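(* Let $|v(x)|\lesssim\langle x\rangle^{-4-}$. Let $\phi\in S_1L^2(\mathbb R^4)$ and let $\psi=c_0-G_1v\phi$ with $c_0=\frac1{\|V\|_{L^1}}\int_{\mathbb R^4}v\,T\phi\,dx$, so that $\phi=Uv\psi$. Then $\phi\in S_4L^2$ if and only if $\psi\in L^2(\mathbb R^4)$.
   Context: $V:\mathbb R^4\to\mathbb R$ is a real-valued potential, not a.e. zero, and $H=(-\Delta)^2+V$. $U(x)=1$ if $V(x)\ge0$ and $U(x)=-1$ if $V(x)<0$; $v=|V|^{1/2}$. $\langle x\rangle=(1+|x|^2)^{1/2}$, and $|v(x)|\lesssim\langle x\rangle^{-a-}$ means $|v(x)|\le C\langle x\rangle^{-a-\epsilon}$ for some $C,\epsilon>0$. $P$ is the orthogonal projection in $L^2(\mathbb R^4)$ onto the span of $v$, $Q=1-P$. $G_1f(x)=-\frac1{8\pi^2}\int_{\mathbb R^4}\log|x-y|\,f(y)\,dy$; $G_2$ has kernel $c_2|x-y|^2$ and $G_4$ has kernel $c_4|x-y|^4$, with $c_2,c_4$ nonzero real constants whose values are immaterial here. $T=U+vG_1v$. $S_1$ is the orthogonal projection onto the kernel of $QTQ$ on $QL^2$ (a finite-rank projection); $S_2$ onto the kernel of $S_1TPTS_1$ on $S_1L^2$; $S_3$ onto the kernel of $S_2vG_2vS_2$ on $S_2L^2$; $S_4$ onto the kernel of $S_3vG_4vS_3$ on $S_3L^2$. Here $S_jvG_kvS_j$ is the operator on the finite-dimensional space $S_jL^2$ given by the form $(f,g)\mapsto\iint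 v(x)f(x)G_k(x,y)v(y)\overline{g(y)}\,dx\,dy$. *)

theory Defs
  imports "HOL-Analysis.Analysis"
begin

type_synonym R4 = "real^4"

text \<open>
  Elements of \<open>L\<^sup>2\<close> are represented by functions rather than by classes modulo null sets. All
  equations between them are therefore read almost everywhere, and kernels and ranges are
  closed under almost-everywhere equality.
\<close>

definition L2 :: "(R4 \<Rightarrow> complex) set" where
  "L2 = {f \<in> borel_measurable lebesgue. integrable lebesgue (\<lambda>x. (cmod (f x))\<^sup>2)}"

definition l2_inner :: "(R4 \<Rightarrow> complex) \<Rightarrow> (R4 \<Rightarrow> complex) \<Rightarrow> complex" where
  "l2_inner f g = (LINT x|lebesgue. f x * cnj (g x))"

definition range_L2 :: "((R4 \<Rightarrow> complex) \<Rightarrow> (R4 \<Rightarrow> complex)) \<Rightarrow> (R4 \<Rightarrow> complex) set" where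
  "range_L2 A = {g \<in> L2. \<exists>f\<in>L2. AE x in lebesgue. g x = A f x}"

definition kernel_on ::
    "((R4 \<Rightarrow> complex) \<Rightarrow> (R4 \<Rightarrow> complex)) \<Rightarrow> (R4 \<Rightarrow> complex) set \<Rightarrow> (R4 \<Rightarrow> complex) set" where
  "kernel_on A M = {f \<in> M. AE x in lebesgue. A f x = 0}"

text \<open>The value of the projection is determined only up to a null set; some representative is chosen.\<close>

definition orth_proj :: "(R4 \<Rightarrow> complex) set \<Rightarrow> (R4 \<Rightarrow> complex) \<Rightarrow> (R4 \<Rightarrow> complex)" where
  "orth_proj M f = (SOME g. g \<in> M \<and> (\<forall>h\<in>M. l2_inner (\<lambda>x. f x - g x) h = 0))"

text \<open>
  The operator \<open>A\<close> on \<open>M\<close> given by a sesquilinear form \<open>B\<close>, that is,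
  \<open>\<langle>A f, g\<rangle> = B f g\<close> for all \<open>f, g\<close> in \<open>M\<close>.
\<close>

definition form_operator ::
    "(R4 \<Rightarrow> complex) set \<Rightarrow> ((R4 \<Rightarrow> complex) \<Rightarrow> (R4 \<Rightarrow> complex) \<Rightarrow> complex)
      \<Rightarrow> (R4 \<Rightarrow> complex) \<Rightarrow> (R4 \<Rightarrow> complex)" where
  "form_operator M B f = (SOME h. h \<in> M \<and> (\<forall>g\<in>M. l2_inner h g = B f g))"

definition japanese_bracket :: "R4 \<Rightarrow> real" where
  "japanese_bracket x = sqrt (1 + (norm x)\<^sup>2)"

text \<open>Decay with some power strictly larger than \<open>a\<close>.\<close>

definition decays_faster :: "(R4 \<Rightarrow> real) \<Rightarrow> real \<Rightarrow> bool" where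
  "decays_faster w a \<longleftrightarrow> (\<exists>C \<epsilon>. 0 < C \<and> 0 < \<epsilon> \<and>
     (AE x in lebesgue. \<bar>w x\<bar> \<le> C * japanese_bracket x powr (- a - \<epsilon>)))"

definition pot_sign :: "(R4 \<Rightarrow> real) \<Rightarrow> R4 \<Rightarrow> real" where
  "pot_sign V x = (if V x \<ge> 0 then 1 else - 1)"

definition pot_root :: "(R4 \<Rightarrow> real) \<Rightarrow> R4 \<Rightarrow> real" where
  "pot_root V x = sqrt \<bar>V x\<bar>"

definition G1 :: "(R4 \<Rightarrow> complex) \<Rightarrow> (R4 \<Rightarrow> complex)" where
  "G1 f x = - (1 / (8 * pi\<^sup>2)) *\<^sub>R (LINT y|lebesgue. ln (norm (x - y)) *\<^sub>R f y)"

definition mult_op :: "(R4 \<Rightarrow> real) \<Rightarrow> (R4 \<Rightarrow> complex) \<Rightarrow> (R4 \<Rightarrow> complex)" where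
  "mult_op w f x = w x *\<^sub>R f x"

definition T_op :: "(R4 \<Rightarrow> real) \<Rightarrow> (R4 \<Rightarrow> complex) \<Rightarrow> (R4 \<Rightarrow> complex)" where
  "T_op V f x = mult_op (pot_sign V) f x + mult_op (pot_root V) (G1 (mult_op (pot_root V) f)) x"

definition P_op :: "(R4 \<Rightarrow> real) \<Rightarrow> (R4 \<Rightarrow> complex) \<Rightarrow> (R4 \<Rightarrow> complex)" where
  "P_op V = orth_proj {g \<in> L2. \<exists>a::complex. AE x in lebesgue. g x = a * of_real (pot_root V x)}"

definition Q_op :: "(R4 \<Rightarrow> real) \<Rightarrow> (R4 \<Rightarrow> complex) \<Rightarrow> (R4 \<Rightarrow> complex)" where
  "Q_op V f x = f x - P_op V f x"

text \<open>The form of \<open>v G v\<close>, where \<open>G\<close> has kernel \<open>c \<bar>x - y\<bar>\<^sup>k\<close>.\<close>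

definition vGv_form ::
    "(R4 \<Rightarrow> real) \<Rightarrow> real \<Rightarrow> nat \<Rightarrow> (R4 \<Rightarrow> complex) \<Rightarrow> (R4 \<Rightarrow> complex) \<Rightarrow> complex" where
  "vGv_form V c k f g =
     (LINT x|lebesgue. LINT y|lebesgue.
        of_real (pot_root V x) * f x * of_real (c * norm (x - y) ^ k)
          * of_real (pot_root V y) * cnj (g y))"

definition S1_op :: "(R4 \<Rightarrow> real) \<Rightarrow> (R4 \<Rightarrow> complex) \<Rightarrow> (R4 \<Rightarrow> complex)" where
  "S1_op V = orth_proj (kernel_on (Q_op V \<circ> T_op V \<circ> Q_op V) (range_L2 (Q_op V)))"

definition S2_op :: "(R4 \<Rightarrow> real) \<Rightarrow> (R4 \<Rightarrow> complex) \<Rightarrow> (R4 \<Rightarrow> complex)" where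
  "S2_op V = orth_proj
     (kernel_on (S1_op V \<circ> T_op V \<circ> P_op V \<circ> T_op V \<circ> S1_op V) (range_L2 (S1_op V)))"

definition S3_op :: "(R4 \<Rightarrow> real) \<Rightarrow> real \<Rightarrow> (R4 \<Rightarrow> complex) \<Rightarrow> (R4 \<Rightarrow> complex)" where
  "S3_op V c2 = orth_proj
     (kernel_on (form_operator (range_L2 (S2_op V)) (vGv_form V c2 2)) (range_L2 (S2_op V)))"

definition S4_op :: "(R4 \<Rightarrow> real) \<Rightarrow> real \<Rightarrow> real \<Rightarrow> (R4 \<Rightarrow> complex) \<Rightarrow> (R4 \<Rightarrow> complex)" where
  "S4_op V c2 c4 = orth_proj
     (kernel_on (form_operator (range_L2 (S3_op V c2)) (vGv_form V c4 4))
        (range_L2 (S3_op V c2)))"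

end

theory Submission
  imports Defs
begin

text \<open>
  Write \<open>f\<close> for an element of \<open>S\<^sub>1L\<^sup>2\<close>. The four nested spaces turn out to have concrete descriptions:
  \<open>S\<^sub>1L\<^sup>2\<close> consists of the \<open>f\<close> orthogonal to \<open>v\<close> with \<open>T f = c v\<close> for a constant \<open>c\<close>;
  \<open>S\<^sub>2L\<^sup>2\<close> adds \<open>c = 0\<close>; \<open>S\<^sub>3L\<^sup>2\<close> adds that the first moments of \<open>v f\<close> vanish; and \<open>S\<^sub>4L\<^sup>2\<close> adds
  that all second moments of \<open>v f\<close> vanish. On the other hand \<open>\<psi> = c - G\<^sub>1 (v f)\<close>, and expanding
  \<open>log \<bar>x - y\<bar>\<close> to second order in \<open>y\<close> gives, since \<open>v f\<close> has integral zero,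
  \<open>\<psi>(x) = c + dipole(x) + quadrupole(x) + O(\<bar>x\<bar>\<^sup>-\<^sup>3)\<close> up to constant factors,
  where the dipole is homogeneous of degree \<open>-1\<close> with the first moments as coefficients, and the
  quadrupole is homogeneous of degree \<open>-2\<close> with the second moments as coefficients. In dimension four a
  nonzero continuous homogeneous function of degree \<open>0\<close>, \<open>-1\<close> or \<open>-2\<close> is not square integrable at infinity, whereas
  \<open>O(\<bar>x\<bar>\<^sup>-\<^sup>3)\<close> is. So \<open>\<psi>\<close> is square integrable exactly if \<open>c\<close>, the dipole and the quadrupole vanish
  (\<open>homogeneous_leading_term_vanishes\<close>, \<open>resonance_expansion\<close>), and a vanishing quadrupole forces
  all second moments to vanish (\<open>quadrupole_injective\<close>).

  The description of the spaces rests on three facts. The equation \<open>T f = c v\<close> says \<open>f = U v \<psi>\<close> with \<open>\<psi>\<close>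
  bounded, so \<open>v f\<close> decays like \<open>v\<^sup>2\<close> and has enough moments
  (\<open>S1_space_representation\<close>, \<open>S1_space_decay\<close>). The operator \<open>T\<close> is
  self-adjoint, so the form of \<open>S\<^sub>1TPTS\<^sub>1\<close> at \<open>f\<close> is \<open>\<bar>c\<bar>\<^sup>2 \<parallel>v\<parallel>\<^sup>2\<close> (\<open>kernel_S1TPTS1\<close>). Finally \<open>\<bar>x - y\<bar>\<^sup>2\<close>
  and \<open>\<bar>x - y\<bar>\<^sup>4\<close> are finite sums of products of monomials, which turns the forms of \<open>vG\<^sub>2v\<close> and \<open>vG\<^sub>4v\<close>
  into sums of squares of first and of second moments (\<open>vGv_form_two\<close>, \<open>vGv_form_four\<close>).

  The projections and the operators given by forms are chosen by description, so their existence has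
  to be secured. All spaces below \<open>S\<^sub>1L\<^sup>2\<close> are finite-dimensional because orthonormal families in \<open>S\<^sub>1L\<^sup>2\<close>
  have bounded length: Bessel's inequality applied to the kernel of \<open>vG\<^sub>1v\<close> bounds the sum of the
  \<open>\<bar>e\<^sub>i(x)\<bar>\<^sup>2\<close> by a multiple of \<open>v(x)\<^sup>2\<close> (\<open>S1_space_findim\<close>).
\<close>

section \<open>Square-integrable functions\<close>

lemma L2_measurable: "f \<in> L2 \<Longrightarrow> f \<in> borel_measurable lebesgue"
  by (simp add: L2_def)

lemma L2_norm_sq_integrable: "f \<in> L2 \<Longrightarrow> integrable lebesgue (\<lambda>x. (cmod (f x))\<^sup>2)"
  by (simp add: L2_def)

lemma L2_dominated:
  assumes "f \<in> borel_measurable lebesgue" "integrable lebesgue g"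
    and "AE x in lebesgue. (cmod (f x))\<^sup>2 \<le> g x"
  shows "f \<in> L2"
proof -
  have "integrable lebesgue (\<lambda>x. (cmod (f x))\<^sup>2)"
    by (rule Bochner_Integration.integrable_bound[OF assms(2)])
       (use assms in \<open>auto intro: AE_mp\<close>)
  then show ?thesis using assms by (simp add: L2_def)
qed

lemma L2_zero: "(\<lambda>x. 0) \<in> L2"
  by (simp add: L2_def)

lemma L2_scale: "f \<in> L2 \<Longrightarrow> (\<lambda>x. a * f x) \<in> L2"
  by (auto simp: L2_def norm_mult power_mult_distrib)

lemma norm_add_sq_le: "(cmod (a + b))\<^sup>2 \<le> 2 * (cmod a)\<^sup>2 + 2 * (cmod b)\<^sup>2"
proof -
  have "(cmod (a + b))\<^sup>2 \<le> (cmod a + cmod b)\<^sup>2"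
    by (intro power_mono norm_triangle_ineq) auto
  also have "\<dots> \<le> 2 * (cmod a)\<^sup>2 + 2 * (cmod b)\<^sup>2"
    using zero_le_power2[of "cmod a - cmod b"] by (simp add: power2_eq_square algebra_simps)
  finally show ?thesis .
qed

lemma mult_le_sum_squares:
  fixes a b :: real
  assumes "0 \<le> a" "0 \<le> b" shows "a * b \<le> a\<^sup>2 + b\<^sup>2"
  using sum_squares_ge_zero[of a b] zero_le_power2[of "a - b"] mult_nonneg_nonneg[OF assms]
  by (simp add: power2_eq_square algebra_simps)

lemma L2_add:
  assumes "f \<in> L2" "g \<in> L2" shows "(\<lambda>x. f x + g x) \<in> L2"
proof (rule L2_dominated)
  show "integrable lebesgue (\<lambda>x. 2 * (cmod (f x))\<^sup>2 + 2 * (cmod (g x))\<^sup>2)"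
    using assms by (auto simp: L2_def)
  show "AE x in lebesgue. (cmod (f x + g x))\<^sup>2 \<le> 2 * (cmod (f x))\<^sup>2 + 2 * (cmod (g x))\<^sup>2"
    by (simp add: norm_add_sq_le)
qed (use assms in \<open>auto simp: L2_def\<close>)

lemma L2_diff: "f \<in> L2 \<Longrightarrow> g \<in> L2 \<Longrightarrow> (\<lambda>x. f x - g x) \<in> L2"
  using L2_add[of f "\<lambda>x. - 1 * g x"] L2_scale[of g "- 1"] by simp

lemma L2_sum:
  "(\<And>i. i < n \<Longrightarrow> e i \<in> L2) \<Longrightarrow> (\<lambda>x. \<Sum>i<n. a i * e i x) \<in> L2" for n :: nat
  by (induction n) (auto intro!: L2_add L2_scale L2_zero)

lemma L2_mult_integrable:
  assumes "f \<in> L2" "g \<in> L2"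
  shows "integrable lebesgue (\<lambda>x. f x * g x)"
proof (rule Bochner_Integration.integrable_bound)
  show "integrable lebesgue (\<lambda>x. (cmod (f x))\<^sup>2 + (cmod (g x))\<^sup>2)"
    using assms by (auto simp: L2_def)
  show "AE x in lebesgue. norm (f x * g x) \<le> norm ((cmod (f x))\<^sup>2 + (cmod (g x))\<^sup>2)"
    by (simp add: norm_mult mult_le_sum_squares)
qed (use assms in \<open>auto simp: L2_def\<close>)

lemma L2_cnj: "f \<in> L2 \<Longrightarrow> (\<lambda>x. cnj (f x)) \<in> L2"
proof -
  assume f: "f \<in> L2"
  have "(\<lambda>x. cnj (f x)) \<in> borel_measurable lebesgue"
    using L2_measurable[OF f] by (intro borel_measurable_continuous_on[where f=cnj]) (auto intro: continuous_intros)
  then show ?thesis using f by (simp add: L2_def)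
qed

lemma l2_inner_integrable:
  "f \<in> L2 \<Longrightarrow> g \<in> L2 \<Longrightarrow> integrable lebesgue (\<lambda>x. f x * cnj (g x))"
  by (rule L2_mult_integrable[OF _ L2_cnj])

text \<open>
  A weak form of the Cauchy--Schwarz inequality; a bound by squared norms is enough wherever only
  finiteness and uniformity in a parameter matter.
\<close>

lemma l2_inner_norm_bound:
  assumes "f \<in> L2" "g \<in> L2"
  shows "cmod (l2_inner f g) \<le> (LINT x|lebesgue. (cmod (f x))\<^sup>2) + (LINT x|lebesgue. (cmod (g x))\<^sup>2)"
    and "(LINT x|lebesgue. norm (f x * cnj (g x))) \<le> (LINT x|lebesgue. (cmod (f x))\<^sup>2) + (LINT x|lebesgue. (cmod (g x))\<^sup>2)"
proof -
  note i = l2_inner_integrable[OF assms] and fi = L2_norm_sq_integrable[OF assms(1)]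
    and gi = L2_norm_sq_integrable[OF assms(2)]
  have "(LINT x|lebesgue. norm (f x * cnj (g x))) \<le> (LINT x|lebesgue. (cmod (f x))\<^sup>2 + (cmod (g x))\<^sup>2)"
    by (rule integral_mono[OF integrable_norm[OF i] Bochner_Integration.integrable_add[OF fi gi]])
       (simp add: norm_mult mult_le_sum_squares)
  also have "\<dots> = (LINT x|lebesgue. (cmod (f x))\<^sup>2) + (LINT x|lebesgue. (cmod (g x))\<^sup>2)"
    by (rule Bochner_Integration.integral_add[OF fi gi])
  finally show *: "(LINT x|lebesgue. norm (f x * cnj (g x)))
    \<le> (LINT x|lebesgue. (cmod (f x))\<^sup>2) + (LINT x|lebesgue. (cmod (g x))\<^sup>2)" .
  have "cmod (l2_inner f g) \<le> (LINT x|lebesgue. norm (f x * cnj (g x)))"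
    unfolding l2_inner_def by (rule integral_norm_bound)
  then show "cmod (l2_inner f g) \<le> (LINT x|lebesgue. (cmod (f x))\<^sup>2) + (LINT x|lebesgue. (cmod (g x))\<^sup>2)"
    using * by simp
qed

lemma l2_inner_cong_AE:
  assumes "f \<in> L2" "f' \<in> L2" "g \<in> L2" "g' \<in> L2"
    and "AE x in lebesgue. f x = f' x" "AE x in lebesgue. g x = g' x"
  shows "l2_inner f g = l2_inner f' g'"
  unfolding l2_inner_def
proof (rule integral_cong_AE)
  show "AE x in lebesgue. f x * cnj (g x) = f' x * cnj (g' x)"
    using assms(5,6) by eventually_elim auto
qed (use assms in \<open>auto intro: borel_measurable_integrable l2_inner_integrable\<close>)

lemma l2_inner_add_left:
  "f \<in> L2 \<Longrightarrow> g \<in> L2 \<Longrightarrow> h \<in> L2 \<Longrightarrow> l2_inner (\<lambda>x. f x + g x) h = l2_inner f h + l2_inner g h"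
  unfolding l2_inner_def
  by (simp add: distrib_right Bochner_Integration.integral_add l2_inner_integrable)

lemma l2_inner_diff_left:
  "f \<in> L2 \<Longrightarrow> g \<in> L2 \<Longrightarrow> h \<in> L2 \<Longrightarrow> l2_inner (\<lambda>x. f x - g x) h = l2_inner f h - l2_inner g h"
  unfolding l2_inner_def
  by (simp add: left_diff_distrib Bochner_Integration.integral_diff l2_inner_integrable)

lemma l2_inner_scale_left: "l2_inner (\<lambda>x. a * f x) h = a * l2_inner f h"
  unfolding l2_inner_def by (simp add: mult.assoc)

lemma l2_inner_cnj: "cnj (l2_inner f g) = l2_inner g f"
proof -
  have "cnj (l2_inner f g) = (LINT x|lebesgue. cnj (f x * cnj (g x)))"
    unfolding l2_inner_def by (simp only: Bochner_Integration.integral_cnj)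
  then show ?thesis by (simp add: l2_inner_def mult.commute)
qed

lemma l2_inner_scale_right: "l2_inner f (\<lambda>x. a * g x) = cnj a * l2_inner f g"
  using l2_inner_scale_left[of a g f, THEN arg_cong[where f=cnj]]
  by (simp only: complex_cnj_mult l2_inner_cnj)

lemma l2_inner_add_right:
  assumes "f \<in> L2" "g \<in> L2" "h \<in> L2"
  shows "l2_inner h (\<lambda>x. f x + g x) = l2_inner h f + l2_inner h g"
  using arg_cong[OF l2_inner_add_left[OF assms], of cnj]
  by (simp only: complex_cnj_add l2_inner_cnj)

lemma l2_inner_zero_left: "l2_inner (\<lambda>x. 0) f = 0"
  by (simp add: l2_inner_def)

lemma l2_inner_sum_left:
  fixes n :: nat
  shows "(\<And>i. i < n \<Longrightarrow> e i \<in> L2) \<Longrightarrow> h \<in> L2 \<Longrightarrow>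
    l2_inner (\<lambda>x. \<Sum>i<n. a i * e i x) h = (\<Sum>i<n. a i * l2_inner (e i) h)"
  by (induction n)
     (auto simp: l2_inner_zero_left l2_inner_add_left L2_sum L2_scale l2_inner_scale_left)

lemma l2_inner_sum_right:
  fixes n :: nat
  assumes "\<And>i. i < n \<Longrightarrow> e i \<in> L2" "h \<in> L2"
  shows "l2_inner h (\<lambda>x. \<Sum>i<n. a i * e i x) = (\<Sum>i<n. cnj (a i) * l2_inner h (e i))"
proof -
  have "l2_inner h (\<lambda>x. \<Sum>i<n. a i * e i x) = cnj (l2_inner (\<lambda>x. \<Sum>i<n. a i * e i x) h)"
    by (simp add: l2_inner_cnj)
  also have "\<dots> = (\<Sum>i<n. cnj (a i) * l2_inner h (e i))"
    by (subst l2_inner_sum_left) (use assms in \<open>auto simp: cnj_sum l2_inner_cnj\<close>)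
  finally show ?thesis .
qed

lemma l2_inner_self: "l2_inner f f = of_real (LINT x|lebesgue. (cmod (f x))\<^sup>2)"
  unfolding l2_inner_def by (simp add: complex_norm_square[symmetric] del: of_real_power)

lemma l2_inner_self_eq_0:
  assumes "f \<in> L2"
  shows "l2_inner f f = 0 \<longleftrightarrow> (AE x in lebesgue. f x = 0)"
proof -
  have "l2_inner f f = 0 \<longleftrightarrow> (LINT x|lebesgue. (cmod (f x))\<^sup>2) = 0"
    by (simp add: l2_inner_self)
  also have "\<dots> \<longleftrightarrow> (AE x in lebesgue. (cmod (f x))\<^sup>2 = 0)"
    by (rule integral_nonneg_eq_0_iff_AE) (use assms in \<open>auto simp: L2_def\<close>)
  finally show ?thesis by simp
qed

section \<open>Finite-dimensional subspaces and their projections\<close>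

definition l2_orthonormal :: "nat \<Rightarrow> (nat \<Rightarrow> R4 \<Rightarrow> complex) \<Rightarrow> bool" where
  "l2_orthonormal n e \<longleftrightarrow> (\<forall>i<n. e i \<in> L2) \<and>
     (\<forall>i<n. \<forall>j<n. l2_inner (e i) (e j) = (if i = j then 1 else 0))"

lemma l2_residual_orthogonal:
  assumes e: "l2_orthonormal n e" and f: "f \<in> L2" and j: "j < n"
  shows "l2_inner (\<lambda>x. f x - (\<Sum>i<n. l2_inner f (e i) * e i x)) (e j) = 0"
proof -
  have eL: "e i \<in> L2" if "i < n" for i using e that by (simp add: l2_orthonormal_def)
  have "(\<Sum>i<n. l2_inner f (e i) * l2_inner (e i) (e j)) = (\<Sum>i<n. if i = j then l2_inner f (e j) else 0)"
    by (rule sum.cong) (use e j in \<open>auto simp: l2_orthonormal_def\<close>)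
  then show ?thesis using j
    by (simp add: l2_inner_diff_left f L2_sum eL l2_inner_sum_left)
qed

text \<open>
  The residual of \<open>f\<close> after subtracting its orthogonal expansion is orthogonal to the expansion, so
  its squared norm is the difference of the two sides.
\<close>

lemma l2_bessel:
  assumes e: "l2_orthonormal n e" and f: "f \<in> L2"
  shows "(\<Sum>i<n. (cmod (l2_inner f (e i)))\<^sup>2) \<le> (LINT x|lebesgue. (cmod (f x))\<^sup>2)"
proof -
  have eL: "e i \<in> L2" if "i < n" for i using e that by (simp add: l2_orthonormal_def)
  define g where "g = (\<lambda>x. \<Sum>i<n. l2_inner f (e i) * e i x)"
  have gL: "g \<in> L2" unfolding g_def by (rule L2_sum) (rule eL)
  have rL: "(\<lambda>x. f x - g x) \<in> L2" by (rule L2_diff[OF f gL])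
  have rg: "l2_inner (\<lambda>x. f x - g x) g = 0"
  proof -
    have "l2_inner (\<lambda>x. f x - g x) g
      = (\<Sum>i<n. cnj (l2_inner f (e i)) * l2_inner (\<lambda>x. f x - g x) (e i))"
      unfolding g_def by (subst l2_inner_sum_right) (use eL rL in \<open>auto simp: g_def\<close>)
    also have "\<dots> = 0" unfolding g_def using l2_residual_orthogonal[OF e f] by simp
    finally show ?thesis .
  qed
  have fg: "l2_inner f g = of_real (\<Sum>i<n. (cmod (l2_inner f (e i)))\<^sup>2)"
    unfolding g_def by (subst l2_inner_sum_right)
      (use eL f in \<open>auto simp: mult.commute complex_norm_square simp del: of_real_power\<close>)
  have gr: "l2_inner g (\<lambda>x. f x - g x) = 0"
    using arg_cong[OF rg, of cnj] by (simp only: l2_inner_cnj complex_cnj_zero)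
  have "l2_inner (\<lambda>x. f x - g x) (\<lambda>x. f x - g x) = l2_inner f (\<lambda>x. f x - g x)"
    by (simp only: l2_inner_diff_left[OF f gL rL] gr diff_zero)
  also have "\<dots> = cnj (l2_inner (\<lambda>x. f x - g x) f)" by (simp only: l2_inner_cnj)
  also have "\<dots> = cnj (l2_inner f f) - cnj (l2_inner g f)"
    by (simp only: l2_inner_diff_left[OF f gL f] complex_cnj_diff)
  also have "\<dots> = l2_inner f f - l2_inner f g" by (simp only: l2_inner_cnj)
  finally have "of_real (LINT x|lebesgue. (cmod (f x - g x))\<^sup>2)
    = complex_of_real ((LINT x|lebesgue. (cmod (f x))\<^sup>2) - (\<Sum>i<n. (cmod (l2_inner f (e i)))\<^sup>2))"
    unfolding fg l2_inner_self by simp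
  then have "(LINT x|lebesgue. (cmod (f x - g x))\<^sup>2)
    = (LINT x|lebesgue. (cmod (f x))\<^sup>2) - (\<Sum>i<n. (cmod (l2_inner f (e i)))\<^sup>2)"
    using of_real_eq_iff by blast
  moreover have "(LINT x|lebesgue. (cmod (f x - g x))\<^sup>2) \<ge> 0" by simp
  ultimately show ?thesis by linarith
qed

text \<open>
  Elements of \<open>L\<^sup>2\<close> are functions, so a subspace is also required to be closed under
  almost-everywhere equality.
\<close>

definition l2_subspace :: "(R4 \<Rightarrow> complex) set \<Rightarrow> bool" where
  "l2_subspace M \<longleftrightarrow> M \<subseteq> L2 \<and> (\<lambda>x. 0) \<in> M
     \<and> (\<forall>f\<in>M. \<forall>g\<in>M. (\<lambda>x. f x + g x) \<in> M) \<and> (\<forall>f\<in>M. \<forall>a. (\<lambda>x. a * f x) \<in> M)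
     \<and> (\<forall>f\<in>M. \<forall>g\<in>L2. (AE x in lebesgue. f x = g x) \<longrightarrow> g \<in> M)"

lemma l2_subspaceD:
  assumes "l2_subspace M"
  shows "f \<in> M \<Longrightarrow> f \<in> L2" "(\<lambda>x. 0) \<in> M"
    "f \<in> M \<Longrightarrow> g \<in> M \<Longrightarrow> (\<lambda>x. f x + g x) \<in> M"
    "f \<in> M \<Longrightarrow> (\<lambda>x. a * f x) \<in> M"
    "f \<in> M \<Longrightarrow> g \<in> L2 \<Longrightarrow> AE x in lebesgue. f x = g x \<Longrightarrow> g \<in> M"
  using assms unfolding l2_subspace_def by auto

lemma l2_subspace_diff:
  assumes "l2_subspace M" "f \<in> M" "g \<in> M" shows "(\<lambda>x. f x - g x) \<in> M"
  using l2_subspaceD(3)[OF assms(1,2) l2_subspaceD(4)[OF assms(1,3), of "- 1"]] by simp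

lemma l2_subspace_sum:
  fixes n :: nat
  assumes M: "l2_subspace M"
  shows "(\<And>i. i < n \<Longrightarrow> e i \<in> M) \<Longrightarrow> (\<lambda>x. \<Sum>i<n. a i * e i x) \<in> M"
  by (induction n) (simp_all add: l2_subspaceD(2,3,4)[OF M])

text \<open>
  Finite dimension, expressed by a bound on the length of orthonormal families. In this form it passes
  trivially to subspaces and is what Bessel's inequality delivers.
\<close>

definition l2_findim :: "(R4 \<Rightarrow> complex) set \<Rightarrow> bool" where
  "l2_findim M \<longleftrightarrow> (\<exists>N. \<forall>n e. l2_orthonormal n e \<longrightarrow> (\<forall>i<n. e i \<in> M) \<longrightarrow> n \<le> N)"

lemma l2_findim_mono:
  assumes "l2_findim M" "M' \<subseteq> M" shows "l2_findim M'"
proof -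
  from assms(1)[unfolded l2_findim_def] obtain N
    where "\<forall>n e. l2_orthonormal n e \<longrightarrow> (\<forall>i<n. e i \<in> M) \<longrightarrow> n \<le> N" by (elim exE)
  then have "\<forall>n e. l2_orthonormal n e \<longrightarrow> (\<forall>i<n. e i \<in> M') \<longrightarrow> n \<le> N"
    using assms(2) by (simp add: subset_iff)
  then show ?thesis unfolding l2_findim_def by (rule exI)
qed

text \<open>
  Normalising a nonzero vector orthogonal to the family lengthens the family by one.
\<close>

lemma l2_orthonormal_extend:
  assumes e: "l2_orthonormal n e" and r: "r \<in> L2" and r0: "\<not> (AE x in lebesgue. r x = 0)"
    and ort: "\<And>i. i < n \<Longrightarrow> l2_inner r (e i) = 0"
  shows "\<exists>a. l2_orthonormal (Suc n) (e(n := (\<lambda>x. a * r x)))"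
proof -
  define s where "s = (LINT x|lebesgue. (cmod (r x))\<^sup>2)"
  have rr: "l2_inner r r = of_real s" by (simp add: l2_inner_self s_def)
  have "s \<ge> 0" by (simp add: s_def)
  moreover have "s \<noteq> 0" using l2_inner_self_eq_0[OF r] r0 rr by simp
  ultimately have s: "s > 0" by simp
  define a where "a = complex_of_real (1 / sqrt s)"
  have "l2_inner (\<lambda>x. a * r x) (\<lambda>x. a * r x) = a * cnj a * of_real s"
    by (simp add: l2_inner_scale_left l2_inner_scale_right rr)
  also have "\<dots> = 1" using s unfolding a_def by (simp flip: of_real_mult add: field_simps)
  finally have "l2_inner (\<lambda>x. a * r x) (\<lambda>x. a * r x) = 1" .
  moreover have "l2_inner (e i) r = 0" if "i < n" for i
    using ort[OF that] l2_inner_cnj[of r "e i"] by simp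
  ultimately have "l2_orthonormal (Suc n) (e(n := (\<lambda>x. a * r x)))"
    using e ort r unfolding l2_orthonormal_def
    by (auto simp: less_Suc_eq l2_inner_scale_left l2_inner_scale_right L2_scale mult.left_commute)
  then show ?thesis by (rule exI)
qed

text \<open>
  An orthonormal family of maximal length is a basis: a nonzero residual could be normalised and added
  to it.
\<close>

lemma l2_findim_basis:
  assumes M: "l2_subspace M" and fd: "l2_findim M"
  shows "\<exists>n e. l2_orthonormal n e \<and> (\<forall>i<n. e i \<in> M)
    \<and> (\<forall>f\<in>M. AE x in lebesgue. f x = (\<Sum>i<n. l2_inner f (e i) * e i x))"
proof -
  define S where "S = {n. \<exists>e. l2_orthonormal n e \<and> (\<forall>i<n. e i \<in> M)}"
  obtain N where N: "\<And>n. n \<in> S \<Longrightarrow> n \<le> N"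
    using fd unfolding l2_findim_def S_def by auto
  have "0 \<in> S" by (auto simp: S_def l2_orthonormal_def)
  then obtain n where nS: "n \<in> S" and nmax: "\<And>m. m \<in> S \<Longrightarrow> m \<le> n"
    using N Nat.ex_has_greatest_nat[of "\<lambda>m. m \<in> S" 0 N] by auto
  obtain e where e: "l2_orthonormal n e" and eM: "\<And>i. i < n \<Longrightarrow> e i \<in> M"
    using nS by (auto simp: S_def)
  have "\<forall>f\<in>M. AE x in lebesgue. f x = (\<Sum>i<n. l2_inner f (e i) * e i x)"
  proof
    fix f assume f: "f \<in> M"
    have fL: "f \<in> L2" by (rule l2_subspaceD(1)[OF M f])
    define r where "r = (\<lambda>x. f x - (\<Sum>i<n. l2_inner f (e i) * e i x))"
    have rM: "r \<in> M" unfolding r_def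
      by (rule l2_subspace_diff[OF M f l2_subspace_sum[OF M eM]])
    have rL: "r \<in> L2" by (rule l2_subspaceD(1)[OF M rM])
    have ort: "l2_inner r (e i) = 0" if "i < n" for i
      unfolding r_def by (rule l2_residual_orthogonal[OF e fL that])
    have "AE x in lebesgue. r x = 0"
    proof (rule ccontr)
      assume "\<not> ?thesis"
      then have "\<exists>a. l2_orthonormal (Suc n) (e(n := (\<lambda>x. a * r x)))"
        by (rule l2_orthonormal_extend[OF e rL]) (rule ort)
      then obtain a where "l2_orthonormal (Suc n) (e(n := (\<lambda>x. a * r x)))" by (elim exE)
      moreover have "\<forall>i<Suc n. (e(n := (\<lambda>x. a * r x))) i \<in> M"
        using eM l2_subspaceD(4)[OF M rM] by (auto simp: less_Suc_eq)
      ultimately have "l2_orthonormal (Suc n) (e(n := (\<lambda>x. a * r x))) \<and>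
        (\<forall>i<Suc n. (e(n := (\<lambda>x. a * r x))) i \<in> M)" by (rule conjI)
      then have "Suc n \<in> S" unfolding S_def mem_Collect_eq
        by (rule exI[where x = "e(n := (\<lambda>x. a * r x))"])
      then show False using nmax[of "Suc n"] by simp
    qed
    then show "AE x in lebesgue. f x = (\<Sum>i<n. l2_inner f (e i) * e i x)"
      by (simp add: r_def)
  qed
  with e eM have "l2_orthonormal n e \<and> (\<forall>i<n. e i \<in> M)
    \<and> (\<forall>f\<in>M. AE x in lebesgue. f x = (\<Sum>i<n. l2_inner f (e i) * e i x))"
    by (intro conjI allI impI)
  then show ?thesis by (intro exI)
qed

text \<open>
  Existence of the orthogonal projection onto \<open>M\<close>, without which the choice in \<^const>\<open>orth_proj\<close> says
  nothing.
\<close>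

definition l2_complemented :: "(R4 \<Rightarrow> complex) set \<Rightarrow> bool" where
  "l2_complemented M \<longleftrightarrow> (\<forall>f\<in>L2. \<exists>g\<in>M. \<forall>h\<in>M. l2_inner (\<lambda>x. f x - g x) h = 0)"

text \<open>
  The Riesz representation of a conjugate-linear functional, by expansion in an orthonormal basis.
\<close>

lemma l2_findim_riesz:
  assumes M: "l2_subspace M" and fd: "l2_findim M"
    and add: "\<And>f g. f \<in> M \<Longrightarrow> g \<in> M \<Longrightarrow> L (\<lambda>x. f x + g x) = L f + L g"
    and scale: "\<And>f a. f \<in> M \<Longrightarrow> L (\<lambda>x. a * f x) = cnj a * L f"
    and cong: "\<And>f g. f \<in> M \<Longrightarrow> g \<in> M \<Longrightarrow> AE x in lebesgue. f x = g x \<Longrightarrow> L f = L g"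
  shows "\<exists>h\<in>M. \<forall>g\<in>M. l2_inner h g = L g"
proof -
  from l2_findim_basis[OF M fd] obtain n e where e: "l2_orthonormal n e"
    and eM': "\<forall>i<n. e i \<in> M"
    and ex': "\<forall>f\<in>M. AE x in lebesgue. f x = (\<Sum>i<n. l2_inner f (e i) * e i x)"
    by (elim exE conjE)
  note eM = eM'[rule_format] and ex = bspec[OF ex']
  have eL: "e i \<in> L2" if "i < n" for i using l2_subspaceD(1)[OF M eM[OF that]] .
  have Lsum: "k \<le> n \<Longrightarrow> L (\<lambda>x. \<Sum>i<k. a i * e i x) = (\<Sum>i<k. cnj (a i) * L (e i))" for a k
  proof (induction k)
    case 0
    show ?case using scale[OF l2_subspaceD(2)[OF M], of 0] by simp
  next
    case (Suc k)
    have s: "(\<lambda>x. \<Sum>i<k. a i * e i x) \<in> M"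
      by (rule l2_subspace_sum[OF M]) (use eM Suc.prems in auto)
    have k: "e k \<in> M" using eM Suc.prems by auto
    have "L (\<lambda>x. \<Sum>i<Suc k. a i * e i x) = L (\<lambda>x. \<Sum>i<k. a i * e i x) + cnj (a k) * L (e k)"
      using add[OF s l2_subspaceD(4)[OF M k, of "a k"]] scale[OF k, of "a k"] by simp
    then show ?case using Suc by simp
  qed
  define h where "h = (\<lambda>x. \<Sum>i<n. L (e i) * e i x)"
  have "l2_inner h g = L g" if g: "g \<in> M" for g
  proof -
    have gL: "g \<in> L2" by (rule l2_subspaceD(1)[OF M g])
    have "L g = L (\<lambda>x. \<Sum>i<n. l2_inner g (e i) * e i x)"
      by (rule cong[OF g l2_subspace_sum[OF M eM] ex[OF g]])
    also have "\<dots> = (\<Sum>i<n. L (e i) * l2_inner (e i) g)"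
      by (subst Lsum) (auto simp: l2_inner_cnj mult.commute)
    also have "\<dots> = l2_inner h g"
      unfolding h_def by (rule l2_inner_sum_left[symmetric]) (use eL gL in auto)
    finally show ?thesis by simp
  qed
  moreover have "h \<in> M" unfolding h_def by (rule l2_subspace_sum[OF M eM])
  ultimately show ?thesis by blast
qed

lemma l2_findim_complemented:
  assumes M: "l2_subspace M" and fd: "l2_findim M"
  shows "l2_complemented M"
  unfolding l2_complemented_def
proof
  fix f assume f: "f \<in> L2"
  have "\<exists>h\<in>M. \<forall>g\<in>M. l2_inner h g = l2_inner f g"
  proof (rule l2_findim_riesz[OF M fd, where L = "l2_inner f"])
    fix g g' assume "g \<in> M" "g' \<in> M" "AE x in lebesgue. g x = g' x"
    then show "l2_inner f g = l2_inner f g'"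
      by (intro l2_inner_cong_AE) (auto simp: f l2_subspaceD(1)[OF M])
  qed (simp_all add: l2_inner_add_right l2_inner_scale_right f l2_subspaceD(1)[OF M])
  then obtain h where h: "h \<in> M" and hf': "\<forall>g\<in>M. l2_inner h g = l2_inner f g"
    by (elim bexE)
  note hf = bspec[OF hf']
  have "l2_inner (\<lambda>x. f x - h x) g = 0" if g: "g \<in> M" for g
    using hf[OF g] l2_inner_diff_left[OF f l2_subspaceD(1)[OF M h] l2_subspaceD(1)[OF M g]] by simp
  then show "\<exists>g\<in>M. \<forall>h\<in>M. l2_inner (\<lambda>x. f x - g x) h = 0"
    by (intro bexI[OF _ h] ballI)
qed

lemma orth_proj_props:
  assumes M: "l2_complemented M" and f: "f \<in> L2"
  shows "orth_proj M f \<in> M" "h \<in> M \<Longrightarrow> l2_inner (\<lambda>x. f x - orth_proj M f x) h = 0"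
proof -
  have ex: "\<exists>g. g \<in> M \<and> (\<forall>h\<in>M. l2_inner (\<lambda>x. f x - g x) h = 0)"
    using bspec[OF iffD1[OF l2_complemented_def M] f] unfolding Bex_def .
  have p: "orth_proj M f \<in> M \<and> (\<forall>h\<in>M. l2_inner (\<lambda>x. f x - orth_proj M f x) h = 0)"
    by (rule someI_ex[OF ex, folded orth_proj_def])
  show "orth_proj M f \<in> M" by (rule conjunct1[OF p])
  show "h \<in> M \<Longrightarrow> l2_inner (\<lambda>x. f x - orth_proj M f x) h = 0"
    by (rule bspec[OF conjunct2[OF p]])
qed

text \<open>
  Two candidates for the projection differ by an element of \<open>M\<close> that is orthogonal to \<open>M\<close>.
\<close>

lemma orth_proj_unique:
  assumes M: "l2_subspace M" "l2_complemented M" and f: "f \<in> L2" and g: "g \<in> M"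
    and ort: "\<And>h. h \<in> M \<Longrightarrow> l2_inner (\<lambda>x. f x - g x) h = 0"
  shows "AE x in lebesgue. orth_proj M f x = g x"
proof -
  let ?p = "orth_proj M f"
  have p: "?p \<in> M" by (rule orth_proj_props[OF M(2) f])
  have pL: "?p \<in> L2" and gL: "g \<in> L2" using l2_subspaceD(1)[OF M(1)] p g by auto
  define d where "d = (\<lambda>x. ?p x - g x)"
  have d: "d \<in> M" unfolding d_def by (rule l2_subspace_diff[OF M(1) p g])
  have dL: "d \<in> L2" by (rule l2_subspaceD(1)[OF M(1) d])
  have "l2_inner d d = l2_inner (\<lambda>x. f x - g x) d - l2_inner (\<lambda>x. f x - ?p x) d"
    unfolding l2_inner_diff_left[OF f gL dL] l2_inner_diff_left[OF f pL dL]
    using l2_inner_diff_left[OF pL gL dL] by (simp add: d_def)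
  also have "\<dots> = 0" using ort[OF d] orth_proj_props(2)[OF M(2) f d] by simp
  finally have "AE x in lebesgue. d x = 0" using l2_inner_self_eq_0[OF dL] by simp
  then show ?thesis by (simp add: d_def)
qed

lemma orth_proj_ident:
  assumes M: "l2_subspace M" "l2_complemented M" and f: "f \<in> M"
  shows "AE x in lebesgue. orth_proj M f x = f x"
  by (rule orth_proj_unique[OF M l2_subspaceD(1)[OF M(1) f] f]) (simp add: l2_inner_zero_left)

lemma orth_proj_eq_0_iff:
  assumes M: "l2_subspace M" "l2_complemented M" and f: "f \<in> L2"
  shows "(AE x in lebesgue. orth_proj M f x = 0) \<longleftrightarrow> (\<forall>h\<in>M. l2_inner f h = 0)"
proof
  assume z: "AE x in lebesgue. orth_proj M f x = 0"
  have p: "orth_proj M f \<in> M" by (rule orth_proj_props[OF M(2) f])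
  have pL: "orth_proj M f \<in> L2" by (rule l2_subspaceD(1)[OF M(1) p])
  show "\<forall>h\<in>M. l2_inner f h = 0"
  proof
    fix h assume h: "h \<in> M"
    have hL: "h \<in> L2" by (rule l2_subspaceD(1)[OF M(1) h])
    have "l2_inner (orth_proj M f) h = l2_inner (\<lambda>x. 0) h"
      by (rule l2_inner_cong_AE) (use z pL hL L2_zero in auto)
    then show "l2_inner f h = 0"
      using orth_proj_props(2)[OF M(2) f h] by (simp add: l2_inner_diff_left f pL hL l2_inner_zero_left)
  qed
next
  assume "\<forall>h\<in>M. l2_inner f h = 0"
  then show "AE x in lebesgue. orth_proj M f x = 0"
    by (intro orth_proj_unique[OF M f l2_subspaceD(2)[OF M(1)]]) simp
qed

lemma range_orth_proj:
  assumes M: "l2_subspace M" "l2_complemented M"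
  shows "range_L2 (orth_proj M) = M"
proof (intro equalityI subsetI)
  fix g assume "g \<in> range_L2 (orth_proj M)"
  then obtain f where "g \<in> L2" "f \<in> L2" "AE x in lebesgue. g x = orth_proj M f x"
    by (auto simp: range_L2_def)
  then show "g \<in> M"
    using l2_subspaceD(5)[OF M(1) orth_proj_props(1)[OF M(2), of f], of g] by (auto simp: eq_commute)
next
  fix g assume g: "g \<in> M"
  have "AE x in lebesgue. g x = orth_proj M g x"
    using orth_proj_ident[OF M g] by eventually_elim simp
  then show "g \<in> range_L2 (orth_proj M)"
    using l2_subspaceD(1)[OF M(1) g] by (auto simp: range_L2_def)
qed

text \<open>
  By the Riesz representation the operator of the form exists, and then it annihilates \<open>f\<close> exactly if the
  form vanishes at \<open>f\<close> against all of \<open>M\<close>.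
\<close>

lemma kernel_form_operator:
  assumes M: "l2_subspace M" and fd: "l2_findim M"
    and add: "\<And>f g h. f \<in> M \<Longrightarrow> g \<in> M \<Longrightarrow> h \<in> M \<Longrightarrow> B h (\<lambda>x. f x + g x) = B h f + B h g"
    and scale: "\<And>f h a. f \<in> M \<Longrightarrow> h \<in> M \<Longrightarrow> B h (\<lambda>x. a * f x) = cnj a * B h f"
    and cong: "\<And>f g h. f \<in> M \<Longrightarrow> g \<in> M \<Longrightarrow> h \<in> M \<Longrightarrow> AE x in lebesgue. f x = g x \<Longrightarrow> B h f = B h g"
  shows "kernel_on (form_operator M B) M = {f \<in> M. \<forall>g\<in>M. B f g = 0}"
proof -
  have "(AE x in lebesgue. form_operator M B f x = 0) \<longleftrightarrow> (\<forall>g\<in>M. B f g = 0)" if f: "f \<in> M" for f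
  proof -
    let ?h = "form_operator M B f"
    have "\<exists>h\<in>M. \<forall>g\<in>M. l2_inner h g = B f g"
      by (rule l2_findim_riesz[OF M fd, where L = "B f"]) (fact add[OF _ _ f] scale[OF _ f] cong[OF _ _ f])+
    then have ex: "\<exists>h. h \<in> M \<and> (\<forall>g\<in>M. l2_inner h g = B f g)" unfolding Bex_def .
    have p: "?h \<in> M \<and> (\<forall>g\<in>M. l2_inner ?h g = B f g)"
      by (rule someI_ex[OF ex, folded form_operator_def])
    note h = conjunct1[OF p] and hB = bspec[OF conjunct2[OF p]]
    have hL: "?h \<in> L2" by (rule l2_subspaceD(1)[OF M h])
    show ?thesis
    proof
      assume z: "AE x in lebesgue. ?h x = 0"
      show "\<forall>g\<in>M. B f g = 0"
      proof
        fix g assume g: "g \<in> M"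
        have "l2_inner ?h g = l2_inner (\<lambda>x. 0) g"
          by (rule l2_inner_cong_AE) (use z hL l2_subspaceD(1)[OF M g] L2_zero in auto)
        then show "B f g = 0" using hB[OF g] by (simp add: l2_inner_zero_left)
      qed
    next
      assume "\<forall>g\<in>M. B f g = 0"
      then have "l2_inner ?h ?h = 0" using hB[OF h] h by simp
      then show "AE x in lebesgue. ?h x = 0" using l2_inner_self_eq_0[OF hL] by simp
    qed
  qed
  then show ?thesis unfolding kernel_on_def by (intro Collect_cong conj_cong refl)
qed

text \<open>
  The familiar formula for the projection onto a line shows that it exists.
\<close>

lemma span_singleton_complemented:
  assumes u: "u \<in> L2" and u0: "\<not> (AE x in lebesgue. u x = 0)"
  defines "M \<equiv> {g \<in> L2. \<exists>a::complex. AE x in lebesgue. g x = a * u x}"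
  shows "l2_subspace M" "l2_complemented M"
    "f \<in> L2 \<Longrightarrow> AE x in lebesgue. orth_proj M f x = l2_inner f u / l2_inner u u * u x"
proof -
  have uu: "l2_inner u u \<noteq> 0" using l2_inner_self_eq_0[OF u] u0 by simp
  show sub: "l2_subspace M"
    unfolding l2_subspace_def
  proof (intro conjI ballI allI impI)
    show "M \<subseteq> L2" unfolding M_def by auto
    show "(\<lambda>x. 0) \<in> M" unfolding M_def using L2_zero by (auto intro: exI[of _ 0])
  next
    fix f g assume "f \<in> M" "g \<in> M"
    then obtain a b where f: "f \<in> L2" "AE x in lebesgue. f x = a * u x"
      and g: "g \<in> L2" "AE x in lebesgue. g x = b * u x" unfolding M_def by auto
    have "AE x in lebesgue. f x + g x = (a + b) * u x"
      using f(2) g(2) by eventually_elim (simp add: distrib_right)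
    then show "(\<lambda>x. f x + g x) \<in> M" unfolding M_def using L2_add[OF f(1) g(1)] by auto
  next
    fix f c assume "f \<in> M"
    then obtain a where f: "f \<in> L2" "AE x in lebesgue. f x = a * u x" unfolding M_def by auto
    have "AE x in lebesgue. c * f x = (c * a) * u x"
      using f(2) by eventually_elim simp
    then show "(\<lambda>x. c * f x) \<in> M" unfolding M_def using L2_scale[OF f(1), of c] by blast
  next
    fix f g assume "f \<in> M" and g: "g \<in> L2" and fg: "AE x in lebesgue. f x = g x"
    then obtain a where f: "AE x in lebesgue. f x = a * u x" unfolding M_def by auto
    have "AE x in lebesgue. g x = a * u x" using f fg by eventually_elim simp
    then show "g \<in> M" unfolding M_def using g by auto
  qed
  have proj: "(\<lambda>x. l2_inner f u / l2_inner u u * u x) \<in> M" for f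
    unfolding M_def using L2_scale[OF u, of "l2_inner f u / l2_inner u u"] by blast
  have ort: "l2_inner (\<lambda>x. f x - l2_inner f u / l2_inner u u * u x) h = 0"
    if f: "f \<in> L2" and h: "h \<in> M" for f h
  proof -
    obtain b where hL: "h \<in> L2" and hb: "AE x in lebesgue. h x = b * u x"
      using h unfolding M_def by auto
    let ?r = "\<lambda>x. f x - l2_inner f u / l2_inner u u * u x"
    have rL: "?r \<in> L2" by (rule L2_diff[OF f L2_scale[OF u]])
    have "l2_inner ?r h = l2_inner ?r (\<lambda>x. b * u x)"
      by (rule l2_inner_cong_AE) (use rL hL hb L2_scale[OF u] in auto)
    also have "\<dots> = cnj b * (l2_inner f u - l2_inner f u / l2_inner u u * l2_inner u u)"
      by (simp only: l2_inner_scale_right l2_inner_diff_left[OF f L2_scale[OF u] u] l2_inner_scale_left)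
    also have "\<dots> = 0" using uu by simp
    finally show ?thesis .
  qed
  show compl: "l2_complemented M"
    unfolding l2_complemented_def by (intro ballI bexI[OF _ proj]) (rule ort)
  show "AE x in lebesgue. orth_proj M f x = l2_inner f u / l2_inner u u * u x" if f: "f \<in> L2"
    by (rule orth_proj_unique[OF sub compl f proj]) (rule ort[OF f])
qed

section \<open>Integrals of radial weights on four-space\<close>

lemma borel_imp_lebesgue_measurable:
  "f \<in> borel_measurable borel \<Longrightarrow> f \<in> borel_measurable lebesgue"
  by (simp add: measurable_completion)

lemma japanese_bracket_bounds:
  "1 \<le> japanese_bracket x" "norm x \<le> japanese_bracket x" "japanese_bracket x \<le> 1 + norm x"
proof -
  show "1 \<le> japanese_bracket x" by (simp add: japanese_bracket_def)
  show "norm x \<le> japanese_bracket x" unfolding japanese_bracket_def by (rule real_le_rsqrt) simp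
  show "japanese_bracket x \<le> 1 + norm x"
    unfolding japanese_bracket_def by (rule real_le_lsqrt) (auto simp: power2_eq_square algebra_simps)
qed

lemma japanese_bracket_measurable [measurable]: "japanese_bracket \<in> borel_measurable borel"
  unfolding japanese_bracket_def by measurable

text \<open>
  Dyadic balls take the place of polar coordinates: a function dominated by a weighted sum of
  indicators of concentric balls has integral at most the corresponding sum of volumes.
\<close>

lemma nn_integral_ball_cover:
  fixes c :: R4
  assumes nonneg: "\<And>k. 0 \<le> a k" "\<And>k. 0 \<le> r k"
    and cover: "\<And>y. f y \<le> (\<Sum>k. ennreal (a k) * indicator (ball c (r k)) y)"
    and sm: "summable (\<lambda>k. a k * r k ^ 4)"
  shows "(\<integral>\<^sup>+ y. f y \<partial>lebesgue) \<le> ennreal (unit_ball_vol 4 * (\<Sum>k. a k * r k ^ 4))"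
proof -
  have em: "emeasure lebesgue (ball c (r k)) = ennreal (unit_ball_vol 4 * r k ^ 4)" for k
    using emeasure_ball[of "r k" c] nonneg(2) by simp
  have "(\<integral>\<^sup>+ y. f y \<partial>lebesgue) \<le> (\<integral>\<^sup>+ y. (\<Sum>k. ennreal (a k) * indicator (ball c (r k)) y) \<partial>lebesgue)"
    by (rule nn_integral_mono) (rule cover)
  also have "\<dots> = (\<Sum>k. \<integral>\<^sup>+ y. ennreal (a k) * indicator (ball c (r k)) y \<partial>lebesgue)"
    by (rule nn_integral_suminf) (auto intro!: borel_measurable_times_ennreal borel_measurable_indicator)
  also have "\<dots> = (\<Sum>k. ennreal (unit_ball_vol 4 * (a k * r k ^ 4)))"
  proof (rule suminf_cong)
    fix k
    have "(\<integral>\<^sup>+ y. ennreal (a k) * indicator (ball c (r k)) y \<partial>lebesgue)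
        = ennreal (a k) * emeasure lebesgue (ball c (r k))"
      by (rule nn_integral_cmult_indicator) auto
    also have "\<dots> = ennreal (unit_ball_vol 4 * (a k * r k ^ 4))"
      using nonneg by (simp add: em ennreal_mult[symmetric] mult_ac)
    finally show "(\<integral>\<^sup>+ y. ennreal (a k) * indicator (ball c (r k)) y \<partial>lebesgue)
      = ennreal (unit_ball_vol 4 * (a k * r k ^ 4))" .
  qed
  also have "\<dots> = ennreal (\<Sum>k. unit_ball_vol 4 * (a k * r k ^ 4))"
    by (rule suminf_ennreal2) (use nonneg sm in \<open>auto intro!: summable_mult\<close>)
  also have "\<dots> = ennreal (unit_ball_vol 4 * (\<Sum>k. a k * r k ^ 4))"
    using sm by (simp add: suminf_mult)
  finally show ?thesis .
qed

lemma ex_dyadic_interval: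
  fixes t :: real assumes "1 \<le> t" shows "\<exists>k. 2 ^ k \<le> t \<and> t < 2 ^ Suc k"
proof -
  obtain n where n: "t < 2 ^ n" using real_arch_pow[of 2 t] by auto
  define m where "m = (LEAST n. t < 2 ^ n)"
  have m: "t < 2 ^ m" unfolding m_def by (rule LeastI[of _ n]) (rule n)
  with assms obtain k where k: "m = Suc k" by (cases m) auto
  have "\<not> t < 2 ^ k" using not_less_Least[of k "\<lambda>n. t < 2 ^ n"] k m_def by auto
  then have "2 ^ k \<le> t \<and> t < 2 ^ Suc k" using m k by simp
  then show ?thesis by (rule exI)
qed

lemma single_le_suminf_ennreal: "f k \<le> (\<Sum>k. f k)" for f :: "nat \<Rightarrow> ennreal"
  using sum_le_suminf[of f "{k}"] by simp

text \<open>
  On the shell where the bracket is about \<open>2^k\<close> the integrand is at most \<open>2^(-k (4 + e))\<close>, against a volume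
  of order \<open>2^(4 k)\<close>.
\<close>

lemma japanese_bracket_integrable:
  assumes "0 < e"
  shows "integrable lebesgue (\<lambda>x. japanese_bracket x powr (- 4 - e))"
proof (rule integrableI_nonneg)
  define q where "q = (2::real) powr (- 4 - e)"
  have q: "0 \<le> q" "q * 2 ^ 4 < 1"
  proof -
    have "q * 2 ^ 4 = 2 powr (- 4 - e) * 2 powr 4" by (simp add: q_def)
    also have "\<dots> = 2 powr (- 4 - e + 4)" by (rule powr_add[symmetric])
    also have "\<dots> = 2 powr (- e)" by simp
    also have "\<dots> < 1" using assms by (simp add: powr_less_one)
    finally show "q * 2 ^ 4 < 1" .
  qed (simp add: q_def)
  have cover: "ennreal (japanese_bracket y powr (- 4 - e))
      \<le> (\<Sum>k. ennreal (q ^ k) * indicator (ball 0 (2 ^ Suc k)) y)" for y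
  proof -
    obtain k where k: "2 ^ k \<le> japanese_bracket y" "japanese_bracket y < 2 ^ Suc k"
      using ex_dyadic_interval[OF japanese_bracket_bounds(1)] by blast
    have "japanese_bracket y powr (- 4 - e) \<le> (2 ^ k) powr (- 4 - e)"
      using k(1) assms by (intro powr_mono2') auto
    also have "\<dots> = q ^ k"
      by (simp add: q_def powr_powr mult.commute flip: powr_realpow)
    finally have "ennreal (japanese_bracket y powr (- 4 - e))
        \<le> ennreal (q ^ k) * indicator (ball 0 (2 ^ Suc k)) y"
      using k(2) japanese_bracket_bounds(2)[of y] by (simp add: dist_norm ennreal_leI)
    also have "\<dots> \<le> (\<Sum>k. ennreal (q ^ k) * indicator (ball 0 (2 ^ Suc k)) y)"
      by (rule single_le_suminf_ennreal)
    finally show ?thesis .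
  qed
  have sm: "summable (\<lambda>k. q ^ k * (2 ^ Suc k) ^ 4)"
  proof -
    have "(\<lambda>k. q ^ k * (2 ^ Suc k) ^ 4) = (\<lambda>k. 16 * (q * 2 ^ 4) ^ k)"
    proof
      fix k
      have "((2::real) ^ k) ^ 4 = 16 ^ k" by (induction k) (simp_all add: power_mult_distrib)
      then show "q ^ k * (2 ^ Suc k) ^ 4 = 16 * (q * 2 ^ 4) ^ k"
        by (simp add: power_mult_distrib)
    qed
    moreover have "summable (\<lambda>k. 16 * (q * 2 ^ 4) ^ k)"
      by (intro summable_mult summable_geometric) (use q in simp)
    ultimately show ?thesis by simp
  qed
  have "(\<integral>\<^sup>+ x. ennreal (japanese_bracket x powr (- 4 - e)) \<partial>lebesgue)
      \<le> ennreal (unit_ball_vol 4 * (\<Sum>k. q ^ k * (2 ^ Suc k) ^ 4))"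
    by (rule nn_integral_ball_cover[OF _ _ cover sm]) (use q in auto)
  then show "(\<integral>\<^sup>+ x. ennreal (japanese_bracket x powr (- 4 - e)) \<partial>lebesgue) < \<infinity>"
    by (rule le_less_trans) (simp add: ennreal_less_top)
qed (auto intro!: borel_imp_lebesgue_measurable)

text \<open>
  On the shell of radius about \<open>2^(-k)\<close> around \<open>x\<close> the integrand is at most \<open>4^(k + 1)\<close>, against a volume of
  order \<open>2^(-4 k)\<close>; the bound does not depend on the centre.
\<close>

lemma inverse_square_ball_integrable:
  obtains D where "\<And>x::R4. integrable lebesgue (\<lambda>y. indicator (ball x 1) y / (norm (x - y))\<^sup>2)"
    "\<And>x::R4. (LINT y|lebesgue. indicator (ball x 1) y / (norm (x - y))\<^sup>2) \<le> D" "0 \<le> D"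
proof -
  define D where "D = unit_ball_vol 4 * (\<Sum>k. 4 ^ Suc k * (2 * (1/2) ^ k) ^ 4 :: real)"
  have sm: "summable (\<lambda>k. 4 ^ Suc k * (2 * (1/2) ^ k) ^ 4 :: real)"
  proof -
    have eq: "4 ^ Suc k * (2 * (1/2) ^ k) ^ 4 = 64 * (1/4 :: real) ^ k" for k
    proof -
      have "((1/2 :: real) ^ k) ^ 4 = (1/16) ^ k"
        by (induction k) (simp_all add: power_mult_distrib power_divide)
      moreover have "(4 :: real) ^ k * (1/16) ^ k = (1/4) ^ k"
        by (simp flip: power_mult_distrib)
      ultimately show ?thesis by (simp add: power_mult_distrib)
    qed
    show ?thesis unfolding eq by (simp add: summable_mult)
  qed
  have D0: "0 \<le> D" unfolding D_def by (intro mult_nonneg_nonneg suminf_nonneg sm) auto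
  have cover: "ennreal (indicator (ball x 1) y / (norm (x - y))\<^sup>2)
      \<le> (\<Sum>k. ennreal (4 ^ Suc k) * indicator (ball x (2 * (1/2) ^ k)) y)" for x y :: R4
  proof (cases "y \<in> ball x 1 \<and> y \<noteq> x")
    case True
    define s where "s = norm (x - y)"
    have s: "0 < s" "s < 1" using True by (auto simp: s_def dist_norm)
    obtain k where k: "2 ^ k \<le> 1 / s" "1 / s < 2 ^ Suc k"
      using ex_dyadic_interval[of "1 / s"] s by auto
    have "(1 / s)\<^sup>2 \<le> (2 ^ Suc k)\<^sup>2" using k s by (intro power_mono) auto
    then have "1 / s\<^sup>2 \<le> 4 ^ Suc k"
      by (simp add: power_divide power2_eq_square flip: power_mult_distrib)
    \<comment> \<open>the radius is doubled because the balls are open\<close>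
    moreover have "s < 2 * (1/2) ^ k"
    proof -
      have "s \<le> (1/2) ^ k" using k(1) s by (simp add: field_simps power_divide)
      moreover have "(0::real) < (1/2) ^ k" by simp
      ultimately show ?thesis by linarith
    qed
    ultimately have "ennreal (indicator (ball x 1) y / (norm (x - y))\<^sup>2)
        \<le> ennreal (4 ^ Suc k) * indicator (ball x (2 * (1/2) ^ k)) y"
      using True by (simp add: s_def dist_norm)
    also have "\<dots> \<le> (\<Sum>k. ennreal (4 ^ Suc k) * indicator (ball x (2 * (1/2) ^ k)) y)"
      by (rule single_le_suminf_ennreal)
    finally show ?thesis .
  qed auto
  have nn: "(\<integral>\<^sup>+ y. ennreal (indicator (ball x 1) y / (norm (x - y))\<^sup>2) \<partial>lebesgue) \<le> ennreal D" for x :: R4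
    unfolding D_def by (rule nn_integral_ball_cover[OF _ _ cover sm]) auto
  have meas: "(\<lambda>y. indicator (ball x 1) y / (norm (x - y))\<^sup>2 :: real) \<in> borel_measurable lebesgue" for x :: R4
    by (rule borel_imp_lebesgue_measurable)
      (intro borel_measurable_divide borel_measurable_indicator borel_measurable_continuous_onI
        continuous_intros open_ball borel_open)
  show ?thesis
  proof (rule that[OF _ _ D0])
    fix x :: R4
    show "integrable lebesgue (\<lambda>y. indicator (ball x 1) y / (norm (x - y))\<^sup>2)"
      by (rule integrableI_nonneg[OF meas]) (use le_less_trans[OF nn[of x] ennreal_less_top] in auto)
    show "(LINT y|lebesgue. indicator (ball x 1) y / (norm (x - y))\<^sup>2) \<le> D"
      by (subst integral_eq_nn_integral[OF meas])
         (use nn[of x] D0 in \<open>auto intro: enn2real_leI\<close>)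
  qed
qed

text \<open>
  Near the pole the boundedness of \<open>w\<close> is used, away from it the integrability.
\<close>

lemma inverse_square_potential_bounded:
  fixes w :: "R4 \<Rightarrow> real"
  assumes w: "integrable lebesgue w" and pos: "\<And>y. 0 \<le> w y" and bd: "AE y in lebesgue. w y \<le> C"
  shows "\<exists>D. \<forall>x. integrable lebesgue (\<lambda>y. w y / (norm (x - y))\<^sup>2)
    \<and> (LINT y|lebesgue. w y / (norm (x - y))\<^sup>2) \<le> D"
proof -
  obtain D where D: "\<And>x::R4. integrable lebesgue (\<lambda>y. indicator (ball x 1) y / (norm (x - y))\<^sup>2)"
    "\<And>x::R4. (LINT y|lebesgue. indicator (ball x 1) y / (norm (x - y))\<^sup>2) \<le> D" "0 \<le> D"
    using inverse_square_ball_integrable by blast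
  define C' where "C' = max C 0"
  let ?g = "\<lambda>x y. C' * (indicator (ball x 1) y / (norm (x - y))\<^sup>2) + w y"
  have gi: "integrable lebesgue (?g x)" for x
    by (intro Bochner_Integration.integrable_add integrable_mult_right D(1) w)
  have le: "AE y in lebesgue. w y / (norm (x - y))\<^sup>2 \<le> ?g x y" for x
    using bd
  proof eventually_elim
    case (elim y)
    show ?case
    proof (cases "y \<in> ball x 1")
      case True
      have "w y / (norm (x - y))\<^sup>2 \<le> C' / (norm (x - y))\<^sup>2"
        using elim by (intro divide_right_mono) (auto simp: C'_def)
      then show ?thesis using True pos[of y] by simp
    next
      case False
      then have "1 \<le> norm (x - y)" by (simp add: dist_norm)
      then have "1 \<le> (norm (x - y))\<^sup>2" by simp
      then have "w y / (norm (x - y))\<^sup>2 \<le> w y / 1"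
        using pos[of y] by (intro divide_left_mono) auto
      then show ?thesis using False by simp
    qed
  qed
  have int: "integrable lebesgue (\<lambda>y. w y / (norm (x - y))\<^sup>2)" for x
  proof (rule Bochner_Integration.integrable_bound[OF gi[of x]])
    show "(\<lambda>y. w y / (norm (x - y))\<^sup>2) \<in> borel_measurable lebesgue"
      using borel_measurable_integrable[OF w] borel_imp_lebesgue_measurable[of "\<lambda>y. (norm (x - y))\<^sup>2"]
      by (intro borel_measurable_divide) auto
    show "AE y in lebesgue. norm (w y / (norm (x - y))\<^sup>2) \<le> norm (?g x y)"
      using le[of x] by eventually_elim (use pos in auto)
  qed
  have "(LINT y|lebesgue. w y / (norm (x - y))\<^sup>2) \<le> C' * D + (LINT y|lebesgue. w y)" for x
  proof -
    have "(LINT y|lebesgue. w y / (norm (x - y))\<^sup>2) \<le> (LINT y|lebesgue. ?g x y)"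
      by (rule integral_mono_AE[OF int gi le])
    also have "\<dots> = C' * (LINT y|lebesgue. indicator (ball x 1) y / (norm (x - y))\<^sup>2) + (LINT y|lebesgue. w y)"
      by (subst Bochner_Integration.integral_add[OF integrable_mult_right[OF D(1)] w])
         (simp only: integral_mult_right_zero)
    also have "\<dots> \<le> C' * D + (LINT y|lebesgue. w y)"
      by (intro add_right_mono mult_left_mono D(2)) (simp add: C'_def)
    finally show ?thesis .
  qed
  then show ?thesis using int by blast
qed

section \<open>Pointwise estimates for the logarithmic kernel\<close>

text \<open>
  The logarithm of the distance grows like that of \<open>\<langle>x\<rangle>\<close>, uniformly up to a function of \<open>y\<close> and a mild
  singularity: both \<open>\<bar>x - y\<bar>/\<langle>x\<rangle>\<close> and its inverse are controlled by \<open>\<langle>y\<rangle>\<close> and \<open>1 + 1/\<bar>x - y\<bar>\<close>. Subtracting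
  \<open>log \<langle>x\<rangle>\<close> is harmless against functions of integral zero.
\<close>

lemma ln_dist_bound:
  "\<bar>ln (norm (x - y)) - ln (japanese_bracket x)\<bar> \<le> 2 * japanese_bracket y + 1 / norm (x - y)"
  for x y :: R4
proof (cases "x = y")
  case True
  have "\<bar>ln (japanese_bracket y)\<bar> \<le> japanese_bracket y - 1"
    using japanese_bracket_bounds(1)[of y] ln_le_minus_one[of "japanese_bracket y"] by simp
  then show ?thesis using True japanese_bracket_bounds(1)[of y] by simp
next
  case False
  define s where "s = norm (x - y)"
  let ?a = "japanese_bracket x" and ?b = "japanese_bracket y"
  have s: "0 < s" using False by (simp add: s_def)
  have a: "1 \<le> ?a" "norm x \<le> ?a" "?a \<le> 1 + norm x" and b: "1 \<le> ?b" "norm y \<le> ?b"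
    using japanese_bracket_bounds by auto
  have lb: "ln (2 * ?b) \<le> 2 * ?b - 1" using b by (intro ln_le_minus_one) auto
  have "s \<le> norm x + norm y" unfolding s_def by (rule norm_triangle_ineq4)
  also have "\<dots> \<le> ?a + ?b" using a b by simp
  also have "\<dots> \<le> ?a * (2 * ?b)"
  proof -
    have "?a * 1 \<le> ?a * ?b" "1 * ?b \<le> ?a * ?b"
      using a b by (auto intro!: mult_left_mono mult_right_mono)
    then show ?thesis by simp
  qed
  finally have "ln s \<le> ln (?a * (2 * ?b))" using s a b by (subst ln_le_cancel_iff) auto
  also have "\<dots> = ln ?a + ln (2 * ?b)" using a b by (intro ln_mult_pos) auto
  finally have up: "ln s - ln ?a \<le> 2 * ?b" using lb by linarith
  have "norm x \<le> norm y + s" unfolding s_def using norm_triangle_ineq[of "y" "x - y"] by simp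
  then have "?a \<le> 2 * ?b + s" using a b by simp
  also have "\<dots> \<le> 2 * ?b + s * (2 * ?b)"
    using mult_left_mono[of 1 "2 * ?b" s] s b by simp
  also have "\<dots> = s * ((1 + 1 / s) * (2 * ?b))" using s by (simp add: field_simps)
  finally have "ln ?a \<le> ln (s * ((1 + 1 / s) * (2 * ?b)))"
    using s a b by (subst ln_le_cancel_iff) (auto intro!: mult_pos_pos add_pos_pos)
  also have "\<dots> = ln s + (ln (1 + 1 / s) + ln (2 * ?b))"
    using s b by (simp add: ln_mult_pos add_pos_pos)
  also have "\<dots> \<le> ln s + (1 / s + (2 * ?b - 1))"
    using ln_add_one_self_le_self[of "1 / s"] s lb by (intro add_mono) auto
  finally have "ln ?a - ln s \<le> 2 * ?b + 1 / s" by linarith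
  moreover have "0 \<le> 1 / s" using s by simp
  ultimately show ?thesis using up unfolding s_def[symmetric] by linarith
qed

text \<open>
  The derivative of the remainder is \<open>t\<^sup>2/(1 + t)\<close>, which is at most \<open>3 t\<^sup>2\<close> in the range.
\<close>

lemma ln_one_plus_cubic_bound:
  fixes t :: real assumes "\<bar>t\<bar> \<le> 9 / 16"
  shows "\<bar>ln (1 + t) - (t - t\<^sup>2 / 2)\<bar> \<le> 3 * \<bar>t\<bar> ^ 3"
proof -
  define g where "g = (\<lambda>t::real. ln (1 + t) - (t - t\<^sup>2 / 2))"
  have der: "(g has_real_derivative u\<^sup>2 / (1 + u)) (at u within S)" if "\<bar>u\<bar> \<le> 9 / 16" for u S
  proof -
    have "(g has_real_derivative 1 / (1 + u) - (1 - u)) (at u within S)"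
      unfolding g_def using that by (auto intro!: derivative_eq_intros simp: field_simps)
    moreover have "1 / (1 + u) - (1 - u) = u\<^sup>2 / (1 + u)"
      using that by (simp add: field_simps power2_eq_square abs_le_iff)
    ultimately show ?thesis by simp
  qed
  have "\<bar>g t - g 0\<bar> \<le> 3 * t\<^sup>2 * \<bar>t - 0\<bar>"
  proof -
    have "norm (g t - g 0) \<le> (3 * t\<^sup>2) * norm (t - 0)"
    proof (rule field_differentiable_bound[where S = "closed_segment 0 t"])
      fix u assume "u \<in> closed_segment 0 t"
      then have ut: "\<bar>u\<bar> \<le> \<bar>t\<bar>" by (auto simp: closed_segment_eq_real_ivl split: if_splits)
      then have u: "\<bar>u\<bar> \<le> 9 / 16" using assms by simp
      show "(g has_field_derivative u\<^sup>2 / (1 + u)) (at u within closed_segment 0 t)"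
        by (rule der[OF u])
      have "1 / (1 + u) \<le> 3" using u by (simp add: field_simps abs_le_iff)
      then have "u\<^sup>2 * (1 / (1 + u)) \<le> t\<^sup>2 * 3"
        using u iffD1[OF abs_le_square_iff ut] by (intro mult_mono) (auto simp: abs_le_iff)
      then show "norm (u\<^sup>2 / (1 + u)) \<le> 3 * t\<^sup>2" using u by (simp add: abs_le_iff)
    qed auto
    then show ?thesis by simp
  qed
  then show ?thesis by (simp add: g_def power3_eq_cube power2_eq_square mult.assoc abs_mult_self_eq)
qed

text \<open>
  The Taylor polynomial of degree two of \<open>y \<mapsto> log \<bar>x - y\<bar>\<close> at \<open>y = 0\<close>.
\<close>

definition log_expansion :: "R4 \<Rightarrow> R4 \<Rightarrow> real" where
  "log_expansion x y = ln (norm x) - (x \<bullet> y) / (norm x)\<^sup>2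
     + (norm y)\<^sup>2 / (2 * (norm x)\<^sup>2) - (x \<bullet> y)\<^sup>2 / norm x ^ 4"

lemma abs_inner_div_norm_sq_le: "\<bar>(x \<bullet> y) / (norm x)\<^sup>2\<bar> \<le> norm y / norm x" for x y :: R4
proof -
  have "\<bar>x \<bullet> y\<bar> / (norm x)\<^sup>2 \<le> (norm x * norm y) / (norm x)\<^sup>2"
    by (intro divide_right_mono Cauchy_Schwarz_ineq2) auto
  then show ?thesis by (cases "x = 0") (simp_all add: power2_eq_square)
qed

text \<open>
  With \<open>\<rho> = \<bar>y\<bar>/\<bar>x\<bar>\<close> and \<open>\<beta> = x \<bullet> y/\<bar>x\<bar>\<^sup>2\<close> one has \<open>\<bar>x - y\<bar>\<^sup>2 = \<bar>x\<bar>\<^sup>2 (1 + t)\<close> for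
  \<open>t = \<rho>\<^sup>2 - 2 \<beta>\<close>, so half the expansion of \<open>log (1 + t)\<close> gives the claim. The restriction \<open>\<rho> \<le> 1/4\<close> keeps
  \<open>\<bar>t\<bar>\<close> below \<open>9/16\<close>.
\<close>

lemma log_expansion_near:
  assumes "x \<noteq> 0" "norm y \<le> norm x / 4"
  shows "\<bar>ln (norm (x - y)) - log_expansion x y\<bar> \<le> 30 * (norm y / norm x) ^ 3"
proof -
  define \<rho> where "\<rho> = norm y / norm x"
  define \<beta> where "\<beta> = (x \<bullet> y) / (norm x)\<^sup>2"
  define t where "t = \<rho>\<^sup>2 - 2 * \<beta>"
  have nx: "0 < norm x" using assms by simp
  have \<rho>: "0 \<le> \<rho>" "\<rho> \<le> 1 / 4" using assms nx by (auto simp: \<rho>_def field_simps)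
  have \<beta>: "\<bar>\<beta>\<bar> \<le> \<rho>" unfolding \<beta>_def \<rho>_def by (rule abs_inner_div_norm_sq_le)
  have \<rho>2: "\<rho>\<^sup>2 \<le> \<rho> / 4" "0 \<le> \<rho>\<^sup>2" using \<rho> mult_left_mono[of \<rho> "1/4" \<rho>] by (auto simp: power2_eq_square)
  have t3: "\<bar>t\<bar> \<le> 9 / 4 * \<rho>" using \<beta> \<rho>2 unfolding t_def by linarith
  then have t: "\<bar>t\<bar> \<le> 9 / 16" using \<rho> by linarith
  have norm_eq: "(norm (x - y))\<^sup>2 = (norm x)\<^sup>2 * (1 + t)"
  proof -
    have "(norm (x - y))\<^sup>2 = (norm x)\<^sup>2 - 2 * (x \<bullet> y) + (norm y)\<^sup>2"
      by (simp add: power2_norm_eq_inner inner_diff inner_commute)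
    also have "\<dots> = (norm x)\<^sup>2 * (1 + t)" using nx
      by (simp add: t_def \<rho>_def \<beta>_def field_simps power_divide)
    finally show ?thesis .
  qed
  have xy: "0 < norm (x - y)" using assms nx by auto
  have "2 * ln (norm (x - y)) = ln ((norm (x - y))\<^sup>2)" using xy by (simp add: ln_realpow)
  also have "\<dots> = 2 * ln (norm x) + ln (1 + t)"
    unfolding norm_eq using nx t by (subst ln_mult_pos) (auto simp: ln_realpow abs_le_iff)
  finally have ln_eq: "ln (norm (x - y)) = ln (norm x) + ln (1 + t) / 2" by simp
  have le: "log_expansion x y = ln (norm x) - \<beta> + \<rho>\<^sup>2 / 2 - \<beta>\<^sup>2"
    unfolding log_expansion_def \<rho>_def \<beta>_def by (simp add: power_divide flip: power_mult)
  have "ln (norm (x - y)) - log_expansion x y = (ln (1 + t) - (t - t\<^sup>2 / 2)) / 2 + (\<beta> * \<rho>\<^sup>2 - \<rho>\<^sup>2 * \<rho>\<^sup>2 / 4)"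
    unfolding ln_eq le t_def by (simp add: power2_eq_square field_simps)
  moreover have "\<bar>ln (1 + t) - (t - t\<^sup>2 / 2)\<bar> \<le> 3 * (9 / 4 * \<rho>) ^ 3"
    using ln_one_plus_cubic_bound[OF t] power_mono[OF t3, of 3] by simp
  \<comment> \<open>\<open>3 (9/4)\<^sup>3 / 2\<close> is just below \<open>18\<close>\<close>
  then have "\<bar>(ln (1 + t) - (t - t\<^sup>2 / 2)) / 2\<bar> \<le> 18 * \<rho> ^ 3"
    using zero_le_power[OF \<rho>(1), of 3] by (simp add: power_mult_distrib power3_eq_cube)
  moreover have "\<bar>\<beta> * \<rho>\<^sup>2 - \<rho>\<^sup>2 * \<rho>\<^sup>2 / 4\<bar> \<le> 2 * \<rho> ^ 3"
  proof -
    have "\<bar>\<beta> * \<rho>\<^sup>2\<bar> \<le> \<rho> * \<rho>\<^sup>2" using \<beta> by (simp add: abs_mult mult_right_mono)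
    moreover have "\<rho>\<^sup>2 * \<rho>\<^sup>2 \<le> (\<rho> / 4) * \<rho>\<^sup>2" using \<rho>2 by (intro mult_right_mono) auto
    moreover have "\<rho> * \<rho>\<^sup>2 = \<rho> ^ 3" "0 \<le> \<rho>\<^sup>2 * \<rho>\<^sup>2" "0 \<le> \<rho> ^ 3"
      using \<rho> by (auto simp: power2_eq_square power3_eq_cube)
    ultimately show ?thesis by linarith
  qed
  ultimately show ?thesis unfolding \<rho>_def[symmetric] using zero_le_power[OF \<rho>(1), of 3] by linarith
qed

text \<open>
  For \<open>\<bar>y\<bar>\<close> small against \<open>\<bar>x\<bar>\<close> this is Taylor's formula. Otherwise \<open>\<bar>y\<bar>/\<bar>x\<bar> \<ge> 1/4\<close>, so every term of the
  expansion, and the logarithm itself, may be multiplied by \<open>64 (\<bar>y\<bar>/\<bar>x\<bar>)\<^sup>3 \<ge> 1\<close> at will.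
\<close>

lemma log_expansion_error:
  assumes x: "1 \<le> norm x"
  shows "\<bar>ln (norm (x - y)) - log_expansion x y\<bar>
    \<le> 300 / norm x ^ 3 * (japanese_bracket y ^ 3 * (japanese_bracket y + 1 / norm (x - y)))"
proof -
  define \<rho> where "\<rho> = norm y / norm x"
  let ?b = "japanese_bracket y" and ?s = "norm (x - y)"
  have nx: "0 < norm x" using x by linarith
  have \<rho>0: "0 \<le> \<rho>" by (simp add: \<rho>_def)
  have b: "1 \<le> ?b" "norm y \<le> ?b" using japanese_bracket_bounds by auto
  have is0: "0 \<le> 1 / ?s" by simp
  have key: "\<bar>ln ?s - log_expansion x y\<bar> \<le> 300 * \<rho> ^ 3 * (?b + 1 / ?s)"
  proof (cases "norm y \<le> norm x / 4")
    case True
    have "x \<noteq> 0" using nx by simp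
    then have "\<bar>ln ?s - log_expansion x y\<bar> \<le> 30 * \<rho> ^ 3"
      unfolding \<rho>_def using True by (rule log_expansion_near)
    also have "\<dots> \<le> 300 * \<rho> ^ 3 * 1" using zero_le_power[OF \<rho>0, of 3] by simp
    also have "\<dots> \<le> 300 * \<rho> ^ 3 * (?b + 1 / ?s)"
      using b(1) is0 zero_le_power[OF \<rho>0, of 3] by (intro mult_left_mono) linarith+
    finally show ?thesis .
  next
    case False
    then have \<rho>: "1 / 4 \<le> \<rho>" using nx by (simp add: \<rho>_def field_simps)
    define \<beta> where "\<beta> = (x \<bullet> y) / (norm x)\<^sup>2"
    have \<beta>: "\<bar>\<beta>\<bar> \<le> \<rho>" unfolding \<beta>_def \<rho>_def by (rule abs_inner_div_norm_sq_le)
    have \<beta>2: "\<beta>\<^sup>2 \<le> \<rho>\<^sup>2" using \<beta> \<rho>0 by (simp add: abs_le_square_iff[symmetric])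
    have p2: "\<rho>\<^sup>2 \<le> 4 * \<rho> ^ 3"
      using mult_right_mono[OF \<rho>, of "\<rho>\<^sup>2"] by (simp add: power2_eq_square power3_eq_cube)
    have p1: "\<rho> \<le> 4 * \<rho>\<^sup>2"
      using mult_right_mono[OF \<rho>, of \<rho>] \<rho>0 by (simp add: power2_eq_square)
    have p0: "1 \<le> 64 * \<rho> ^ 3" using p1 p2 \<rho> by linarith
    have le: "log_expansion x y = ln (norm x) - \<beta> + \<rho>\<^sup>2 / 2 - \<beta>\<^sup>2"
      unfolding log_expansion_def \<rho>_def \<beta>_def by (simp add: power_divide flip: power_mult)
    have "\<bar>ln (japanese_bracket x) - ln (norm x)\<bar> \<le> 1"
    proof -
      have "ln (norm x) \<le> ln (japanese_bracket x)"
        using nx japanese_bracket_bounds(2)[of x] by (intro ln_mono) linarith+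
      moreover have "ln (japanese_bracket x) \<le> ln (2 * norm x)"
        using nx x japanese_bracket_bounds(1,3)[of x] by (subst ln_le_cancel_iff) auto
      moreover have "ln (2 * norm x) = ln 2 + ln (norm x)" using nx by (intro ln_mult_pos) auto
      moreover have "ln (2::real) \<le> 1" using ln_le_minus_one[of 2] by simp
      ultimately show ?thesis by linarith
    qed
    then have "\<bar>ln ?s - ln (norm x)\<bar> \<le> 2 * ?b + 1 / ?s + 1"
      using ln_dist_bound[of x y] by linarith
    then have "\<bar>ln ?s - ln (norm x)\<bar> \<le> 3 * (?b + 1 / ?s)"
      using b(1) is0 by argo
    moreover define E where "E = ?b + 1 / ?s"
    ultimately have d: "\<bar>ln ?s - ln (norm x)\<bar> \<le> 3 * E" by simp
    have E: "1 \<le> E" using b(1) is0 unfolding E_def by linarith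
    have \<rho>3: "0 \<le> \<rho> ^ 3" using \<rho>0 by simp
    have "1 * E \<le> (64 * \<rho> ^ 3) * E" using p0 E by (intro mult_right_mono) auto
    then have e1: "E \<le> 64 * (\<rho> ^ 3 * E)" by (simp only: mult_1 mult.assoc)
    have e2: "\<rho> ^ 3 \<le> \<rho> ^ 3 * E" using mult_left_mono[OF E \<rho>3] by simp
    have "\<bar>- \<beta> + \<rho>\<^sup>2 / 2 - \<beta>\<^sup>2\<bar> \<le> 22 * \<rho> ^ 3"
      using \<beta> \<beta>2 p1 p2 zero_le_power2[of \<beta>] zero_le_power2[of \<rho>] by linarith
    then have "\<bar>ln ?s - log_expansion x y\<bar> \<le> 3 * E + 22 * (\<rho> ^ 3 * E)"
      using d e2 unfolding le by linarith
    \<comment> \<open>the constants add up to \<open>3 \<cdot> 64 + 22\<close>\<close>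
    also have "\<dots> \<le> 300 * (\<rho> ^ 3 * E)" using e1 e2 \<rho>3 by linarith
    finally show ?thesis by (simp only: E_def mult.assoc)
  qed
  have "300 * \<rho> ^ 3 * (?b + 1 / ?s) \<le> 300 * (?b / norm x) ^ 3 * (?b + 1 / ?s)"
    unfolding \<rho>_def using b is0 nx
    by (intro mult_right_mono mult_left_mono power_mono divide_right_mono add_nonneg_nonneg) auto
  also have "\<dots> = 300 / norm x ^ 3 * (?b ^ 3 * (?b + 1 / ?s))"
    by (simp add: power_divide)
  finally show ?thesis using key by linarith
qed

section \<open>The logarithmic potential as an integral operator\<close>

text \<open>
  The product of two completed measures is not complete, so functions are replaced by Borel
  representatives before Fubini's theorem is applied.
\<close>

lemma lebesgue_measurable_ex_borel:
  fixes f :: "R4 \<Rightarrow> complex"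
  assumes f: "f \<in> borel_measurable lebesgue"
  obtains g where "g \<in> borel_measurable borel" "AE x in lebesgue. f x = g x"
proof -
  have re: "(\<lambda>x. Re (f x)) \<in> borel_measurable lebesgue"
    and im: "(\<lambda>x. Im (f x)) \<in> borel_measurable lebesgue"
    using f by auto
  from completion_ex_borel_measurable_real[OF re] obtain a
    where a: "a \<in> borel_measurable lborel" "AE x in lborel. Re (f x) = a x" by (elim bexE)
  from completion_ex_borel_measurable_real[OF im] obtain b
    where b: "b \<in> borel_measurable lborel" "AE x in lborel. Im (f x) = b x" by (elim bexE)
  have "AE x in lebesgue. f x = Complex (a x) (b x)"
    using AE_completion[OF a(2)] AE_completion[OF b(2)] by eventually_elim (simp add: complex_eq_iff)
  moreover have "(\<lambda>x. Complex (a x) (b x)) \<in> borel_measurable borel"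
    using a b by (simp add: Complex_eq)
  ultimately show ?thesis by (rule that[rotated])
qed

lemma ln_dist_measurable: "(\<lambda>y. ln (norm (x - y))) \<in> borel_measurable lebesgue" for x :: R4
  by (rule borel_imp_lebesgue_measurable) (auto intro!: borel_measurable_ln borel_measurable_continuous_onI continuous_intros)

lemma G1_cong_AE:
  assumes "f \<in> borel_measurable lebesgue" "g \<in> borel_measurable lebesgue" "AE x in lebesgue. f x = g x"
  shows "G1 f x = G1 g x"
proof -
  have "(LINT y|lebesgue. ln (norm (x - y)) *\<^sub>R f y) = (LINT y|lebesgue. ln (norm (x - y)) *\<^sub>R g y)"
    by (rule integral_cong_AE)
       (use assms in \<open>auto intro!: borel_measurable_scaleR ln_dist_measurable\<close>)
  then show ?thesis by (simp add: G1_def)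
qed

lemma ln_dist_pair_measurable:
  "(\<lambda>p. ln (norm (fst p - snd p))) \<in> borel_measurable (borel \<Otimes>\<^sub>M (borel :: R4 measure))"
proof -
  have "(\<lambda>p. norm (fst p - snd p)) \<in> borel_measurable (borel \<Otimes>\<^sub>M (borel :: R4 measure))"
    by measurable
  then show ?thesis by (rule borel_measurable_ln)
qed

lemma G1_borel:
  assumes g: "g \<in> borel_measurable borel"
  shows "G1 g x = - (1 / (8 * pi\<^sup>2)) *\<^sub>R (LINT y|lborel. ln (norm (x - y)) *\<^sub>R g y)"
proof -
  have "(\<lambda>y. ln (norm (x - y)) *\<^sub>R g y) \<in> borel_measurable borel"
    by (intro borel_measurable_scaleR g borel_measurable_ln borel_measurable_continuous_onI continuous_intros)
  then show ?thesis unfolding G1_def by (subst integral_completion) auto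
qed

lemma G1_measurable:
  assumes f: "f \<in> borel_measurable lebesgue"
  shows "G1 f \<in> borel_measurable lebesgue"
proof -
  obtain g where g: "g \<in> borel_measurable borel" and ae: "AE x in lebesgue. f x = g x"
    using lebesgue_measurable_ex_borel[OF f] .
  have eq: "G1 f = G1 g"
    using G1_cong_AE[OF f borel_imp_lebesgue_measurable[OF g] ae] by (rule ext)
  have "(\<lambda>p. ln (norm (fst p - snd p)) *\<^sub>R g (snd p)) \<in> borel_measurable (borel \<Otimes>\<^sub>M lborel)"
  proof -
    have "(\<lambda>p. ln (norm (fst p - snd p)) *\<^sub>R g (snd p)) \<in> borel_measurable (borel \<Otimes>\<^sub>M (borel :: R4 measure))"
      by (intro borel_measurable_scaleR ln_dist_pair_measurable measurable_compose[OF measurable_snd g])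
    then show ?thesis by (simp cong: measurable_cong_sets sets_pair_measure_cong)
  qed
  then have "(\<lambda>x. LINT y|lborel. ln (norm (x - y)) *\<^sub>R g y) \<in> borel_measurable borel"
    by (intro lborel.borel_measurable_lebesgue_integral) (simp add: case_prod_beta)
  then have "G1 g \<in> borel_measurable borel"
    unfolding G1_borel[OF g] by (intro borel_measurable_scaleR) auto
  then show ?thesis unfolding eq by (rule borel_imp_lebesgue_measurable)
qed

text \<open>
  The kernel of \<open>G\<^sub>1\<close> is symmetric; the bound makes the double integral absolutely convergent, so the order
  of integration can be exchanged.
\<close>

lemma G1_symmetric:
  assumes f: "f \<in> borel_measurable lebesgue" and h: "h \<in> borel_measurable lebesgue"
    and fint: "\<And>x. integrable lebesgue (\<lambda>y. ln (norm (x - y)) *\<^sub>R f y)"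
    and bound: "\<And>x. (LINT y|lebesgue. norm (ln (norm (x - y)) *\<^sub>R f y)) \<le> B x"
    and B: "integrable lebesgue (\<lambda>x. B x * cmod (h x))"
  shows "(LINT x|lebesgue. G1 f x * h x) = (LINT x|lebesgue. f x * G1 h x)"
proof -
  obtain f' where f': "f' \<in> borel_measurable borel" and aef: "AE x in lebesgue. f x = f' x"
    using lebesgue_measurable_ex_borel[OF f] .
  obtain h' where h': "h' \<in> borel_measurable borel" and aeh: "AE x in lebesgue. h x = h' x"
    using lebesgue_measurable_ex_borel[OF h] .
  note fl = borel_imp_lebesgue_measurable[OF f'] and hl = borel_imp_lebesgue_measurable[OF h']
  have Gf: "G1 f = G1 f'" and Gh: "G1 h = G1 h'"
    using G1_cong_AE[OF f fl aef] G1_cong_AE[OF h hl aeh] by (auto intro!: ext)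
  define F where "F = (\<lambda>x y. (ln (norm (x - y)) *\<^sub>R f' y) * h' x)"
  have mk: "(\<lambda>y. ln (norm (x - y)) *\<^sub>R f' y) \<in> borel_measurable borel" for x
    by (intro borel_measurable_scaleR f' borel_measurable_ln borel_measurable_continuous_onI continuous_intros)
  have fint': "integrable lborel (\<lambda>y. ln (norm (x - y)) *\<^sub>R f' y)" for x
  proof -
    have "integrable lebesgue (\<lambda>y. ln (norm (x - y)) *\<^sub>R f' y)"
      by (rule integrable_cong_AE_imp[OF fint[of x]])
         (use aef borel_imp_lebesgue_measurable[OF mk] in auto)
    then show ?thesis using integrable_completion[of "\<lambda>y. ln (norm (x - y)) *\<^sub>R f' y" lborel] mk by simp
  qed
  have nb: "(LINT y|lborel. norm (ln (norm (x - y)) *\<^sub>R f' y)) \<le> B x" for x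
  proof -
    have "(LINT y|lborel. norm (ln (norm (x - y)) *\<^sub>R f' y))
        = (LINT y|lebesgue. norm (ln (norm (x - y)) *\<^sub>R f' y))"
      by (rule integral_completion[symmetric], rule measurable_compose[OF _ borel_measurable_norm])
         (use mk in simp)
    also have "\<dots> = (LINT y|lebesgue. norm (ln (norm (x - y)) *\<^sub>R f y))"
    proof (rule integral_cong_AE)
      show "(\<lambda>y. norm (ln (norm (x - y)) *\<^sub>R f' y)) \<in> borel_measurable lebesgue"
        by (rule borel_imp_lebesgue_measurable[OF measurable_compose[OF mk borel_measurable_norm]])
      show "(\<lambda>y. norm (ln (norm (x - y)) *\<^sub>R f y)) \<in> borel_measurable lebesgue"
        by (rule measurable_compose[OF _ borel_measurable_norm])
           (intro borel_measurable_scaleR ln_dist_measurable f)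
    qed (use aef in auto)
    finally show ?thesis using bound[of x] by simp
  qed
  have mF: "case_prod F \<in> borel_measurable (borel \<Otimes>\<^sub>M borel)"
    unfolding F_def case_prod_beta
    by (intro borel_measurable_times borel_measurable_scaleR ln_dist_pair_measurable
        measurable_compose[OF measurable_snd f'] measurable_compose[OF measurable_fst h'])
  then have mF': "case_prod F \<in> borel_measurable (lborel \<Otimes>\<^sub>M lborel)"
    by (simp cong: measurable_cong_sets sets_pair_measure_cong)
  have "integrable (lborel \<Otimes>\<^sub>M lborel) (case_prod F)"
  proof (rule lborel_pair.Fubini_integrable[OF mF'])
    have Bi: "integrable lebesgue (\<lambda>x. B x * cmod (h x))" by (rule B)
    have m1: "(\<lambda>x. LINT y|lborel. norm (case_prod F (x, y))) \<in> borel_measurable lborel"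
      by (rule lborel.borel_measurable_lebesgue_integral)
         (use measurable_compose[OF mF' borel_measurable_norm] in \<open>simp add: case_prod_beta\<close>)
    have val: "(LINT y|lborel. norm (case_prod F (x, y)))
        = (LINT y|lborel. norm (ln (norm (x - y)) *\<^sub>R f' y)) * cmod (h' x)" for x
      by (simp only: F_def prod.case norm_mult integral_mult_left_zero)
    have "integrable lebesgue (\<lambda>x. LINT y|lborel. norm (case_prod F (x, y)))"
    proof (rule Bochner_Integration.integrable_bound[OF Bi])
      show "(\<lambda>x. LINT y|lborel. norm (case_prod F (x, y))) \<in> borel_measurable lebesgue"
        using m1 by (intro borel_imp_lebesgue_measurable) simp
      show "AE x in lebesgue. norm (LINT y|lborel. norm (case_prod F (x, y))) \<le> norm (B x * cmod (h x))"
        using aeh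
      proof eventually_elim
        case (elim x)
        have "0 \<le> (LINT y|lborel. norm (ln (norm (x - y)) *\<^sub>R f' y))" by simp
        then show ?case unfolding val elim
          using nb[of x] by (simp add: abs_mult mult_right_mono)
      qed
    qed
    then show "integrable lborel (\<lambda>x. LINT y|lborel. norm (case_prod F (x, y)))"
      using integrable_completion[OF m1] by simp
    show "AE x in lborel. integrable lborel (\<lambda>y. case_prod F (x, y))"
      unfolding F_def prod.case by (intro AE_I2 integrable_mult_left fint')
  qed
  from lborel_pair.Fubini_integral[OF this]
  have fub: "(LINT y|lborel. LINT x|lborel. F x y) = (LINT x|lborel. LINT y|lborel. F x y)" .
  have Gf_meas: "G1 f' \<in> borel_measurable lebesgue" and Gh_meas: "G1 h' \<in> borel_measurable lebesgue"
    using G1_measurable fl hl by auto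
  let ?c = "- (1 / (8 * pi\<^sup>2))"
  have F1: "(LINT y|lborel. F x y) = (LINT y|lborel. ln (norm (x - y)) *\<^sub>R f' y) * h' x" for x
    unfolding F_def by (simp only: integral_mult_left_zero)
  have F2: "(LINT x|lborel. F x y) = f' y * (LINT x|lborel. ln (norm (y - x)) *\<^sub>R h' x)" for y
  proof -
    have "(LINT x|lborel. F x y) = (LINT x|lborel. f' y * (ln (norm (y - x)) *\<^sub>R h' x))"
      unfolding F_def by (intro Bochner_Integration.integral_cong refl) (simp add: norm_minus_commute scaleR_conv_of_real mult_ac)
    then show ?thesis by (simp only: integral_mult_right_zero)
  qed
  have m2: "(\<lambda>x. LINT y|lborel. F x y) \<in> borel_measurable lborel"
    by (rule lborel.borel_measurable_lebesgue_integral) (rule mF')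
  have m3: "(\<lambda>y. LINT x|lborel. F x y) \<in> borel_measurable lborel"
    by (rule lborel.borel_measurable_lebesgue_integral)
       (use measurable_compose[OF measurable_pair_swap' mF', unfolded case_prod_beta] in
         \<open>simp add: case_prod_beta\<close>)
  have "(LINT x|lebesgue. G1 f x * h x) = (LINT x|lebesgue. G1 f' x * h' x)"
    unfolding Gf by (rule integral_cong_AE) (use Gf_meas h hl aeh in auto)
  also have "\<dots> = (LINT x|lebesgue. ?c *\<^sub>R (LINT y|lborel. F x y))"
    unfolding G1_borel[OF f'] F1 by simp
  also have "\<dots> = ?c *\<^sub>R (LINT x|lborel. LINT y|lborel. F x y)"
    using m2 by (simp add: integral_completion)
  also have "\<dots> = ?c *\<^sub>R (LINT y|lborel. LINT x|lborel. F x y)" unfolding fub ..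
  also have "\<dots> = (LINT y|lebesgue. ?c *\<^sub>R (LINT x|lborel. F x y))"
    using m3 by (simp add: integral_completion)
  also have "\<dots> = (LINT y|lebesgue. f' y * G1 h' y)"
    unfolding G1_borel[OF h'] F2 by simp
  also have "\<dots> = (LINT x|lebesgue. f x * G1 h x)"
    unfolding Gh by (rule integral_cong_AE) (use Gh_meas f fl aef in auto)
  finally show ?thesis .
qed

section \<open>Functions of polynomial growth and separation of powers of the distance\<close>

definition polynomial_growth :: "nat \<Rightarrow> (R4 \<Rightarrow> real) \<Rightarrow> bool" where
  "polynomial_growth k p \<longleftrightarrow> p \<in> borel_measurable borel \<and> (\<exists>C\<ge>0. \<forall>x. \<bar>p x\<bar> \<le> C * japanese_bracket x ^ k)"

lemma polynomial_growthI:
  assumes "p \<in> borel_measurable borel" "\<And>x. \<bar>p x\<bar> \<le> C * japanese_bracket x ^ k"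
  shows "polynomial_growth k p"
proof -
  have "0 \<le> C * japanese_bracket 0 ^ k" by (rule order_trans[OF abs_ge_zero assms(2)])
  then have "0 \<le> C" by (simp add: japanese_bracket_def)
  then show ?thesis unfolding polynomial_growth_def using assms by auto
qed

lemma polynomial_growth_mult:
  assumes "polynomial_growth j p" "polynomial_growth k q"
  shows "polynomial_growth (j + k) (\<lambda>x. p x * q x)"
proof -
  obtain C D where C: "0 \<le> C" "\<And>x. \<bar>p x\<bar> \<le> C * japanese_bracket x ^ j"
    and D: "\<And>x. \<bar>q x\<bar> \<le> D * japanese_bracket x ^ k"
    using assms unfolding polynomial_growth_def by auto
  have jb: "0 \<le> japanese_bracket x" for x using japanese_bracket_bounds(1)[of x] by linarith
  show ?thesis
  proof (rule polynomial_growthI)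
    show "(\<lambda>x. p x * q x) \<in> borel_measurable borel"
      using assms unfolding polynomial_growth_def by (intro borel_measurable_times) auto
    fix x
    have "\<bar>p x\<bar> * \<bar>q x\<bar> \<le> (C * japanese_bracket x ^ j) * (D * japanese_bracket x ^ k)"
      using C D jb by (intro mult_mono) auto
    then show "\<bar>p x * q x\<bar> \<le> (C * D) * japanese_bracket x ^ (j + k)"
      by (simp add: abs_mult power_add mult_ac)
  qed
qed

lemma polynomial_growth_mono:
  assumes "polynomial_growth j p" "j \<le> k" shows "polynomial_growth k p"
proof -
  obtain C where C: "0 \<le> C" "\<And>x. \<bar>p x\<bar> \<le> C * japanese_bracket x ^ j"
    using assms(1) unfolding polynomial_growth_def by auto
  show ?thesis
  proof (rule polynomial_growthI)
    show "p \<in> borel_measurable borel" using assms(1) by (simp add: polynomial_growth_def)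
    fix x
    have "C * japanese_bracket x ^ j \<le> C * japanese_bracket x ^ k"
      by (intro mult_left_mono power_increasing assms C japanese_bracket_bounds)
    then show "\<bar>p x\<bar> \<le> C * japanese_bracket x ^ k" using C(2)[of x] by linarith
  qed
qed

lemma polynomial_growth_basic:
  "polynomial_growth 0 (\<lambda>x. 1)" "b \<in> Basis \<Longrightarrow> polynomial_growth 1 (\<lambda>x. a * (x \<bullet> b))"
  "polynomial_growth 2 (\<lambda>x. (norm x)\<^sup>2)"
proof -
  show "polynomial_growth 0 (\<lambda>x. 1)" by (rule polynomial_growthI[of _ 1]) auto
  show "polynomial_growth 2 (\<lambda>x. (norm x)\<^sup>2)"
    by (rule polynomial_growthI[of _ 1]) (auto intro!: power_mono japanese_bracket_bounds)
  assume b: "b \<in> Basis"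
  show "polynomial_growth 1 (\<lambda>x. a * (x \<bullet> b))"
  proof (rule polynomial_growthI)
    fix x
    have "\<bar>x \<bullet> b\<bar> \<le> japanese_bracket x"
      using Basis_le_norm[OF b, of x] japanese_bracket_bounds(2)[of x] by linarith
    then show "\<bar>a * (x \<bullet> b)\<bar> \<le> \<bar>a\<bar> * japanese_bracket x ^ 1"
      by (simp add: abs_mult mult_left_mono)
  qed (intro borel_measurable_times borel_measurable_const borel_measurable_continuous_onI continuous_intros)
qed

lemma sum_Basis_plus_bool:
  "sum F (Basis <+> (UNIV :: bool set)) = (\<Sum>b\<in>Basis. F (Inl b)) + F (Inr True) + F (Inr False)"
  for F :: "R4 + bool \<Rightarrow> 'a :: comm_monoid_add"
  by (subst sum.Plus) (auto simp: UNIV_bool add_ac)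

text \<open>
  The factors in \<open>\<bar>x - y\<bar>\<^sup>2 = \<bar>x\<bar>\<^sup>2 \<cdot> 1 + 1 \<cdot> \<bar>y\<bar>\<^sup>2 + \<Sum>\<^sub>b (-2 x \<bullet> b) \<cdot> (y \<bullet> b)\<close>, indexed by the basis vectors
  together with two further terms, one for each square.
\<close>

fun dist_sq_left :: "R4 + bool \<Rightarrow> R4 \<Rightarrow> real" where
  "dist_sq_left (Inl b) x = - 2 * (x \<bullet> b)"
| "dist_sq_left (Inr t) x = (if t then (norm x)\<^sup>2 else 1)"

fun dist_sq_right :: "R4 + bool \<Rightarrow> R4 \<Rightarrow> real" where
  "dist_sq_right (Inl b) y = 1 * (y \<bullet> b)"
| "dist_sq_right (Inr t) y = (if t then 1 else (norm y)\<^sup>2)"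

abbreviation dist_sq_terms :: "(R4 + bool) set" where
  "dist_sq_terms \<equiv> Basis <+> UNIV"

lemma dist_sq_separated:
  "norm (x - y) ^ 2 = (\<Sum>s\<in>dist_sq_terms. dist_sq_left s x * dist_sq_right s y)"
proof -
  have "norm (x - y) ^ 2 = (norm x)\<^sup>2 - 2 * (x \<bullet> y) + (norm y)\<^sup>2"
    by (simp add: power2_norm_eq_inner inner_diff inner_commute)
  also have "x \<bullet> y = (\<Sum>b\<in>Basis. (x \<bullet> b) * (y \<bullet> b))" by (rule euclidean_inner)
  finally show ?thesis unfolding sum_Basis_plus_bool
    by (simp add: sum_distrib_left sum_negf mult.assoc)
qed

text \<open>
  Squaring the separated form of \<open>\<bar>x - y\<bar>\<^sup>2\<close> indexes the terms by pairs.
\<close>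

lemma dist_fourth_separated:
  "norm (x - y) ^ 4 = (\<Sum>s\<in>dist_sq_terms \<times> dist_sq_terms.
    (dist_sq_left (fst s) x * dist_sq_left (snd s) x) * (dist_sq_right (fst s) y * dist_sq_right (snd s) y))"
proof -
  have "norm (x - y) ^ 4 = norm (x - y) ^ 2 * norm (x - y) ^ 2" by (simp flip: power_add)
  also have "\<dots> = (\<Sum>s\<in>dist_sq_terms. \<Sum>t\<in>dist_sq_terms.
      (dist_sq_left s x * dist_sq_right s y) * (dist_sq_left t x * dist_sq_right t y))"
    unfolding dist_sq_separated by (rule sum_product)
  finally show ?thesis by (simp add: sum.cartesian_product case_prod_beta mult_ac)
qed

lemma dist_sq_growth:
  assumes "s \<in> dist_sq_terms"
  shows "polynomial_growth 2 (dist_sq_left s)" "polynomial_growth 2 (dist_sq_right s)"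
proof -
  have one: "polynomial_growth 2 (\<lambda>x. 1)" by (rule polynomial_growth_mono[OF polynomial_growth_basic(1)]) simp
  have lin: "polynomial_growth 2 (\<lambda>x. a * (x \<bullet> b))" if "b \<in> Basis" for a b
    by (rule polynomial_growth_mono[OF polynomial_growth_basic(2)[OF that]]) simp
  consider b where "s = Inl b" "b \<in> Basis" | "s = Inr True" | "s = Inr False"
    using assms by auto
  then show "polynomial_growth 2 (dist_sq_left s)" "polynomial_growth 2 (dist_sq_right s)"
    by (cases; simp add: one lin[of _ 1, simplified] lin[of _ "- 2", simplified] polynomial_growth_basic(3)
        dist_sq_left.simps[abs_def] dist_sq_right.simps[abs_def])+
qed

lemma dist_sq_factor_growth:
  assumes "s \<in> dist_sq_terms"
  shows "polynomial_growth 4 (dist_sq_left s)" "polynomial_growth 4 (dist_sq_right s)"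
  using dist_sq_growth[OF assms] polynomial_growth_mono[of 2 _ 4] by auto

lemma dist_fourth_factor_growth:
  assumes "s \<in> dist_sq_terms \<times> dist_sq_terms"
  shows "polynomial_growth 4 (\<lambda>x. dist_sq_left (fst s) x * dist_sq_left (snd s) x)"
    "polynomial_growth 4 (\<lambda>x. dist_sq_right (fst s) x * dist_sq_right (snd s) x)"
proof -
  have s: "fst s \<in> dist_sq_terms" "snd s \<in> dist_sq_terms" using assms by (simp_all only: mem_Times_iff)
  have "polynomial_growth (2 + 2) (\<lambda>x. dist_sq_left (fst s) x * dist_sq_left (snd s) x)"
    "polynomial_growth (2 + 2) (\<lambda>x. dist_sq_right (fst s) x * dist_sq_right (snd s) x)"
    by (intro polynomial_growth_mult dist_sq_growth s)+
  then show "polynomial_growth 4 (\<lambda>x. dist_sq_left (fst s) x * dist_sq_left (snd s) x)"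
    "polynomial_growth 4 (\<lambda>x. dist_sq_right (fst s) x * dist_sq_right (snd s) x)" by simp_all
qed

lemma finite_dist_sq_terms: "finite dist_sq_terms" "finite (dist_sq_terms \<times> dist_sq_terms)"
  by auto

section \<open>Homogeneous leading terms of square-integrable functions\<close>

text \<open>
  If \<open>H z \<noteq> 0\<close> then \<open>\<bar>\<psi>\<bar>\<close> is at least of order \<open>R\<^sup>-\<^sup>a \<ge> R\<^sup>-\<^sup>2\<close> on the ball around \<open>R z\<close> of radius \<open>R r\<close>, by
  continuity and homogeneity. The volume of this ball is of order \<open>R\<^sup>4\<close>, so the integral of \<open>\<bar>\<psi>\<bar>\<^sup>2\<close> over it is
  bounded below, independently of \<open>R\<close>. But the balls escape to infinity, so these integrals tend to zero.
\<close>

lemma homogeneous_leading_term_vanishes: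
  fixes \<psi> H :: "R4 \<Rightarrow> complex"
  assumes \<psi>: "\<psi> \<in> L2" and a: "a \<le> 2" and z: "z \<noteq> 0" and cont: "isCont H z"
    and homog: "\<And>R x. 0 < R \<Longrightarrow> H (R *\<^sub>R x) = H x / of_real (R ^ a)"
    and err: "\<And>x. 1 \<le> norm x \<Longrightarrow> cmod (\<psi> x - H x) \<le> C / norm x ^ Suc a"
  shows "H z = 0"
proof (rule ccontr)
  assume "H z \<noteq> 0"
  define \<eta> where "\<eta> = cmod (H z) / 4"
  have \<eta>: "0 < \<eta>" using \<open>H z \<noteq> 0\<close> by (simp add: \<eta>_def)
  have nz: "0 < norm z" using z by simp
  obtain d where d: "0 < d" "\<And>w. dist w z < d \<Longrightarrow> dist (H w) (H z) < \<eta>"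
    using cont \<eta> unfolding continuous_at_eps_delta by blast
  \<comment> \<open>half the norm of \<open>z\<close> keeps the ball away from the origin\<close>
  define r where "r = min d (norm z / 2)"
  have r: "0 < r" "r \<le> d" "r \<le> norm z / 2" using d nz by (auto simp: r_def)
  have C0: "0 \<le> C"
  proof -
    have "norm ((1 / norm z) *\<^sub>R z) = 1" using nz by simp
    then have "0 \<le> C / 1 ^ Suc a"
      using order_trans[OF norm_ge_zero err[of "(1 / norm z) *\<^sub>R z"]] by simp
    then show ?thesis by simp
  qed
  let ?D = "C / (norm z / 2) ^ Suc a"
  have D0: "0 \<le> ?D" using C0 nz by simp
  have lower: "\<eta> / R\<^sup>2 \<le> cmod (\<psi> x)"
    if R: "1 \<le> R" "2 / norm z \<le> R" "?D / \<eta> \<le> R" and x: "x \<in> ball (R *\<^sub>R z) (R * r)" for R x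
  proof -
    have R0: "0 < R" using R by simp
    define w where "w = (1 / R) *\<^sub>R x"
    have xw: "x = R *\<^sub>R w" using R0 by (simp add: w_def)
    have "norm (R *\<^sub>R (z - w)) < R * r" using x by (simp add: dist_norm xw scaleR_diff_right)
    then have zw: "norm (z - w) < r" using R0 by simp
    then have "dist (H w) (H z) < \<eta>" using d(2)[of w] r by (simp add: dist_norm norm_minus_commute)
    then have Hw: "3 * \<eta> \<le> cmod (H w)"
      using norm_triangle_ineq2[of "H z" "H w"] by (simp add: \<eta>_def dist_norm norm_minus_commute)
    have "norm z \<le> norm (z - w) + norm w" using norm_triangle_ineq[of "z - w" w] by simp
    then have nw: "norm z / 2 \<le> norm w" using zw r by linarith
    have nx: "R * (norm z / 2) \<le> norm x" using nw R0 by (simp add: xw)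
    have "1 \<le> R * (norm z / 2)" using R(2) nz by (simp add: field_simps)
    then have x1: "1 \<le> norm x" using nx by linarith
    have "cmod (\<psi> x - H x) \<le> C / norm x ^ Suc a" by (rule err[OF x1])
    also have "\<dots> \<le> C / (R * (norm z / 2)) ^ Suc a"
      using C0 R0 nz nx x1 by (intro divide_left_mono power_mono mult_pos_pos zero_less_power) auto
    also have "\<dots> = ?D / R * (1 / R ^ a)" unfolding power_mult_distrib[of R] by (simp add: mult_ac)
    also have "\<dots> \<le> \<eta> * (1 / R ^ a)"
    proof (rule mult_right_mono)
      have "q / R \<le> \<eta>" if "q / \<eta> \<le> R" for q
        using that R0 \<eta> by (simp add: field_simps)
      then show "?D / R \<le> \<eta>" using R(3) .
    qed (use R0 in simp)
    finally have e: "cmod (\<psi> x - H x) \<le> \<eta> / R ^ a" by simp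
    have "cmod (H x) = cmod (H w) / R ^ a"
      unfolding xw homog[OF R0] using R0 by (simp add: norm_divide norm_power)
    then have "3 * \<eta> / R ^ a \<le> cmod (H x)" using Hw R0 by (simp add: divide_right_mono)
    then have "3 * (\<eta> / R ^ a) \<le> cmod (H x)" by simp
    then have "2 * (\<eta> / R ^ a) \<le> cmod (\<psi> x)"
      using e norm_triangle_ineq2[of "H x" "\<psi> x"] norm_minus_commute[of "H x" "\<psi> x"] by linarith
    moreover have "0 \<le> \<eta> / R ^ a" using \<eta> R0 by simp
    moreover have "\<eta> / R\<^sup>2 \<le> \<eta> / R ^ a"
      using \<eta> R0 R(1) a by (intro divide_left_mono power_increasing mult_pos_pos zero_less_power) auto
    ultimately show ?thesis by linarith
  qed
  define s where "s = (\<lambda>k x. indicator (ball (real k *\<^sub>R z) (real k * r)) x *\<^sub>R (cmod (\<psi> x))\<^sup>2)"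
  have int: "integrable lebesgue (s k)" for k
    unfolding s_def by (intro integrable_mult_indicator L2_norm_sq_integrable[OF \<psi>]) simp
  have "(\<lambda>k. LINT x|lebesgue. s k x) \<longlonglongrightarrow> (LINT x::R4|lebesgue. 0)"
  proof (rule integral_dominated_convergence[where w = "\<lambda>x. (cmod (\<psi> x))\<^sup>2"])
    show "AE x in lebesgue. (\<lambda>k. s k x) \<longlonglongrightarrow> 0"
    proof (rule AE_I2)
      fix x :: R4
      obtain N where N: "2 * norm x / norm z < real N" using reals_Archimedean2 by blast
      have "s k x = 0" if "k \<ge> N" for k
      proof -
        have "2 * norm x / norm z < real k" using N that by linarith
        then have "norm x < real k * (norm z / 2)" using nz by (simp add: field_simps)
        moreover have "real k * r \<le> real k * (norm z / 2)" using r by (intro mult_left_mono) auto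
        moreover have "real k * norm z \<le> norm (real k *\<^sub>R z - x) + norm x"
          using norm_triangle_ineq[of "real k *\<^sub>R z - x" x] by simp
        ultimately have "x \<notin> ball (real k *\<^sub>R z) (real k * r)" by (simp add: dist_norm)
        then show ?thesis by (simp add: s_def)
      qed
      then show "(\<lambda>k. s k x) \<longlonglongrightarrow> 0"
        by (intro tendsto_eventually) (auto simp: eventually_sequentially)
    qed
    show "AE x in lebesgue. norm (s k x) \<le> (cmod (\<psi> x))\<^sup>2" for k
      by (rule AE_I2) (simp add: s_def indicator_def)
  qed (use int L2_norm_sq_integrable[OF \<psi>] in \<open>auto intro: borel_measurable_integrable\<close>)
  then have lim: "(\<lambda>k. LINT x|lebesgue. s k x) \<longlonglongrightarrow> 0" by simp
  define K where "K = \<eta>\<^sup>2 * (unit_ball_vol 4 * r ^ 4)"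
  have K: "0 < K" using \<eta> r by (simp add: K_def)
  have "K \<le> (LINT x|lebesgue. s k x)" if k: "1 \<le> real k" "2 / norm z \<le> real k" "?D / \<eta> \<le> real k" for k
  proof -
    let ?B = "ball (real k *\<^sub>R z) (real k * r)"
    have kr: "0 \<le> real k * r" using r by simp
    have em: "emeasure lebesgue ?B < \<infinity>" using emeasure_ball[OF kr, of "real k *\<^sub>R z"] by simp
    have meas: "measure lebesgue ?B = unit_ball_vol 4 * (real k * r) ^ 4"
      using content_ball[OF kr, of "real k *\<^sub>R z"] by simp
    have iB: "integrable lebesgue (indicator ?B :: R4 \<Rightarrow> real)"
      by (rule integrable_real_indicator[OF _ em]) simp
    have "K = (\<eta> / (real k)\<^sup>2)\<^sup>2 * measure lebesgue ?B"
      unfolding meas K_def using k(1) by (simp add: power_mult_distrib power_divide flip: power_mult)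
    also have "\<dots> = (LINT x|lebesgue. (\<eta> / (real k)\<^sup>2)\<^sup>2 * indicator ?B x)"
      by simp
    also have "\<dots> \<le> (LINT x|lebesgue. s k x)"
    proof (rule integral_mono[OF integrable_mult_right[OF iB] int])
      fix x
      show "(\<eta> / (real k)\<^sup>2)\<^sup>2 * indicator ?B x \<le> s k x"
      proof (cases "x \<in> ?B")
        case True
        have "(\<eta> / (real k)\<^sup>2)\<^sup>2 \<le> (cmod (\<psi> x))\<^sup>2"
          using lower[OF k True] \<eta> by (intro power_mono) auto
        then show ?thesis using True by (simp add: s_def)
      qed (simp add: s_def)
    qed
    finally show ?thesis .
  qed
  moreover have "eventually (\<lambda>k. real k \<ge> max 1 (max (2 / norm z) (?D / \<eta>))) sequentially"
    using filterlim_real_sequentially unfolding filterlim_at_top by blast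
  ultimately have "eventually (\<lambda>k. K \<le> (LINT x|lebesgue. s k x)) sequentially"
    by (auto elim!: eventually_mono)
  then have "K \<le> 0" by (intro tendsto_lowerbound[OF lim]) auto
  then show False using K by simp
qed

text \<open>
  Up to sign, the first-order term in the expansion at infinity of the logarithmic potential of a density with
  first moments \<open>m\<close>.
\<close>

definition dipole :: "(R4 \<Rightarrow> complex) \<Rightarrow> R4 \<Rightarrow> complex" where
  "dipole m x = (\<Sum>b\<in>Basis. of_real ((x \<bullet> b) / (norm x)\<^sup>2) * m b)"

text \<open>
  The second-order term for a density with second moments \<open>M\<close>. Even a multiple of the identity contributes, since
  the logarithm is not harmonic in dimension four.
\<close>

definition quadrupole :: "(R4 \<Rightarrow> R4 \<Rightarrow> complex) \<Rightarrow> R4 \<Rightarrow> complex" where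
  "quadrupole M x = of_real (1 / (2 * (norm x)\<^sup>2)) * (\<Sum>b\<in>Basis. M b b)
     - (\<Sum>b\<in>Basis. \<Sum>b'\<in>Basis. of_real ((x \<bullet> b) * (x \<bullet> b') / norm x ^ 4) * M b b')"

lemma dipole_homogeneous: "0 < R \<Longrightarrow> dipole m (R *\<^sub>R x) = dipole m x / of_real (R ^ 1)"
  unfolding dipole_def sum_divide_distrib
  by (intro sum.cong refl) (simp add: power_mult_distrib power2_eq_square)

lemma quadrupole_homogeneous:
  assumes R: "0 < R" shows "quadrupole M (R *\<^sub>R x) = quadrupole M x / of_real (R ^ 2)"
proof -
  have "of_real (1 / (2 * (norm (R *\<^sub>R x))\<^sup>2)) = complex_of_real (1 / (2 * (norm x)\<^sup>2)) / of_real (R ^ 2)"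
    using R by (simp add: power_mult_distrib)
  moreover have "of_real ((R *\<^sub>R x) \<bullet> b * ((R *\<^sub>R x) \<bullet> b') / norm (R *\<^sub>R x) ^ 4)
      = complex_of_real ((x \<bullet> b) * (x \<bullet> b') / norm x ^ 4) / of_real (R ^ 2)" for b b'
  proof -
    have scale: "(r * A) * (r * B) / (r * n) ^ 4 = (A * B / n ^ 4) / r ^ 2" if "0 < r" for r A B n :: real
      using that unfolding power_mult_distrib power4_eq_xxxx power2_eq_square
      by (cases "n = 0") (simp_all add: field_simps)
    have "(R *\<^sub>R x) \<bullet> b * ((R *\<^sub>R x) \<bullet> b') / norm (R *\<^sub>R x) ^ 4
        = (R * (x \<bullet> b)) * (R * (x \<bullet> b')) / (R * norm x) ^ 4" using R by simp
    also have "\<dots> = ((x \<bullet> b) * (x \<bullet> b') / norm x ^ 4) / R ^ 2" by (rule scale[OF R])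
    finally show ?thesis by (simp only: of_real_divide)
  qed
  ultimately show ?thesis
    unfolding quadrupole_def by (simp only: diff_divide_distrib sum_divide_distrib times_divide_eq_left)
qed

lemma dipole_isCont: "z \<noteq> 0 \<Longrightarrow> isCont (dipole m) z"
  unfolding dipole_def[abs_def] by (intro continuous_intros) auto

lemma quadrupole_isCont: "z \<noteq> 0 \<Longrightarrow> isCont (quadrupole M) z"
  unfolding quadrupole_def[abs_def] by (intro continuous_intros) auto

lemma dipole_bound: "cmod (dipole m x) \<le> (\<Sum>b\<in>Basis. cmod (m b)) / norm x"
proof (cases "x = 0")
  case False
  have "cmod (dipole m x) \<le> (\<Sum>b\<in>Basis. cmod (of_real ((x \<bullet> b) / (norm x)\<^sup>2) * m b))"
    unfolding dipole_def by (rule norm_sum)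
  also have "\<dots> \<le> (\<Sum>b\<in>Basis. cmod (m b) / norm x)"
  proof (rule sum_mono)
    fix b :: R4 assume b: "b \<in> Basis"
    have "\<bar>x \<bullet> b\<bar> / (norm x)\<^sup>2 \<le> norm x / (norm x)\<^sup>2"
      by (intro divide_right_mono Basis_le_norm b) simp
    then have "\<bar>x \<bullet> b\<bar> / (norm x)\<^sup>2 \<le> 1 / norm x" using False by (simp add: power2_eq_square)
    from mult_right_mono[OF this norm_ge_zero[of "m b"]]
    show "cmod (of_real ((x \<bullet> b) / (norm x)\<^sup>2) * m b) \<le> cmod (m b) / norm x"
      unfolding norm_mult norm_of_real by (simp add: abs_divide)
  qed
  finally show ?thesis by (simp add: sum_divide_distrib)
qed (simp add: dipole_def)

lemma quadrupole_bound: "\<exists>C\<ge>0. \<forall>x. cmod (quadrupole M x) \<le> C / (norm x)\<^sup>2"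
proof -
  let ?A = "cmod (\<Sum>b\<in>Basis. M b b)" and ?B = "\<Sum>b\<in>Basis. \<Sum>b'\<in>Basis. cmod (M b b')"
  have "cmod (quadrupole M x) \<le> (?A + ?B) / (norm x)\<^sup>2" for x
  proof (cases "x = 0")
    case False
    have "cmod (of_real (1 / (2 * (norm x)\<^sup>2)) * (\<Sum>b\<in>Basis. M b b)) = ?A / (2 * (norm x)\<^sup>2)"
      by (simp add: norm_mult norm_divide norm_power)
    also have "\<dots> \<le> ?A / (norm x)\<^sup>2" using False by (intro divide_left_mono) auto
    finally have 1: "cmod (of_real (1 / (2 * (norm x)\<^sup>2)) * (\<Sum>b\<in>Basis. M b b)) \<le> ?A / (norm x)\<^sup>2" .
    have t: "cmod (of_real ((x \<bullet> b) * (x \<bullet> b') / norm x ^ 4) * M b b') \<le> cmod (M b b') / (norm x)\<^sup>2"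
      if "b \<in> Basis" "b' \<in> Basis" for b b'
    proof -
      have "\<bar>x \<bullet> b\<bar> * \<bar>x \<bullet> b'\<bar> \<le> norm x * norm x"
        by (intro mult_mono Basis_le_norm that) auto
      then have "\<bar>x \<bullet> b\<bar> * \<bar>x \<bullet> b'\<bar> / norm x ^ 4 \<le> (norm x * norm x) / norm x ^ 4"
        by (rule divide_right_mono) simp
      also have "\<dots> = 1 / (norm x)\<^sup>2" using False by (simp add: power2_eq_square power4_eq_xxxx)
      finally have "\<bar>x \<bullet> b\<bar> * \<bar>x \<bullet> b'\<bar> / norm x ^ 4 * cmod (M b b') \<le> 1 / (norm x)\<^sup>2 * cmod (M b b')"
        by (rule mult_right_mono) simp
      then show ?thesis unfolding norm_mult norm_of_real by (simp add: abs_mult abs_divide)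
    qed
    have "cmod (\<Sum>b\<in>Basis. \<Sum>b'\<in>Basis. of_real ((x \<bullet> b) * (x \<bullet> b') / norm x ^ 4) * M b b')
        \<le> (\<Sum>b\<in>Basis. \<Sum>b'\<in>Basis. cmod (M b b') / (norm x)\<^sup>2)"
      by (intro sum_norm_le order_trans[OF norm_sum sum_mono] t) auto
    also have "\<dots> = ?B / (norm x)\<^sup>2" by (simp only: sum_divide_distrib)
    finally show ?thesis
      unfolding quadrupole_def add_divide_distrib
      by (intro order_trans[OF norm_triangle_ineq4 add_mono[OF 1]])
  qed (simp add: quadrupole_def)
  moreover have "0 \<le> ?A + ?B" by (intro add_nonneg_nonneg sum_nonneg) auto
  ultimately show ?thesis by blast
qed

lemma dipole_injective:
  assumes "\<And>z. z \<noteq> 0 \<Longrightarrow> dipole m z = 0" and b: "b \<in> Basis"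
  shows "m b = 0"
proof -
  have "dipole m b = (\<Sum>b'\<in>Basis. if b' = b then m b' else 0)"
    unfolding dipole_def by (intro sum.cong refl) (use b in \<open>auto simp: inner_Basis\<close>)
  then have "dipole m b = m b" using b by simp
  then show ?thesis using assms(1)[of b] b nonzero_Basis by auto
qed

text \<open>
  The quadratic form of \<open>M\<close> equals \<open>(tr M/2) \<bar>x\<bar>\<^sup>2\<close>. Taking traces in dimension four gives \<open>tr M = 2 tr M\<close>, so
  the trace vanishes, hence the quadratic form and with it the symmetric matrix.
\<close>

lemma quadrupole_injective:
  fixes M :: "R4 \<Rightarrow> R4 \<Rightarrow> complex"
  assumes zero: "\<And>z. z \<noteq> 0 \<Longrightarrow> quadrupole M z = 0" and sym: "\<And>b b'. M b b' = M b' b"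
    and b: "b \<in> Basis" and b': "b' \<in> Basis"
  shows "M b b' = 0"
proof -
  define t where "t = (\<Sum>b\<in>Basis. M b b)"
  \<comment> \<open>evaluation at the basis vectors gives the diagonal\<close>
  have diag: "M c c = t / 2" if c: "c \<in> Basis" for c
  proof -
    have "(\<Sum>b\<in>Basis. \<Sum>b'\<in>Basis. of_real ((c \<bullet> b) * (c \<bullet> b') / norm c ^ 4) * M b b')
      = (\<Sum>b\<in>Basis. \<Sum>b'\<in>Basis. if b' = c then (if b = c then M c c else 0) else 0)"
      by (intro sum.cong refl) (use c in \<open>auto simp: inner_Basis\<close>)
    also have "\<dots> = M c c" using c by simp
    finally have "quadrupole M c = t / 2 - M c c"
      unfolding quadrupole_def t_def using c by simp
    then show ?thesis using zero[of c] nonzero_Basis[OF c] by simp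
  qed
  have "t = (\<Sum>b\<in>(Basis :: R4 set). t / 2)"
    by (subst (1) t_def) (intro sum.cong refl diag)
  also have "\<dots> = 2 * t" by simp
  finally have t0: "t = 0" by simp
  show ?thesis
  proof (cases "b = b'")
    case True
    then show ?thesis using diag[OF b'] t0 by simp
  next
    case False
    \<comment> \<open>evaluation at the sum of two basis vectors gives the off-diagonal entries\<close>
    let ?z = "b + b'"
    have bb: "b \<bullet> b' = 0" "b' \<bullet> b = 0" "b \<bullet> b = 1" "b' \<bullet> b' = 1"
      using inner_Basis[OF b b'] inner_Basis[OF b' b] inner_Basis[OF b b] inner_Basis[OF b' b'] False by auto
    have nz: "(norm ?z)\<^sup>2 = 2" unfolding power2_norm_eq_inner by (simp add: inner_add bb)
    then have z0: "?z \<noteq> 0" by auto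
    have n4: "norm ?z ^ 4 = 4"
    proof -
      have "norm ?z ^ 4 = ((norm ?z)\<^sup>2)\<^sup>2" by (simp flip: power_mult)
      then show ?thesis unfolding nz by simp
    qed
    have zc: "?z \<bullet> c = (if c = b \<or> c = b' then 1 else 0)" if "c \<in> Basis" for c
      using inner_Basis[OF b that] inner_Basis[OF b' that] False by (auto simp: inner_add_left)
    have "(\<Sum>c\<in>Basis. \<Sum>c'\<in>Basis. of_real ((?z \<bullet> c) * (?z \<bullet> c') / norm ?z ^ 4) * M c c')
        = (\<Sum>c\<in>{b, b'}. \<Sum>c'\<in>{b, b'}. M c c' / 4)"
    proof -
      have "(\<Sum>c'\<in>Basis. of_real ((?z \<bullet> c) * (?z \<bullet> c') / norm ?z ^ 4) * M c c')
          = (\<Sum>c'\<in>{b, b'}. of_real (?z \<bullet> c) * M c c' / 4)" if "c \<in> Basis" for c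
        by (rule sum.mono_neutral_cong_right) (use zc b b' n4 in auto)
      then have "(\<Sum>c\<in>Basis. \<Sum>c'\<in>Basis. of_real ((?z \<bullet> c) * (?z \<bullet> c') / norm ?z ^ 4) * M c c')
          = (\<Sum>c\<in>Basis. \<Sum>c'\<in>{b, b'}. of_real (?z \<bullet> c) * M c c' / 4)" by simp
      also have "\<dots> = (\<Sum>c\<in>{b, b'}. \<Sum>c'\<in>{b, b'}. M c c' / 4)"
        by (rule sum.mono_neutral_cong_right) (use zc b b' in auto)
      finally show ?thesis .
    qed
    also have "\<dots> = (M b b + M b b' + M b' b + M b' b') / 4"
      using False by (simp add: add_divide_distrib)
    also have "\<dots> = M b b' / 2" using diag[OF b] diag[OF b'] t0 sym[of b' b] by simp
    finally have "quadrupole M ?z = - M b b' / 2"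
      unfolding quadrupole_def using t0 by (simp add: t_def)
    then show ?thesis using zero[OF z0] by simp
  qed
qed

section \<open>The operator \<open>T\<close> of a decaying potential\<close>

lemma pot_root_nonneg: "0 \<le> pot_root V x"
  by (simp add: pot_root_def)

lemma pot_sign_sq: "pot_sign V x * pot_sign V x = 1"
  by (simp add: pot_sign_def)

lemma abs_pot_sign: "\<bar>pot_sign V x\<bar> = 1"
  by (simp add: pot_sign_def)

locale decaying_potential =
  fixes V :: "R4 \<Rightarrow> real"
  assumes V_meas: "V \<in> borel_measurable lebesgue"
    and V_nonzero: "\<not> (AE x in lebesgue. V x = 0)"
    and v_decay: "decays_faster (pot_root V) 4"
begin

abbreviation v :: "R4 \<Rightarrow> real" where "v \<equiv> pot_root V"

text \<open>
  The function \<open>v\<close> as an element of the complex Hilbert space.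
\<close>

definition vc :: "R4 \<Rightarrow> complex" where "vc x = of_real (v x)"

lemma v_measurable: "v \<in> borel_measurable lebesgue"
  unfolding pot_root_def using V_meas by measurable

lemma sign_measurable: "pot_sign V \<in> borel_measurable lebesgue"
proof -
  have "{x \<in> space lebesgue. V x \<ge> 0} \<in> sets lebesgue" using V_meas by measurable
  then show ?thesis unfolding pot_sign_def by (intro measurable_If) auto
qed

text \<open>
  The form in which later estimates draw on the decay: \<open>\<langle>x\<rangle>\<^sup>4 v\<^sup>2\<close> is at most a multiple of \<open>\<langle>x\<rangle>^(-4 - e)\<close>, which is
  integrable in dimension four.
\<close>

lemma v_bounded_by_weight: "\<exists>C>0. AE x in lebesgue. japanese_bracket x ^ 4 * v x \<le> C"
  and weighted_v_sq_integrable: "integrable lebesgue (\<lambda>x. japanese_bracket x ^ 4 * (v x)\<^sup>2)"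
proof -
  obtain C e where C: "0 < C" "0 < e"
    and bd: "AE x in lebesgue. \<bar>v x\<bar> \<le> C * japanese_bracket x powr (- 4 - e)"
    using v_decay unfolding decays_faster_def by auto
  have pw: "japanese_bracket x ^ 4 * japanese_bracket x powr (- 4 - e) = japanese_bracket x powr (- e)" for x
  proof -
    have "japanese_bracket x ^ 4 = japanese_bracket x powr 4"
      using japanese_bracket_bounds(1)[of x] by simp
    then show ?thesis by (simp flip: powr_add)
  qed
  have le: "AE x in lebesgue. japanese_bracket x ^ 4 * v x \<le> C * japanese_bracket x powr (- e)"
    using bd
  proof eventually_elim
    case (elim x)
    have "japanese_bracket x ^ 4 * v x \<le> japanese_bracket x ^ 4 * (C * japanese_bracket x powr (- 4 - e))"
      using elim japanese_bracket_bounds(1)[of x] by (intro mult_left_mono) auto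
    also have "\<dots> = C * japanese_bracket x powr (- e)" by (simp flip: pw)
    finally show ?case .
  qed
  have small: "japanese_bracket x powr (- e) \<le> 1" for x
    using japanese_bracket_bounds(1)[of x] C powr_mono2'[of "- e" 1 "japanese_bracket x"] by simp
  have "AE x in lebesgue. japanese_bracket x ^ 4 * v x \<le> C"
    using le
  proof eventually_elim
    case (elim x)
    have "C * japanese_bracket x powr (- e) \<le> C * 1" using small C by (intro mult_left_mono) auto
    then show ?case using elim by simp
  qed
  then show "\<exists>C>0. AE x in lebesgue. japanese_bracket x ^ 4 * v x \<le> C" using C by blast
  show "integrable lebesgue (\<lambda>x. japanese_bracket x ^ 4 * (v x)\<^sup>2)"
  proof (rule Bochner_Integration.integrable_bound)
    show "integrable lebesgue (\<lambda>x. C * C * japanese_bracket x powr (- 4 - e))"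
      by (intro integrable_mult_right japanese_bracket_integrable C)
    show "(\<lambda>x. japanese_bracket x ^ 4 * (v x)\<^sup>2) \<in> borel_measurable lebesgue"
      by (intro borel_measurable_times borel_measurable_power v_measurable
          borel_imp_lebesgue_measurable[OF japanese_bracket_measurable])
    show "AE x in lebesgue. norm (japanese_bracket x ^ 4 * (v x)\<^sup>2)
      \<le> norm (C * C * japanese_bracket x powr (- 4 - e))"
      using bd le
    proof eventually_elim
      case (elim x)
      have "C * japanese_bracket x powr (- e) \<le> C * 1" using small C by (intro mult_left_mono) auto
      then have "japanese_bracket x ^ 4 * v x \<le> C" using elim by linarith
      then have "(japanese_bracket x ^ 4 * v x) * v x \<le> C * (C * japanese_bracket x powr (- 4 - e))"
        using elim C pot_root_nonneg[of V x] by (intro mult_mono) auto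
      then show ?case using C by (simp add: power2_eq_square mult.assoc)
    qed
  qed
qed

lemma weight_v_sq_integrable:
  assumes "k \<le> 4" shows "integrable lebesgue (\<lambda>x. japanese_bracket x ^ k * (v x)\<^sup>2)"
proof (rule Bochner_Integration.integrable_bound[OF weighted_v_sq_integrable])
  show "(\<lambda>x. japanese_bracket x ^ k * (v x)\<^sup>2) \<in> borel_measurable lebesgue"
    by (intro borel_measurable_times borel_measurable_power v_measurable
          borel_imp_lebesgue_measurable[OF japanese_bracket_measurable])
  show "AE x in lebesgue. norm (japanese_bracket x ^ k * (v x)\<^sup>2) \<le> norm (japanese_bracket x ^ 4 * (v x)\<^sup>2)"
  proof (rule AE_I2)
    fix x
    have b: "1 \<le> japanese_bracket x" by (rule japanese_bracket_bounds)
    have "japanese_bracket x ^ k \<le> japanese_bracket x ^ 4" by (rule power_increasing[OF assms b])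
    then show "norm (japanese_bracket x ^ k * (v x)\<^sup>2) \<le> norm (japanese_bracket x ^ 4 * (v x)\<^sup>2)"
      using b by (simp add: abs_mult mult_right_mono)
  qed
qed

lemma v_bounded: "\<exists>C>0. AE x in lebesgue. v x \<le> C \<and> japanese_bracket x ^ 4 * v x \<le> C"
proof -
  obtain C where C: "C > 0" "AE x in lebesgue. japanese_bracket x ^ 4 * v x \<le> C"
    using v_bounded_by_weight by auto
  have "AE x in lebesgue. v x \<le> C \<and> japanese_bracket x ^ 4 * v x \<le> C"
    using C(2)
  proof eventually_elim
    case (elim x)
    have "1 * v x \<le> japanese_bracket x ^ 4 * v x"
      using japanese_bracket_bounds(1)[of x] pot_root_nonneg by (intro mult_right_mono) auto
    then show ?case using elim by simp
  qed
  then show ?thesis using C by blast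
qed

lemma weight_v_L2:
  assumes "k \<le> 2" shows "(\<lambda>x. of_real (japanese_bracket x ^ k * v x)) \<in> L2"
proof (rule L2_dominated)
  have "(\<lambda>x. japanese_bracket x ^ k * v x) \<in> borel_measurable lebesgue"
    by (intro borel_measurable_times borel_measurable_power v_measurable
          borel_imp_lebesgue_measurable[OF japanese_bracket_measurable])
  then show "(\<lambda>x. complex_of_real (japanese_bracket x ^ k * v x)) \<in> borel_measurable lebesgue"
    by (rule measurable_compose[OF _ borel_measurable_of_real])
  show "integrable lebesgue (\<lambda>x. japanese_bracket x ^ (2 * k) * (v x)\<^sup>2)"
    using assms by (intro weight_v_sq_integrable) simp
  have "(cmod (complex_of_real (japanese_bracket x ^ k * v x)))\<^sup>2
      = japanese_bracket x ^ (2 * k) * (v x)\<^sup>2" for x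
    unfolding norm_of_real power2_abs power_mult_distrib by (simp add: mult.commute flip: power_mult)
  then show "AE x in lebesgue. (cmod (complex_of_real (japanese_bracket x ^ k * v x)))\<^sup>2
      \<le> japanese_bracket x ^ (2 * k) * (v x)\<^sup>2" by (simp only: order_refl AE_I2)
qed

lemma vc_L2: "vc \<in> L2"
  using weight_v_L2[of 0] unfolding vc_def by simp

lemma vc_nonzero: "\<not> (AE x in lebesgue. vc x = 0)"
  using V_nonzero by (simp add: vc_def pot_root_def)

lemma inner_vc: "l2_inner vc vc = of_real (LINT x|lebesgue. \<bar>V x\<bar>)"
  by (simp add: l2_inner_self vc_def pot_root_def)

lemma norm_V_pos: "0 < (LINT x|lebesgue. \<bar>V x\<bar>)"
proof -
  have "l2_inner vc vc \<noteq> 0" using l2_inner_self_eq_0[OF vc_L2] vc_nonzero by simp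
  then have "(LINT x|lebesgue. \<bar>V x\<bar>) \<noteq> 0" by (simp add: inner_vc)
  moreover have "0 \<le> (LINT x|lebesgue. \<bar>V x\<bar>)" by simp
  ultimately show ?thesis by linarith
qed

text \<open>
  The kernel of \<open>G\<^sub>1v\<close> up to a constant factor, with \<open>log \<langle>x\<rangle>\<close> subtracted. The subtraction makes its
  \<open>L\<^sup>2\<close> norm in \<open>y\<close> bounded uniformly in \<open>x\<close>.
\<close>

definition shifted_log :: "R4 \<Rightarrow> R4 \<Rightarrow> complex" where
  "shifted_log x y = of_real ((ln (norm (x - y)) - ln (japanese_bracket x)) * v y)"

lemma shifted_log_L2_bound:
  "\<exists>D\<ge>0. \<forall>x. shifted_log x \<in> L2 \<and> (LINT y|lebesgue. (cmod (shifted_log x y))\<^sup>2) \<le> D"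
proof -
  obtain C where C: "C > 0" "AE x in lebesgue. v x \<le> C \<and> japanese_bracket x ^ 4 * v x \<le> C"
    using v_bounded by blast
  have "\<exists>D. \<forall>x. integrable lebesgue (\<lambda>y. (v y)\<^sup>2 / (norm (x - y))\<^sup>2)
    \<and> (LINT y|lebesgue. (v y)\<^sup>2 / (norm (x - y))\<^sup>2) \<le> D"
  proof (rule inverse_square_potential_bounded)
    show "integrable lebesgue (\<lambda>x. (v x)\<^sup>2)" using weight_v_sq_integrable[of 0] by simp
    show "AE y in lebesgue. (v y)\<^sup>2 \<le> C\<^sup>2"
      using C(2) by eventually_elim (auto intro!: power_mono pot_root_nonneg)
  qed simp
  then obtain D where Di: "\<And>x. integrable lebesgue (\<lambda>y. (v y)\<^sup>2 / (norm (x - y))\<^sup>2)"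
    and Db: "\<And>x. (LINT y|lebesgue. (v y)\<^sup>2 / (norm (x - y))\<^sup>2) \<le> D" by auto
  let ?g = "\<lambda>x y. 8 * (japanese_bracket y ^ 2 * (v y)\<^sup>2) + 2 * ((v y)\<^sup>2 / (norm (x - y))\<^sup>2)"
  let ?I = "LINT y|lebesgue. japanese_bracket y ^ 2 * (v y)\<^sup>2"
  have wi: "integrable lebesgue (\<lambda>y. japanese_bracket y ^ 2 * (v y)\<^sup>2)"
    by (rule weight_v_sq_integrable) simp
  have gi: "integrable lebesgue (?g x)" for x
    by (intro Bochner_Integration.integrable_add integrable_mult_right wi Di)
  have le: "(cmod (shifted_log x y))\<^sup>2 \<le> ?g x y" for x y
  proof -
    let ?b = "japanese_bracket y" and ?q = "1 / norm (x - y)"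
    have "(ln (norm (x - y)) - ln (japanese_bracket x))\<^sup>2 \<le> (2 * ?b + ?q)\<^sup>2"
      using ln_dist_bound[of x y] by (intro abs_le_square_iff[THEN iffD1]) simp
    also have "\<dots> \<le> 8 * ?b\<^sup>2 + 2 * ?q\<^sup>2"
      using zero_le_power2[of "2 * ?b - ?q"] unfolding power2_eq_square by argo
    finally have "(ln (norm (x - y)) - ln (japanese_bracket x))\<^sup>2 * (v y)\<^sup>2 \<le> (8 * ?b\<^sup>2 + 2 * ?q\<^sup>2) * (v y)\<^sup>2"
      by (intro mult_right_mono) auto
    then show ?thesis
      unfolding shifted_log_def norm_of_real power2_abs power_mult_distrib
      by (simp add: distrib_right power_divide)
  qed
  have meas: "shifted_log x \<in> borel_measurable lebesgue" for x
  proof -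
    have "(\<lambda>y. (ln (norm (x - y)) - ln (japanese_bracket x)) * v y) \<in> borel_measurable lebesgue"
      by (intro borel_measurable_times borel_measurable_diff ln_dist_measurable borel_measurable_const v_measurable)
    then show ?thesis unfolding shifted_log_def[abs_def] by (rule measurable_compose[OF _ borel_measurable_of_real])
  qed
  have L: "shifted_log x \<in> L2" for x
    by (rule L2_dominated[OF meas gi]) (use le in auto)
  have "(LINT y|lebesgue. (cmod (shifted_log x y))\<^sup>2) \<le> 8 * ?I + 2 * D" for x
  proof -
    have "(LINT y|lebesgue. (cmod (shifted_log x y))\<^sup>2) \<le> (LINT y|lebesgue. ?g x y)"
      by (rule integral_mono[OF L2_norm_sq_integrable[OF L] gi le])
    also have "\<dots> = 8 * ?I + 2 * (LINT y|lebesgue. (v y)\<^sup>2 / (norm (x - y))\<^sup>2)"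
      by (subst Bochner_Integration.integral_add[OF integrable_mult_right[OF wi] integrable_mult_right[OF Di]])
         (simp only: integral_mult_right_zero)
    also have "\<dots> \<le> 8 * ?I + 2 * D" using Db[of x] by simp
    finally show ?thesis .
  qed
  then have "\<forall>x. shifted_log x \<in> L2 \<and> (LINT y|lebesgue. (cmod (shifted_log x y))\<^sup>2) \<le> max 0 (8 * ?I + 2 * D)"
    using L by (simp add: le_max_iff_disj)
  then show ?thesis by (intro exI[of _ "max 0 (8 * ?I + 2 * D)"]) simp
qed

lemma shifted_log_L2: "shifted_log x \<in> L2"
  using shifted_log_L2_bound by blast

lemma log_potential_integrable:
  assumes f: "f \<in> L2"
  shows "integrable lebesgue (\<lambda>y. ln (norm (x - y)) *\<^sub>R mult_op v f y)"
    and "(LINT y|lebesgue. ln (norm (x - y)) *\<^sub>R mult_op v f y)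
      = l2_inner f (shifted_log x) + of_real (ln (japanese_bracket x)) * l2_inner f vc"
proof -
  have eq: "ln (norm (x - y)) *\<^sub>R mult_op v f y
      = f y * cnj (shifted_log x y) + of_real (ln (japanese_bracket x)) * (f y * cnj (vc y))" for y
    by (simp add: shifted_log_def vc_def mult_op_def scaleR_conv_of_real algebra_simps)
  note i1 = l2_inner_integrable[OF f shifted_log_L2[of x]]
  note i2 = l2_inner_integrable[OF f vc_L2]
  show "integrable lebesgue (\<lambda>y. ln (norm (x - y)) *\<^sub>R mult_op v f y)"
    unfolding eq by (intro Bochner_Integration.integrable_add integrable_mult_right i1 i2)
  show "(LINT y|lebesgue. ln (norm (x - y)) *\<^sub>R mult_op v f y)
      = l2_inner f (shifted_log x) + of_real (ln (japanese_bracket x)) * l2_inner f vc"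
    unfolding eq l2_inner_def
    by (subst Bochner_Integration.integral_add[OF i1 integrable_mult_right[OF i2]]) simp
qed

lemma mult_op_measurable:
  "f \<in> borel_measurable lebesgue \<Longrightarrow> mult_op v f \<in> borel_measurable lebesgue"
  unfolding mult_op_def[abs_def] by (intro borel_measurable_scaleR v_measurable)

text \<open>
  In this form the linearity of \<open>G\<^sub>1v\<close>, its growth, and its boundedness on functions orthogonal to \<open>v\<close>
  can be read off from inner products.
\<close>

lemma G1_eq:
  assumes "f \<in> L2"
  shows "G1 (mult_op v f) x = of_real (- (1 / (8 * pi\<^sup>2)))
    * (l2_inner f (shifted_log x) + of_real (ln (japanese_bracket x)) * l2_inner f vc)"
  unfolding G1_def log_potential_integrable(2)[OF assms] by (simp only: scaleR_conv_of_real)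

lemma log_potential_growth:
  assumes f: "f \<in> L2"
  shows "\<exists>B\<ge>0. \<forall>x. (LINT y|lebesgue. norm (ln (norm (x - y)) *\<^sub>R mult_op v f y)) \<le> B * japanese_bracket x"
proof -
  obtain D where D: "0 \<le> D" "\<And>x. (LINT y|lebesgue. (cmod (shifted_log x y))\<^sup>2) \<le> D"
    using shifted_log_L2_bound by auto
  let ?N = "LINT x|lebesgue. (cmod (f x))\<^sup>2"
  define B where "B = (?N + D) + (LINT y|lebesgue. norm (f y * cnj (vc y)))"
  have N0: "0 \<le> ?N" and J0: "0 \<le> (LINT y|lebesgue. norm (f y * cnj (vc y)))" by simp_all
  have "(LINT y|lebesgue. norm (ln (norm (x - y)) *\<^sub>R mult_op v f y)) \<le> B * japanese_bracket x" for x
  proof -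
    let ?l = "ln (japanese_bracket x)"
    have l: "0 \<le> ?l" "?l \<le> japanese_bracket x"
      using japanese_bracket_bounds(1)[of x] ln_le_minus_one[of "japanese_bracket x"] by auto
    note i1 = integrable_norm[OF l2_inner_integrable[OF f shifted_log_L2[of x]]]
    note i2 = integrable_norm[OF l2_inner_integrable[OF f vc_L2]]
    have eq: "ln (norm (x - y)) *\<^sub>R mult_op v f y
      = f y * cnj (shifted_log x y) + of_real ?l * (f y * cnj (vc y))" for y
      by (simp add: shifted_log_def vc_def mult_op_def scaleR_conv_of_real algebra_simps)
    have "(LINT y|lebesgue. norm (ln (norm (x - y)) *\<^sub>R mult_op v f y))
      \<le> (LINT y|lebesgue. norm (f y * cnj (shifted_log x y)) + ?l * norm (f y * cnj (vc y)))"
    proof (rule integral_mono[OF integrable_norm[OF log_potential_integrable(1)[OF f]]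
          Bochner_Integration.integrable_add[OF i1 integrable_mult_right[OF i2]]])
      fix y
      show "norm (ln (norm (x - y)) *\<^sub>R mult_op v f y)
        \<le> norm (f y * cnj (shifted_log x y)) + ?l * norm (f y * cnj (vc y))"
        unfolding eq using norm_triangle_ineq[of "f y * cnj (shifted_log x y)" "of_real ?l * (f y * cnj (vc y))"] l
        by (simp add: norm_mult)
    qed
    also have "\<dots> = (LINT y|lebesgue. norm (f y * cnj (shifted_log x y))) + ?l * (LINT y|lebesgue. norm (f y * cnj (vc y)))"
      by (subst Bochner_Integration.integral_add[OF i1 integrable_mult_right[OF i2]])
         (simp only: integral_mult_right_zero)
    also have "\<dots> \<le> (?N + D) + japanese_bracket x * (LINT y|lebesgue. norm (f y * cnj (vc y)))"
      using l2_inner_norm_bound(2)[OF f shifted_log_L2[of x]] D(2)[of x] mult_right_mono[OF l(2) J0]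
      by linarith
    also have "\<dots> \<le> B * japanese_bracket x"
      using mult_left_mono[OF japanese_bracket_bounds(1)[of x], of "?N + D"] N0 D(1)
      unfolding B_def by (simp add: algebra_simps)
    finally show ?thesis .
  qed
  moreover have "0 \<le> B" unfolding B_def using N0 J0 D(1) by linarith
  ultimately show ?thesis by blast
qed

lemma G1_growth:
  assumes f: "f \<in> L2"
  shows "\<exists>B\<ge>0. \<forall>x. cmod (G1 (mult_op v f) x) \<le> B * japanese_bracket x"
proof -
  obtain B where B: "0 \<le> B"
    "\<And>x. (LINT y|lebesgue. norm (ln (norm (x - y)) *\<^sub>R mult_op v f y)) \<le> B * japanese_bracket x"
    using log_potential_growth[OF f] by auto
  have "cmod (G1 (mult_op v f) x) \<le> (1 / (8 * pi\<^sup>2) * B) * japanese_bracket x" for x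
  proof -
    have "cmod (G1 (mult_op v f) x) = 1 / (8 * pi\<^sup>2) * cmod (LINT y|lebesgue. ln (norm (x - y)) *\<^sub>R mult_op v f y)"
      unfolding G1_def by simp
    also have "\<dots> \<le> 1 / (8 * pi\<^sup>2) * (B * japanese_bracket x)"
      by (intro mult_left_mono order_trans[OF integral_norm_bound B(2)]) auto
    finally show ?thesis by simp
  qed
  then show ?thesis using B(1) by (intro exI[of _ "1 / (8 * pi\<^sup>2) * B"]) auto
qed

lemma vG1v_L2:
  assumes f: "f \<in> L2"
  shows "mult_op v (G1 (mult_op v f)) \<in> L2"
proof -
  obtain B where B: "0 \<le> B" "\<And>x. cmod (G1 (mult_op v f) x) \<le> B * japanese_bracket x"
    using G1_growth[OF f] by auto
  show ?thesis
  proof (rule L2_dominated)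
    show "mult_op v (G1 (mult_op v f)) \<in> borel_measurable lebesgue"
      by (intro mult_op_measurable G1_measurable L2_measurable f)
    show "integrable lebesgue (\<lambda>x. B\<^sup>2 * (japanese_bracket x ^ 2 * (v x)\<^sup>2))"
      by (intro integrable_mult_right weight_v_sq_integrable) simp
    have "(cmod (mult_op v (G1 (mult_op v f)) x))\<^sup>2 \<le> B\<^sup>2 * (japanese_bracket x ^ 2 * (v x)\<^sup>2)" for x
    proof -
      have "cmod (mult_op v (G1 (mult_op v f)) x) \<le> v x * (B * japanese_bracket x)"
        unfolding mult_op_def norm_scaleR using B(2)[of x] pot_root_nonneg[of V x]
        by (simp add: mult_left_mono mult_op_def[abs_def])
      then have "(cmod (mult_op v (G1 (mult_op v f)) x))\<^sup>2 \<le> (v x * (B * japanese_bracket x))\<^sup>2"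
        by (intro power_mono) auto
      then show ?thesis by (simp add: power_mult_distrib mult_ac)
    qed
    then show "AE x in lebesgue. (cmod (mult_op v (G1 (mult_op v f)) x))\<^sup>2
      \<le> B\<^sup>2 * (japanese_bracket x ^ 2 * (v x)\<^sup>2)" by simp
  qed
qed

lemma sign_mult_L2: "f \<in> L2 \<Longrightarrow> mult_op (pot_sign V) f \<in> L2"
  by (rule L2_dominated[OF _ L2_norm_sq_integrable[of f]])
     (auto simp: mult_op_def[abs_def] abs_pot_sign L2_measurable intro!: borel_measurable_scaleR sign_measurable)

lemma T_L2: "f \<in> L2 \<Longrightarrow> T_op V f \<in> L2"
  unfolding T_op_def[abs_def] by (intro L2_add sign_mult_L2 vG1v_L2)

lemma G1_cong:
  assumes "f \<in> L2" "g \<in> L2" "AE x in lebesgue. f x = g x"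
  shows "G1 (mult_op v f) x = G1 (mult_op v g) x"
proof (rule G1_cong_AE)
  show "mult_op v f \<in> borel_measurable lebesgue" "mult_op v g \<in> borel_measurable lebesgue"
    by (intro mult_op_measurable L2_measurable assms)+
qed (use assms(3) in \<open>auto simp: mult_op_def\<close>)

lemma T_cong:
  assumes "f \<in> L2" "g \<in> L2" "AE x in lebesgue. f x = g x"
  shows "AE x in lebesgue. T_op V f x = T_op V g x"
  using assms(3) by eventually_elim (simp add: T_op_def mult_op_def[where f = f] mult_op_def[where f = g]
      mult_op_def[where f = "G1 h" for h] G1_cong[OF assms])

lemma G1_add:
  assumes "f \<in> L2" "g \<in> L2"
  shows "G1 (mult_op v (\<lambda>x. f x + g x)) x = G1 (mult_op v f) x + G1 (mult_op v g) x"
  unfolding G1_eq[OF assms(1)] G1_eq[OF assms(2)] G1_eq[OF L2_add[OF assms]]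
    l2_inner_add_left[OF assms vc_L2] l2_inner_add_left[OF assms shifted_log_L2]
  by (simp add: algebra_simps)

lemma G1_scale:
  assumes "f \<in> L2"
  shows "G1 (mult_op v (\<lambda>x. a * f x)) x = a * G1 (mult_op v f) x"
  unfolding G1_eq[OF assms(1)] G1_eq[OF L2_scale[OF assms]] l2_inner_scale_left
  by (simp add: algebra_simps)

lemma T_add:
  "f \<in> L2 \<Longrightarrow> g \<in> L2 \<Longrightarrow> T_op V (\<lambda>x. f x + g x) x = T_op V f x + T_op V g x"
  using G1_add[of f g x] by (simp add: T_op_def mult_op_def algebra_simps)

lemma T_scale: "f \<in> L2 \<Longrightarrow> T_op V (\<lambda>x. a * f x) x = a * T_op V f x"
  using G1_scale[of f a x] by (simp add: T_op_def mult_op_def algebra_simps)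

lemma T_self_adjoint:
  assumes f: "f \<in> L2" and g: "g \<in> L2"
  shows "l2_inner (T_op V f) g = l2_inner f (T_op V g)"
proof -
  let ?h = "\<lambda>x. cnj (g x)"
  have hL: "?h \<in> L2" by (rule L2_cnj[OF g])
  obtain B where B: "0 \<le> B"
    "\<And>x. (LINT y|lebesgue. norm (ln (norm (x - y)) *\<^sub>R mult_op v f y)) \<le> B * japanese_bracket x"
    using log_potential_growth[OF f] by auto
  have "(LINT x|lebesgue. G1 (mult_op v f) x * mult_op v ?h x) = (LINT x|lebesgue. mult_op v f x * G1 (mult_op v ?h) x)"
  proof (rule G1_symmetric)
    show "mult_op v f \<in> borel_measurable lebesgue" "mult_op v ?h \<in> borel_measurable lebesgue"
      by (intro mult_op_measurable L2_measurable f hL)+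
    show "integrable lebesgue (\<lambda>y. ln (norm (x - y)) *\<^sub>R mult_op v f y)" for x
      by (rule log_potential_integrable[OF f])
    show "(LINT y|lebesgue. norm (ln (norm (x - y)) *\<^sub>R mult_op v f y)) \<le> B * japanese_bracket x" for x
      by (rule B)
    have "integrable lebesgue (\<lambda>x. norm (of_real (japanese_bracket x ^ 1 * v x) * g x))"
      by (intro integrable_norm L2_mult_integrable weight_v_L2 g) simp
    then have "integrable lebesgue (\<lambda>x. B * norm (of_real (japanese_bracket x ^ 1 * v x) * g x))"
      by (rule integrable_mult_right)
    moreover have "(\<lambda>x. B * norm (of_real (japanese_bracket x ^ 1 * v x) * g x))
        = (\<lambda>x. B * japanese_bracket x * cmod (mult_op v ?h x))"
    proof
      fix x
      have "0 \<le> japanese_bracket x" using japanese_bracket_bounds(1)[of x] by linarith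
      then show "B * norm (of_real (japanese_bracket x ^ 1 * v x) * g x)
        = B * japanese_bracket x * cmod (mult_op v ?h x)" by (simp add: mult_op_def norm_mult)
    qed
    ultimately show "integrable lebesgue (\<lambda>x. B * japanese_bracket x * cmod (mult_op v ?h x))"
      by (simp only:)
  qed
  moreover have "G1 (mult_op v ?h) x = cnj (G1 (mult_op v g) x)" for x
  proof -
    have "(LINT y|lebesgue. ln (norm (x - y)) *\<^sub>R mult_op v ?h y)
      = (LINT y|lebesgue. cnj (ln (norm (x - y)) *\<^sub>R mult_op v g y))"
      by (simp add: mult_op_def)
    also have "\<dots> = cnj (LINT y|lebesgue. ln (norm (x - y)) *\<^sub>R mult_op v g y)"
      by (simp only: Bochner_Integration.integral_cnj)
    finally show ?thesis unfolding G1_def by simp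
  qed
  ultimately have sym: "(LINT x|lebesgue. mult_op v (G1 (mult_op v f)) x * cnj (g x))
     = (LINT x|lebesgue. f x * cnj (mult_op v (G1 (mult_op v g)) x))"
    by (simp add: mult_op_def[of v] mult_ac)
  have "l2_inner (T_op V f) g = l2_inner (mult_op (pot_sign V) f) g + l2_inner (mult_op v (G1 (mult_op v f))) g"
    unfolding T_op_def[abs_def] by (rule l2_inner_add_left[OF sign_mult_L2[OF f] vG1v_L2[OF f] g])
  also have "l2_inner (mult_op (pot_sign V) f) g = l2_inner f (mult_op (pot_sign V) g)"
    unfolding l2_inner_def by (simp add: mult_op_def)
  also have "l2_inner (mult_op v (G1 (mult_op v f))) g = l2_inner f (mult_op v (G1 (mult_op v g)))"
    unfolding l2_inner_def by (rule sym)
  also have "l2_inner f (mult_op (pot_sign V) g) + l2_inner f (mult_op v (G1 (mult_op v g))) = l2_inner f (T_op V g)"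
    unfolding T_op_def[abs_def] by (rule l2_inner_add_right[OF sign_mult_L2[OF g] vG1v_L2[OF g] f, symmetric])
  finally show ?thesis .
qed

section \<open>The first projection\<close>

lemma P_op_eq: "P_op V = orth_proj {g \<in> L2. \<exists>a::complex. AE x in lebesgue. g x = a * vc x}"
  by (simp add: P_op_def vc_def)

lemma P_op_AE:
  "f \<in> L2 \<Longrightarrow> AE x in lebesgue. P_op V f x = l2_inner f vc / l2_inner vc vc * vc x"
  unfolding P_op_eq by (rule span_singleton_complemented(3)[OF vc_L2 vc_nonzero])

lemma P_op_L2: "f \<in> L2 \<Longrightarrow> P_op V f \<in> L2"
  unfolding P_op_eq
  by (rule l2_subspaceD(1)[OF span_singleton_complemented(1)[OF vc_L2 vc_nonzero]
        orth_proj_props(1)[OF span_singleton_complemented(2)[OF vc_L2 vc_nonzero]]])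

lemma inner_vc_nonzero: "l2_inner vc vc \<noteq> 0"
  using norm_V_pos by (simp add: inner_vc)

lemma P_op_of_multiple:
  assumes f: "f \<in> L2" and a: "AE x in lebesgue. f x = a * vc x"
  shows "AE x in lebesgue. P_op V f x = a * vc x"
proof -
  have "l2_inner f vc = l2_inner (\<lambda>x. a * vc x) vc"
    by (rule l2_inner_cong_AE) (use f a L2_scale[OF vc_L2] vc_L2 in auto)
  then have "l2_inner f vc / l2_inner vc vc = a"
    using inner_vc_nonzero by (simp add: l2_inner_scale_left)
  then show ?thesis using P_op_AE[OF f] by simp
qed

lemma Q_op_L2: "f \<in> L2 \<Longrightarrow> Q_op V f \<in> L2"
  unfolding Q_op_def[abs_def] by (intro L2_diff P_op_L2)

lemma Q_op_orthogonal:
  assumes f: "f \<in> L2" shows "l2_inner (Q_op V f) vc = 0"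
proof -
  let ?a = "l2_inner f vc / l2_inner vc vc"
  have "l2_inner (P_op V f) vc = l2_inner (\<lambda>x. ?a * vc x) vc"
    by (rule l2_inner_cong_AE[OF P_op_L2[OF f] L2_scale[OF vc_L2] vc_L2 vc_L2 P_op_AE[OF f]]) simp
  then show ?thesis
    unfolding Q_op_def[abs_def] l2_inner_diff_left[OF f P_op_L2[OF f] vc_L2] l2_inner_scale_left
    using inner_vc_nonzero by simp
qed

lemma Q_op_ident:
  assumes f: "f \<in> L2" and "l2_inner f vc = 0"
  shows "AE x in lebesgue. Q_op V f x = f x"
  using P_op_AE[OF f] by eventually_elim (simp add: Q_op_def assms)

lemma range_Q_op: "range_L2 (Q_op V) = {f \<in> L2. l2_inner f vc = 0}"
proof (intro equalityI subsetI)
  fix g assume "g \<in> range_L2 (Q_op V)"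
  then obtain f where g: "g \<in> L2" and f: "f \<in> L2" and ae: "AE x in lebesgue. g x = Q_op V f x"
    by (auto simp: range_L2_def)
  have "l2_inner g vc = l2_inner (Q_op V f) vc"
    by (rule l2_inner_cong_AE[OF g Q_op_L2[OF f] vc_L2 vc_L2 ae]) simp
  then show "g \<in> {f \<in> L2. l2_inner f vc = 0}" using g Q_op_orthogonal[OF f] by simp
next
  fix g assume "g \<in> {f \<in> L2. l2_inner f vc = 0}"
  then have g: "g \<in> L2" "l2_inner g vc = 0" by auto
  have "AE x in lebesgue. g x = Q_op V g x" using Q_op_ident[OF g] by eventually_elim simp
  then show "g \<in> range_L2 (Q_op V)" using g unfolding range_L2_def by auto
qed

definition S1_space :: "(R4 \<Rightarrow> complex) set" where
  "S1_space = {f \<in> L2. l2_inner f vc = 0 \<and> (\<exists>c. AE x in lebesgue. T_op V f x = c * vc x)}"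

text \<open>
  The coefficient of \<open>v\<close> in \<open>P T f\<close>; it is the constant \<open>c\<^sub>0\<close> of the theorem.
\<close>

definition T_coeff :: "(R4 \<Rightarrow> complex) \<Rightarrow> complex" where
  "T_coeff f = l2_inner (T_op V f) vc / l2_inner vc vc"

text \<open>
  On the range of \<open>Q\<close> the operator \<open>Q\<close> is the identity, and \<open>Q\<close> annihilates exactly the multiples of \<open>v\<close>.
\<close>

lemma kernel_QTQ: "kernel_on (Q_op V \<circ> T_op V \<circ> Q_op V) (range_L2 (Q_op V)) = S1_space"
proof -
  have "(AE x in lebesgue. Q_op V (T_op V (Q_op V f)) x = 0) \<longleftrightarrow> (\<exists>c. AE x in lebesgue. T_op V f x = c * vc x)"
    if f: "f \<in> L2" and f0: "l2_inner f vc = 0" for f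
  proof -
    define h where "h = T_op V (Q_op V f)"
    have h: "h \<in> L2" unfolding h_def by (intro T_L2 Q_op_L2 f)
    have hT: "AE x in lebesgue. h x = T_op V f x"
      unfolding h_def by (rule T_cong[OF Q_op_L2[OF f] f Q_op_ident[OF f f0]])
    show ?thesis unfolding h_def[symmetric]
    proof
      assume "AE x in lebesgue. Q_op V h x = 0"
      then have "AE x in lebesgue. T_op V f x = l2_inner h vc / l2_inner vc vc * vc x"
        using hT P_op_AE[OF h] by eventually_elim (simp add: Q_op_def)
      then show "\<exists>c. AE x in lebesgue. T_op V f x = c * vc x" by (rule exI)
    next
      assume "\<exists>c. AE x in lebesgue. T_op V f x = c * vc x"
      then obtain c where c: "AE x in lebesgue. T_op V f x = c * vc x" by (elim exE)
      have hc: "AE x in lebesgue. h x = c * vc x" using hT c by eventually_elim simp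
      show "AE x in lebesgue. Q_op V h x = 0"
        using hc P_op_of_multiple[OF h hc] by eventually_elim (simp add: Q_op_def)
    qed
  qed
  then show ?thesis
    unfolding kernel_on_def range_Q_op S1_space_def o_apply mem_Collect_eq conj_assoc
    by (intro Collect_cong conj_cong refl)
qed

lemma S1_spaceD:
  assumes "f \<in> S1_space"
  shows "f \<in> L2" "l2_inner f vc = 0" "AE x in lebesgue. T_op V f x = T_coeff f * vc x"
proof -
  show f: "f \<in> L2" and "l2_inner f vc = 0" using assms by (auto simp: S1_space_def)
  obtain c where c: "AE x in lebesgue. T_op V f x = c * vc x"
    using assms by (auto simp: S1_space_def)
  have "l2_inner (T_op V f) vc = l2_inner (\<lambda>x. c * vc x) vc"
    by (rule l2_inner_cong_AE[OF T_L2[OF f] L2_scale[OF vc_L2] vc_L2 vc_L2 c]) simp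
  then have "T_coeff f = c" using inner_vc_nonzero by (simp add: T_coeff_def l2_inner_scale_left)
  then show "AE x in lebesgue. T_op V f x = T_coeff f * vc x" using c by simp
qed

lemma S1_space_subspace: "l2_subspace S1_space"
  unfolding l2_subspace_def
proof (intro conjI ballI allI impI)
  show "S1_space \<subseteq> L2" unfolding S1_space_def by auto
  have "T_op V (\<lambda>x. 0) x = 0" for x using T_scale[OF L2_zero, of 0 x] by simp
  then show "(\<lambda>x. 0) \<in> S1_space"
    unfolding S1_space_def using L2_zero by (auto simp: l2_inner_zero_left intro!: exI[of _ 0])
next
  fix f g assume f: "f \<in> S1_space" and g: "g \<in> S1_space"
  note F = S1_spaceD[OF f] and G = S1_spaceD[OF g]
  have "AE x in lebesgue. T_op V (\<lambda>x. f x + g x) x = (T_coeff f + T_coeff g) * vc x"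
    using F(3) G(3) by eventually_elim (simp add: T_add F G distrib_right)
  then show "(\<lambda>x. f x + g x) \<in> S1_space"
    using L2_add[OF F(1) G(1)] l2_inner_add_left[OF F(1) G(1) vc_L2] F(2) G(2)
    unfolding S1_space_def by auto
next
  fix f a assume f: "f \<in> S1_space"
  note F = S1_spaceD[OF f]
  have "AE x in lebesgue. T_op V (\<lambda>x. a * f x) x = (a * T_coeff f) * vc x"
    using F(3) by eventually_elim (simp add: T_scale F)
  then have "\<exists>c. AE x in lebesgue. T_op V (\<lambda>x. a * f x) x = c * vc x" by (rule exI)
  then show "(\<lambda>x. a * f x) \<in> S1_space"
    using L2_scale[OF F(1), of a] l2_inner_scale_left[of a f vc] F(2)
    unfolding S1_space_def by simp
next
  fix f g assume f: "f \<in> S1_space" and g: "g \<in> L2" and fg: "AE x in lebesgue. f x = g x"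
  note F = S1_spaceD[OF f]
  have "AE x in lebesgue. T_op V g x = T_coeff f * vc x"
    using F(3) T_cong[OF F(1) g fg] by eventually_elim simp
  then have "\<exists>c. AE x in lebesgue. T_op V g x = c * vc x" by (rule exI)
  moreover have "l2_inner g vc = l2_inner f vc"
    by (rule l2_inner_cong_AE) (use g F(1) vc_L2 fg in auto)
  ultimately show "g \<in> S1_space" using g F(2) unfolding S1_space_def by simp
qed

text \<open>
  The equation \<open>U f + vG\<^sub>1v f = c v\<close> solved for \<open>f\<close>, using \<open>U\<^sup>2 = 1\<close>.
\<close>

lemma S1_space_representation:
  assumes f: "f \<in> S1_space"
  shows "AE x in lebesgue. f x = of_real (pot_sign V x) * (of_real (v x) * (T_coeff f - G1 (mult_op v f) x))"
  using S1_spaceD(3)[OF f]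
proof eventually_elim
  case (elim x)
  define s where "s = complex_of_real (pot_sign V x)"
  have ss: "s * s = 1" unfolding s_def by (simp add: pot_sign_sq flip: of_real_mult)
  have "s * f x + of_real (v x) * G1 (mult_op v f) x = T_coeff f * of_real (v x)"
    using elim by (simp add: T_op_def mult_op_def[of "pot_sign V"] mult_op_def[of v "G1 h" for h] s_def vc_def scaleR_conv_of_real)
  then have "s * f x = of_real (v x) * (T_coeff f - G1 (mult_op v f) x)"
    by (simp add: algebra_simps)
  then have "s * s * f x = s * (of_real (v x) * (T_coeff f - G1 (mult_op v f) x))"
    by (simp only: mult.assoc)
  then show ?case unfolding ss mult_1 unfolding s_def .
qed

lemma S1_space_G1:
  assumes f: "f \<in> S1_space"
  shows "G1 (mult_op v f) x = of_real (- (1 / (8 * pi\<^sup>2))) * l2_inner f (shifted_log x)"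
  using G1_eq[OF S1_spaceD(1)[OF f]] S1_spaceD(2)[OF f] by simp

text \<open>
  Orthogonality to \<open>v\<close> removes the growing part \<open>log \<langle>x\<rangle>\<close> of the potential.
\<close>

lemma S1_space_bounded:
  assumes f: "f \<in> S1_space"
  shows "\<exists>B\<ge>0. \<forall>x. cmod (T_coeff f - G1 (mult_op v f) x) \<le> B"
proof -
  note F = S1_spaceD[OF f]
  obtain D where D: "0 \<le> D" "\<And>x. (LINT y|lebesgue. (cmod (shifted_log x y))\<^sup>2) \<le> D"
    using shifted_log_L2_bound by auto
  define K where "K = (LINT y|lebesgue. (cmod (f y))\<^sup>2) + D"
  \<comment> \<open>the factor \<open>1/(8\<pi>\<^sup>2)\<close> is the constant of \<open>G\<^sub>1\<close>\<close>
  define B where "B = cmod (T_coeff f) + 1 / (8 * pi\<^sup>2) * K"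
  have g: "cmod (T_coeff f - G1 (mult_op v f) x) \<le> B" for x
  proof -
    have "cmod (l2_inner f (shifted_log x)) \<le> K"
      using l2_inner_norm_bound(1)[OF F(1) shifted_log_L2[of x]] D(2)[of x] unfolding K_def by linarith
    then have "1 / (8 * pi\<^sup>2) * cmod (l2_inner f (shifted_log x)) \<le> 1 / (8 * pi\<^sup>2) * K"
      by (rule mult_left_mono) simp
    then have "cmod (G1 (mult_op v f) x) \<le> 1 / (8 * pi\<^sup>2) * K"
      unfolding S1_space_G1[OF f] norm_mult norm_of_real by simp
    then show ?thesis unfolding B_def using norm_triangle_ineq4[of "T_coeff f" "G1 (mult_op v f) x"] by linarith
  qed
  moreover have "0 \<le> B" by (rule order_trans[OF norm_ge_zero g[of 0]])
  ultimately show ?thesis by auto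
qed

lemma S1_space_decay:
  assumes f: "f \<in> S1_space"
  shows "\<exists>B\<ge>0. AE x in lebesgue. cmod (f x) \<le> B * v x"
proof -
  obtain B where B0: "0 \<le> B" and g: "\<And>x. cmod (T_coeff f - G1 (mult_op v f) x) \<le> B"
    using S1_space_bounded[OF f] by auto
  have "AE x in lebesgue. cmod (f x) \<le> B * v x"
    using S1_space_representation[OF f]
  proof eventually_elim
    case (elim x)
    have "cmod (f x) = v x * cmod (T_coeff f - G1 (mult_op v f) x)"
      by (subst elim) (simp add: norm_mult abs_pot_sign pot_root_nonneg)
    also have "\<dots> \<le> v x * B" by (intro mult_left_mono g pot_root_nonneg)
    finally show ?case by (simp add: mult.commute)
  qed
  then show ?thesis using B0 by auto
qed

text \<open>
  For an orthonormal family \<open>e\<close> in the space, \<open>\<bar>e\<^sub>i\<bar>\<^sup>2 \<le> 2 v\<^sup>2 (\<bar>c\<^sub>i\<bar>\<^sup>2 + \<bar>G\<^sub>1v e\<^sub>i\<bar>\<^sup>2)\<close>. Both \<open>c\<^sub>i\<close> and, at each point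
  \<open>x\<close>, the value of \<open>G\<^sub>1v e\<^sub>i\<close> are inner products of \<open>e\<^sub>i\<close> with fixed vectors, namely \<open>T v\<close> and the kernel. Bessel's
  inequality therefore bounds the sum over \<open>i\<close> by a multiple of \<open>v\<^sup>2\<close>, and integration bounds the
  length of the family.
\<close>

lemma S1_space_findim: "l2_findim S1_space"
proof -
  obtain D where D: "0 \<le> D" "\<And>x. (LINT y|lebesgue. (cmod (shifted_log x y))\<^sup>2) \<le> D"
    using shifted_log_L2_bound by auto
  define N where "N = cmod (l2_inner vc vc)"
  define C where "C = (LINT x|lebesgue. (cmod (T_op V vc x))\<^sup>2) / N\<^sup>2"
  \<comment> \<open>\<open>C\<close> bounds the sum of the \<open>\<bar>c\<^sub>i\<bar>\<^sup>2\<close>; the other term bounds that of the \<open>\<bar>G\<^sub>1v e\<^sub>i\<bar>\<^sup>2\<close>\<close>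
  define K where "K = 2 * C + 2 * ((1 / (8 * pi\<^sup>2))\<^sup>2 * D)"
  have vi: "integrable lebesgue (\<lambda>x. K * (v x)\<^sup>2)"
    using weight_v_sq_integrable[of 0] by simp
  have "real n \<le> K * (LINT x|lebesgue. (v x)\<^sup>2)"
    if e: "l2_orthonormal n e" and eS: "\<forall>i<n. e i \<in> S1_space" for n e
  proof -
    have eL: "e i \<in> L2" if "i < n" for i using e that by (simp add: l2_orthonormal_def)
    have coeff: "(\<Sum>i<n. (cmod (T_coeff (e i)))\<^sup>2) \<le> C"
    proof -
      have "(cmod (T_coeff (e i)))\<^sup>2 = (cmod (l2_inner (T_op V vc) (e i)))\<^sup>2 / N\<^sup>2" if "i < n" for i
      proof -
        have "l2_inner (T_op V (e i)) vc = cnj (l2_inner (T_op V vc) (e i))"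
          unfolding l2_inner_cnj by (rule T_self_adjoint[OF eL[OF that] vc_L2])
        then show ?thesis by (simp add: T_coeff_def norm_divide power_divide N_def)
      qed
      then have "(\<Sum>i<n. (cmod (T_coeff (e i)))\<^sup>2) = (\<Sum>i<n. (cmod (l2_inner (T_op V vc) (e i)))\<^sup>2) / N\<^sup>2"
        by (simp add: sum_divide_distrib)
      also have "\<dots> \<le> C" unfolding C_def
        by (intro divide_right_mono l2_bessel[OF e T_L2[OF vc_L2]]) simp
      finally show ?thesis .
    qed
    have green: "(\<Sum>i<n. (cmod (G1 (mult_op v (e i)) x))\<^sup>2) \<le> (1 / (8 * pi\<^sup>2))\<^sup>2 * D" for x
    proof -
      have "(cmod (G1 (mult_op v (e i)) x))\<^sup>2
        = (1 / (8 * pi\<^sup>2))\<^sup>2 * (cmod (l2_inner (shifted_log x) (e i)))\<^sup>2" if "i < n" for i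
      proof -
        have "cmod (l2_inner (e i) (shifted_log x)) = cmod (l2_inner (shifted_log x) (e i))"
          using complex_mod_cnj[of "l2_inner (e i) (shifted_log x)"] unfolding l2_inner_cnj by simp
        then show ?thesis using S1_space_G1[of "e i" x] eS that
          by (simp only: norm_mult norm_of_real power_mult_distrib abs_minus_cancel power2_abs)
      qed
      then have "(\<Sum>i<n. (cmod (G1 (mult_op v (e i)) x))\<^sup>2)
        = (1 / (8 * pi\<^sup>2))\<^sup>2 * (\<Sum>i<n. (cmod (l2_inner (shifted_log x) (e i)))\<^sup>2)"
        by (simp add: sum_distrib_left)
      also have "\<dots> \<le> (1 / (8 * pi\<^sup>2))\<^sup>2 * D"
        by (intro mult_left_mono order_trans[OF l2_bessel[OF e shifted_log_L2] D(2)]) simp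
      finally show ?thesis .
    qed
    have "AE x in lebesgue. \<forall>i\<in>{..<n}. e i x
        = of_real (pot_sign V x) * (of_real (v x) * (T_coeff (e i) - G1 (mult_op v (e i)) x))"
      by (rule AE_finite_allI) (use eS S1_space_representation in auto)
    then have pointwise: "AE x in lebesgue. (\<Sum>i<n. (cmod (e i x))\<^sup>2) \<le> K * (v x)\<^sup>2"
    proof eventually_elim
      case (elim x)
      have sq: "(cmod (a - b))\<^sup>2 \<le> 2 * (cmod a)\<^sup>2 + 2 * (cmod b)\<^sup>2" for a b
        using norm_add_sq_le[of a "- b"] by simp
      have "(\<Sum>i<n. (cmod (e i x))\<^sup>2) = (\<Sum>i<n. (v x)\<^sup>2 * (cmod (T_coeff (e i) - G1 (mult_op v (e i)) x))\<^sup>2)"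
        using elim by (intro sum.cong refl) (simp add: norm_mult abs_pot_sign power_mult_distrib)
      also have "\<dots> \<le> (\<Sum>i<n. (v x)\<^sup>2 * (2 * (cmod (T_coeff (e i)))\<^sup>2 + 2 * (cmod (G1 (mult_op v (e i)) x))\<^sup>2))"
        by (intro sum_mono mult_left_mono sq) auto
      also have "\<dots> = (v x)\<^sup>2 * (2 * (\<Sum>i<n. (cmod (T_coeff (e i)))\<^sup>2) + 2 * (\<Sum>i<n. (cmod (G1 (mult_op v (e i)) x))\<^sup>2))"
        by (simp only: sum_distrib_left sum.distrib distrib_left)
      also have "\<dots> \<le> (v x)\<^sup>2 * K"
        unfolding K_def using coeff green[of x] by (intro mult_left_mono add_mono) auto
      finally show ?case by (simp add: mult.commute)
    qed
    have ei: "integrable lebesgue (\<lambda>x. (cmod (e i x))\<^sup>2)" if "i < n" for i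
      using L2_norm_sq_integrable[OF eL[OF that]] .
    have "(LINT x|lebesgue. (cmod (e i x))\<^sup>2) = 1" if "i < n" for i
    proof -
      have "complex_of_real (LINT x|lebesgue. (cmod (e i x))\<^sup>2) = 1"
        using e that unfolding l2_inner_self[symmetric] by (simp add: l2_orthonormal_def)
      then show ?thesis by (simp only: of_real_eq_1_iff)
    qed
    then have "real n = (\<Sum>i<n. (LINT x|lebesgue. (cmod (e i x))\<^sup>2))" by simp
    also have "\<dots> = (LINT x|lebesgue. (\<Sum>i<n. (cmod (e i x))\<^sup>2))"
      by (rule Bochner_Integration.integral_sum[symmetric]) (use ei in auto)
    also have "\<dots> \<le> (LINT x|lebesgue. K * (v x)\<^sup>2)"
      by (rule integral_mono_AE[OF _ vi pointwise]) (use ei in auto)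
    finally show ?thesis by simp
  qed
  then have "n \<le> nat \<lceil>K * (LINT x|lebesgue. (v x)\<^sup>2)\<rceil>"
    if "l2_orthonormal n e" "\<forall>i<n. e i \<in> S1_space" for n e
    using that by (intro of_nat_le_iff[THEN iffD1, OF order_trans[OF _ real_nat_ceiling_ge]])
  then have "\<forall>n e. l2_orthonormal n e \<longrightarrow> (\<forall>i<n. e i \<in> S1_space) \<longrightarrow> n \<le> nat \<lceil>K * (LINT x|lebesgue. (v x)\<^sup>2)\<rceil>"
    by simp
  then show ?thesis unfolding l2_findim_def by (rule exI)
qed

lemma subspace_of_S1_complemented:
  "l2_subspace M \<Longrightarrow> M \<subseteq> S1_space \<Longrightarrow> l2_findim M"
  "l2_subspace M \<Longrightarrow> M \<subseteq> S1_space \<Longrightarrow> l2_complemented M"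
  "l2_subspace M \<Longrightarrow> M \<subseteq> S1_space \<Longrightarrow> range_L2 (orth_proj M) = M"
  using l2_findim_mono[OF S1_space_findim] l2_findim_complemented range_orth_proj by simp_all

lemma range_S1: "range_L2 (S1_op V) = S1_space"
  unfolding S1_op_def kernel_QTQ by (rule subspace_of_S1_complemented(3)[OF S1_space_subspace]) simp

section \<open>The second projection\<close>

definition S2_space :: "(R4 \<Rightarrow> complex) set" where
  "S2_space = {f \<in> S1_space. T_coeff f = 0}"

lemma T_coeff_cong:
  assumes "f \<in> L2" "g \<in> L2" "AE x in lebesgue. f x = g x"
  shows "T_coeff f = T_coeff g"
proof -
  have "l2_inner (T_op V f) vc = l2_inner (T_op V g) vc"
    by (rule l2_inner_cong_AE[OF T_L2[OF assms(1)] T_L2[OF assms(2)] vc_L2 vc_L2 T_cong[OF assms]]) simp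
  then show ?thesis by (simp add: T_coeff_def)
qed

lemma S2_space_subspace: "l2_subspace S2_space"
proof -
  note S = l2_subspaceD[OF S1_space_subspace]
  have z: "T_coeff (\<lambda>x. 0) = 0"
  proof -
    have "T_op V (\<lambda>x. 0) = (\<lambda>x. 0)" using T_scale[OF L2_zero, of 0] by (intro ext) simp
    then show ?thesis by (simp add: T_coeff_def l2_inner_zero_left)
  qed
  have a: "T_coeff (\<lambda>x. f x + g x) = T_coeff f + T_coeff g" if "f \<in> L2" "g \<in> L2" for f g
    unfolding T_coeff_def T_add[OF that, abs_def] l2_inner_add_left[OF T_L2[OF that(1)] T_L2[OF that(2)] vc_L2]
    by (rule add_divide_distrib)
  have m: "T_coeff (\<lambda>x. c * f x) = c * T_coeff f" if "f \<in> L2" for f c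
    unfolding T_coeff_def T_scale[OF that, abs_def] l2_inner_scale_left by simp
  show ?thesis
    unfolding l2_subspace_def
  proof (intro conjI ballI allI impI)
    fix f g assume f: "f \<in> S2_space" and g: "g \<in> L2" and fg: "AE x in lebesgue. f x = g x"
    have "T_coeff f = T_coeff g" by (rule T_coeff_cong[OF _ g fg]) (use f S(1) in \<open>simp add: S2_space_def\<close>)
    then show "g \<in> S2_space" using f S(5)[OF _ g fg] by (simp add: S2_space_def)
  next
    show "S2_space \<subseteq> L2" using S(1) by (auto simp: S2_space_def)
    show "(\<lambda>x. 0) \<in> S2_space" using S(2) z by (simp add: S2_space_def)
  next
    fix f g assume "f \<in> S2_space" "g \<in> S2_space"
    then show "(\<lambda>x. f x + g x) \<in> S2_space"
      using S(3)[of f g] a[OF S(1) S(1), of f g] by (simp add: S2_space_def)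
  next
    fix f c assume "f \<in> S2_space"
    then show "(\<lambda>x. c * f x) \<in> S2_space"
      using S(4)[of f c] m[OF S(1), of f c] by (simp add: S2_space_def)
  qed
qed

text \<open>
  For \<open>f\<close> and \<open>h\<close> in \<open>S\<^sub>1L\<^sup>2\<close> with coefficients \<open>c\<close> and \<open>d\<close>, self-adjointness of \<open>T\<close> gives
  \<open>\<langle>TPT f, h\<rangle> = c \<langle>v, T h\<rangle> = c d\<^sup>* \<parallel>v\<parallel>\<^sup>2\<close>. This vanishes for all \<open>h\<close> exactly if \<open>c = 0\<close>, as \<open>h = f\<close> shows.
\<close>

lemma kernel_S1TPTS1:
  "kernel_on (S1_op V \<circ> T_op V \<circ> P_op V \<circ> T_op V \<circ> S1_op V) (range_L2 (S1_op V)) = S2_space"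
proof -
  have S1: "S1_op V = orth_proj S1_space" unfolding S1_op_def kernel_QTQ ..
  have compl: "l2_complemented S1_space"
    by (rule subspace_of_S1_complemented(2)[OF S1_space_subspace]) simp
  have "(AE x in lebesgue. S1_op V (T_op V (P_op V (T_op V (S1_op V f)))) x = 0) \<longleftrightarrow> T_coeff f = 0"
    if f: "f \<in> S1_space" for f
  proof -
    note F = S1_spaceD[OF f]
    define p where "p = S1_op V f"
    have pS: "p \<in> S1_space" unfolding p_def S1 by (rule orth_proj_props(1)[OF compl F(1)])
    have pf: "AE x in lebesgue. p x = f x"
      unfolding p_def S1 by (rule orth_proj_ident[OF S1_space_subspace compl f])
    note Pp = S1_spaceD[OF pS]
    have cp: "T_coeff p = T_coeff f" by (rule T_coeff_cong[OF Pp(1) F(1) pf])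
    define q where "q = P_op V (T_op V p)"
    have qL: "q \<in> L2" unfolding q_def by (intro P_op_L2 T_L2 Pp)
    have "AE x in lebesgue. q x = T_coeff f * vc x"
      unfolding q_def using P_op_of_multiple[OF T_L2[OF Pp(1)] Pp(3)] unfolding cp .
    from T_cong[OF qL L2_scale[OF vc_L2] this]
    have Tq: "AE x in lebesgue. T_op V q x = T_coeff f * T_op V vc x"
      unfolding T_scale[OF vc_L2] .
    have TqL: "T_op V q \<in> L2" by (rule T_L2[OF qL])
    have inner: "l2_inner (T_op V q) h = T_coeff f * cnj (T_coeff h) * l2_inner vc vc" if h: "h \<in> S1_space" for h
    proof -
      note Hh = S1_spaceD[OF h]
      have "l2_inner (T_op V q) h = l2_inner (\<lambda>x. T_coeff f * T_op V vc x) h"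
        by (rule l2_inner_cong_AE[OF TqL L2_scale[OF T_L2[OF vc_L2]] Hh(1) Hh(1) Tq]) simp
      also have "\<dots> = T_coeff f * l2_inner vc (T_op V h)"
        by (simp only: l2_inner_scale_left T_self_adjoint[OF vc_L2 Hh(1)])
      also have "l2_inner vc (T_op V h) = l2_inner vc (\<lambda>x. T_coeff h * vc x)"
        by (rule l2_inner_cong_AE[OF vc_L2 vc_L2 T_L2[OF Hh(1)] L2_scale[OF vc_L2] _ Hh(3)]) simp
      finally show ?thesis by (simp add: l2_inner_scale_right)
    qed
    have "(AE x in lebesgue. S1_op V (T_op V q) x = 0) \<longleftrightarrow> (\<forall>h\<in>S1_space. l2_inner (T_op V q) h = 0)"
      unfolding S1 by (rule orth_proj_eq_0_iff[OF S1_space_subspace compl TqL])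
    also have "\<dots> \<longleftrightarrow> T_coeff f = 0"
    proof
      assume "\<forall>h\<in>S1_space. l2_inner (T_op V q) h = 0"
      then have "T_coeff f * cnj (T_coeff f) * l2_inner vc vc = 0" using inner[OF f] f by simp
      then show "T_coeff f = 0" using inner_vc_nonzero by simp
    qed (simp add: inner)
    finally show ?thesis unfolding q_def p_def .
  qed
  then show ?thesis unfolding kernel_on_def range_S1 S2_space_def o_apply
    by (intro Collect_cong conj_cong refl)
qed

lemma S2_space_subset: "S2_space \<subseteq> S1_space"
  by (auto simp: S2_space_def)

lemma range_S2: "range_L2 (S2_op V) = S2_space"
  unfolding S2_op_def kernel_S1TPTS1
  by (rule subspace_of_S1_complemented(3)[OF S2_space_subspace S2_space_subset])

section \<open>Moments and the last two projections\<close>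

definition moment :: "(R4 \<Rightarrow> real) \<Rightarrow> (R4 \<Rightarrow> complex) \<Rightarrow> complex" where
  "moment p f = (LINT y|lebesgue. of_real (p y * v y) * f y)"

lemma moment_measurable:
  assumes p: "p \<in> borel_measurable borel" and f: "f \<in> L2"
  shows "(\<lambda>y. of_real (p y * v y) * f y) \<in> borel_measurable lebesgue"
proof -
  have "(\<lambda>y. p y * v y) \<in> borel_measurable lebesgue"
    by (intro borel_measurable_times borel_imp_lebesgue_measurable p v_measurable)
  then have "(\<lambda>y. complex_of_real (p y * v y)) \<in> borel_measurable lebesgue"
    by (rule measurable_compose[OF _ borel_measurable_of_real])
  then show ?thesis by (intro borel_measurable_times L2_measurable[OF f])
qed

text \<open>
  As \<open>f\<close> is bounded by a multiple of \<open>v\<close>, the integrand is bounded by a multiple of \<open>\<langle>x\<rangle>\<^sup>4 v\<^sup>2\<close>.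
\<close>

lemma moment_integrable:
  assumes p: "polynomial_growth 4 p" and f: "f \<in> S1_space"
  shows "integrable lebesgue (\<lambda>y. of_real (p y * v y) * f y)"
proof -
  obtain C where pm: "p \<in> borel_measurable borel" and C: "0 \<le> C" "\<And>x. \<bar>p x\<bar> \<le> C * japanese_bracket x ^ 4"
    using p unfolding polynomial_growth_def by auto
  obtain B where B: "0 \<le> B" "AE x in lebesgue. cmod (f x) \<le> B * v x"
    using S1_space_decay[OF f] by auto
  show ?thesis
  proof (rule Bochner_Integration.integrable_bound)
    show "integrable lebesgue (\<lambda>x. C * B * (japanese_bracket x ^ 4 * (v x)\<^sup>2))"
      by (intro integrable_mult_right weighted_v_sq_integrable)
    show "(\<lambda>y. of_real (p y * v y) * f y) \<in> borel_measurable lebesgue"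
      by (rule moment_measurable[OF pm S1_spaceD(1)[OF f]])
    show "AE x in lebesgue. norm (of_real (p x * v x) * f x) \<le> norm (C * B * (japanese_bracket x ^ 4 * (v x)\<^sup>2))"
      using B(2)
    proof eventually_elim
      case (elim x)
      have jb: "0 \<le> japanese_bracket x" using japanese_bracket_bounds(1)[of x] by linarith
      have "norm (of_real (p x * v x) * f x) = (\<bar>p x\<bar> * v x) * cmod (f x)"
        by (simp add: norm_mult abs_mult pot_root_nonneg)
      also have "\<dots> \<le> ((C * japanese_bracket x ^ 4) * v x) * (B * v x)"
        using C elim B(1) jb pot_root_nonneg[of V x] by (intro mult_mono) auto
      also have "\<dots> \<le> norm (C * B * (japanese_bracket x ^ 4 * (v x)\<^sup>2))"
        using C B(1) jb by (simp add: power2_eq_square mult_ac)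
      finally show ?case .
    qed
  qed
qed

lemma moment_add:
  assumes "polynomial_growth 4 p" "f \<in> S1_space" "g \<in> S1_space"
  shows "moment p (\<lambda>x. f x + g x) = moment p f + moment p g"
  unfolding moment_def distrib_left
  by (intro Bochner_Integration.integral_add moment_integrable assms)

lemma moment_scale: "moment p (\<lambda>x. a * f x) = a * moment p f"
  unfolding moment_def by (simp only: mult.left_commute[of _ a] integral_mult_right_zero)

lemma moment_scale_weight: "moment (\<lambda>x. a * p x) f = of_real a * moment p f"
  unfolding moment_def by (simp only: of_real_mult mult.assoc integral_mult_right_zero)

lemma moment_zero: "moment p (\<lambda>x. 0) = 0"
  by (simp add: moment_def)

lemma moment_sum_weight:
  assumes "\<And>i. i \<in> I \<Longrightarrow> polynomial_growth 4 (p i)" "f \<in> S1_space"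
  shows "moment (\<lambda>x. \<Sum>i\<in>I. p i x) f = (\<Sum>i\<in>I. moment (p i) f)"
proof -
  have "moment (\<lambda>x. \<Sum>i\<in>I. p i x) f = (LINT y|lebesgue. (\<Sum>i\<in>I. of_real (p i y * v y) * f y))"
    unfolding moment_def by (simp add: sum_distrib_right)
  also have "\<dots> = (\<Sum>i\<in>I. moment (p i) f)"
    unfolding moment_def by (rule Bochner_Integration.integral_sum) (intro moment_integrable assms)
  finally show ?thesis .
qed

lemma moment_cong:
  assumes "polynomial_growth 4 p" "f \<in> S1_space" "g \<in> S1_space" "AE x in lebesgue. f x = g x"
  shows "moment p f = moment p g"
  unfolding moment_def
  by (rule integral_cong_AE)
     (use assms(4) borel_measurable_integrable[OF moment_integrable[OF assms(1,2)]]
       borel_measurable_integrable[OF moment_integrable[OF assms(1,3)]] in auto)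

lemma moment_one:
  assumes "f \<in> S1_space" shows "moment (\<lambda>x. 1) f = 0"
proof -
  have "moment (\<lambda>x. 1) f = l2_inner f vc"
    unfolding moment_def l2_inner_def vc_def by (simp add: mult.commute)
  then show ?thesis using S1_spaceD(2)[OF assms] by simp
qed

text \<open>
  A separated kernel makes the iterated integral a finite sum of products of moments.
\<close>

lemma vGv_form_separated:
  assumes J: "finite J" and a: "\<And>j. j \<in> J \<Longrightarrow> polynomial_growth 4 (a j)"
    and b: "\<And>j. j \<in> J \<Longrightarrow> polynomial_growth 4 (b j)"
    and sep: "\<And>x y. norm (x - y) ^ k = (\<Sum>j\<in>J. a j x * b j y)"
    and f: "f \<in> S1_space" and g: "g \<in> S1_space"
  shows "vGv_form V c k f g = of_real c * (\<Sum>j\<in>J. moment (a j) f * cnj (moment (b j) g))"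
proof -
  have inner: "(LINT y|lebesgue. of_real (v x) * f x * of_real (c * norm (x - y) ^ k) * of_real (v y) * cnj (g y))
    = (\<Sum>j\<in>J. of_real c * cnj (moment (b j) g) * (of_real (a j x * v x) * f x))" for x
  proof -
    have "(LINT y|lebesgue. of_real (v x) * f x * of_real (c * norm (x - y) ^ k) * of_real (v y) * cnj (g y))
      = (LINT y|lebesgue. (\<Sum>j\<in>J. (of_real c * (of_real (a j x * v x) * f x)) * cnj (of_real (b j y * v y) * g y)))"
      unfolding sep by (intro Bochner_Integration.integral_cong refl)
        (simp add: sum_distrib_left sum_distrib_right mult_ac)
    also have "\<dots> = (\<Sum>j\<in>J. (LINT y|lebesgue. (of_real c * (of_real (a j x * v x) * f x)) * cnj (of_real (b j y * v y) * g y)))"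
      by (intro Bochner_Integration.integral_sum integrable_mult_right)
         (simp only: complex_integrable_cnj, intro moment_integrable b g)
    also have "\<dots> = (\<Sum>j\<in>J. of_real c * cnj (moment (b j) g) * (of_real (a j x * v x) * f x))"
      by (simp only: integral_mult_right_zero Bochner_Integration.integral_cnj moment_def[symmetric])
         (simp add: mult_ac)
    finally show ?thesis .
  qed
  have "vGv_form V c k f g
    = (LINT x|lebesgue. (\<Sum>j\<in>J. of_real c * cnj (moment (b j) g) * (of_real (a j x * v x) * f x)))"
    unfolding vGv_form_def inner ..
  also have "\<dots> = (\<Sum>j\<in>J. (LINT x|lebesgue. of_real c * cnj (moment (b j) g) * (of_real (a j x * v x) * f x)))"
    by (intro Bochner_Integration.integral_sum integrable_mult_right moment_integrable a f)
  also have "\<dots> = of_real c * (\<Sum>j\<in>J. moment (a j) f * cnj (moment (b j) g))"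
    by (simp only: integral_mult_right_zero moment_def[symmetric]) (simp add: sum_distrib_left mult_ac)
  finally show ?thesis .
qed

text \<open>
  Moments are linear and respect almost-everywhere equality, hence so does a form with separated kernel
  in its second argument (up to conjugation), and its operator exists.
\<close>

lemma kernel_vGv_form:
  assumes M: "l2_subspace M" "M \<subseteq> S1_space"
    and J: "finite J" and a: "\<And>j. j \<in> J \<Longrightarrow> polynomial_growth 4 (a j)"
    and b: "\<And>j. j \<in> J \<Longrightarrow> polynomial_growth 4 (b j)"
    and sep: "\<And>x y. norm (x - y) ^ k = (\<Sum>j\<in>J. a j x * b j y)"
  shows "kernel_on (form_operator M (vGv_form V c k)) M = {f \<in> M. \<forall>g\<in>M. vGv_form V c k f g = 0}"
proof (rule kernel_form_operator[OF M(1) subspace_of_S1_complemented(1)[OF M]])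
  note S = l2_subspaceD[OF M(1)]
  have S1: "f \<in> S1_space" if "f \<in> M" for f using that M(2) by auto
  have form: "vGv_form V c k f g = of_real c * (\<Sum>j\<in>J. moment (a j) f * cnj (moment (b j) g))"
    if "f \<in> M" "g \<in> M" for f g
    by (rule vGv_form_separated[OF J a b sep S1[OF that(1)] S1[OF that(2)]])
  fix f g h assume f: "f \<in> M" and g: "g \<in> M" and h: "h \<in> M"
  have "moment (b j) (\<lambda>x. f x + g x) = moment (b j) f + moment (b j) g" if "j \<in> J" for j
    by (rule moment_add[OF b[OF that] S1[OF f] S1[OF g]])
  then show "vGv_form V c k h (\<lambda>x. f x + g x) = vGv_form V c k h f + vGv_form V c k h g"
    unfolding form[OF h f] form[OF h g] form[OF h S(3)[OF f g]]
    by (simp add: distrib_left sum.distrib)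
  show "vGv_form V c k h (\<lambda>x. d * f x) = cnj d * vGv_form V c k h f" for d
    unfolding form[OF h f] form[OF h S(4)[OF f]] moment_scale
    by (simp add: sum_distrib_left mult_ac)
  assume fg: "AE x in lebesgue. f x = g x"
  have "moment (b j) f = moment (b j) g" if "j \<in> J" for j
    by (rule moment_cong[OF b[OF that] S1[OF f] S1[OF g] fg])
  then show "vGv_form V c k h f = vGv_form V c k h g"
    unfolding form[OF h f] form[OF h g] by simp
qed

abbreviation first_moment :: "R4 \<Rightarrow> (R4 \<Rightarrow> complex) \<Rightarrow> complex" where
  "first_moment b \<equiv> moment (\<lambda>x. x \<bullet> b)"

abbreviation second_moment :: "R4 \<Rightarrow> R4 \<Rightarrow> (R4 \<Rightarrow> complex) \<Rightarrow> complex" where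
  "second_moment b b' \<equiv> moment (\<lambda>x. (x \<bullet> b) * (x \<bullet> b'))"

lemma linear_growth: "b \<in> Basis \<Longrightarrow> polynomial_growth 1 (\<lambda>x. x \<bullet> b)"
  using polynomial_growth_basic(2)[of b 1] by simp

lemma first_weight_growth: "b \<in> Basis \<Longrightarrow> polynomial_growth 4 (\<lambda>x. x \<bullet> b)"
  by (rule polynomial_growth_mono[OF linear_growth]) auto

lemma second_weight_growth:
  "b \<in> Basis \<Longrightarrow> b' \<in> Basis \<Longrightarrow> polynomial_growth 4 (\<lambda>x. (x \<bullet> b) * (x \<bullet> b'))"
  by (rule polynomial_growth_mono[OF polynomial_growth_mult[OF linear_growth linear_growth]]) auto

lemma norm_sq_moment:
  assumes f: "f \<in> S1_space"
  shows "moment (\<lambda>x. (norm x)\<^sup>2) f = (\<Sum>b\<in>Basis. second_moment b b f)"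
proof -
  have eq: "(\<lambda>x::R4. (norm x)\<^sup>2) = (\<lambda>x. \<Sum>b\<in>Basis. (x \<bullet> b) * (x \<bullet> b))"
    unfolding power2_norm_eq_inner by (rule ext, rule euclidean_inner)
  show ?thesis
    unfolding eq by (intro moment_sum_weight f second_weight_growth)
qed

text \<open>
  The terms \<open>\<bar>x\<bar>\<^sup>2 \<cdot> 1\<close> and \<open>1 \<cdot> \<bar>y\<bar>\<^sup>2\<close> drop out because \<open>v f\<close> and \<open>v g\<close> have integral zero.
\<close>

lemma vGv_form_two:
  assumes f: "f \<in> S1_space" and g: "g \<in> S1_space"
  shows "vGv_form V c 2 f g = of_real (- 2 * c) * (\<Sum>b\<in>Basis. first_moment b f * cnj (first_moment b g))"
proof -
  have "vGv_form V c 2 f g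
      = of_real c * (\<Sum>s\<in>dist_sq_terms. moment (dist_sq_left s) f * cnj (moment (dist_sq_right s) g))"
    by (rule vGv_form_separated[OF finite_dist_sq_terms(1) dist_sq_factor_growth dist_sq_separated f g])
  also have "(\<Sum>s\<in>dist_sq_terms. moment (dist_sq_left s) f * cnj (moment (dist_sq_right s) g))
      = (\<Sum>b\<in>Basis. - 2 * (first_moment b f * cnj (first_moment b g)))"
    unfolding sum_Basis_plus_bool dist_sq_left.simps[abs_def] dist_sq_right.simps[abs_def] moment_scale_weight
    by (simp add: moment_one f g mult.assoc)
  also have "\<dots> = - 2 * (\<Sum>b\<in>Basis. first_moment b f * cnj (first_moment b g))"
    by (simp only: sum_distrib_left)
  finally show ?thesis by simp
qed

definition S3_space :: "(R4 \<Rightarrow> complex) set" where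
  "S3_space = {f \<in> S2_space. \<forall>b\<in>Basis. first_moment b f = 0}"

definition S4_space :: "(R4 \<Rightarrow> complex) set" where
  "S4_space = {f \<in> S3_space. \<forall>b\<in>Basis. \<forall>b'\<in>Basis. second_moment b b' f = 0}"

text \<open>
  Expanding \<open>\<bar>x - y\<bar>\<^sup>4\<close>, a term survives only if both of its factors have degree two, since the moments of
  degree zero and one vanish; these terms are \<open>4 (x \<bullet> y)\<^sup>2 + 2 \<bar>x\<bar>\<^sup>2 \<bar>y\<bar>\<^sup>2\<close>.
\<close>

lemma vGv_form_four:
  assumes f: "f \<in> S3_space" and g: "g \<in> S3_space"
  shows "vGv_form V c 4 f g = of_real c *
    (4 * (\<Sum>b\<in>Basis. \<Sum>b'\<in>Basis. second_moment b b' f * cnj (second_moment b b' g))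
      + 2 * (moment (\<lambda>x. (norm x)\<^sup>2) f * cnj (moment (\<lambda>x. (norm x)\<^sup>2) g)))"
proof -
  have S1: "f \<in> S1_space" "g \<in> S1_space" using f g by (auto simp: S3_space_def S2_space_def)
  have first: "first_moment b f = 0" "first_moment b g = 0" if "b \<in> Basis" for b
    using f g that by (auto simp: S3_space_def)
  let ?l = "\<lambda>s. \<lambda>x. dist_sq_left (fst s) x * dist_sq_left (snd s) x"
  let ?r = "\<lambda>s. \<lambda>x. dist_sq_right (fst s) x * dist_sq_right (snd s) x"
  have "vGv_form V c 4 f g
      = of_real c * (\<Sum>s\<in>dist_sq_terms \<times> dist_sq_terms. moment (?l s) f * cnj (moment (?r s) g))"
    by (rule vGv_form_separated[OF finite_dist_sq_terms(2) dist_fourth_factor_growth dist_fourth_separated S1])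
  also have "(\<Sum>s\<in>dist_sq_terms \<times> dist_sq_terms. moment (?l s) f * cnj (moment (?r s) g))
      = (\<Sum>s\<in>dist_sq_terms. \<Sum>t\<in>dist_sq_terms. moment (?l (s, t)) f * cnj (moment (?r (s, t)) g))"
    by (simp add: sum.cartesian_product case_prod_beta)
  also have "\<dots> = (\<Sum>b\<in>Basis. \<Sum>b'\<in>Basis. 4 * (second_moment b b' f * cnj (second_moment b b' g)))
      + 2 * (moment (\<lambda>x. (norm x)\<^sup>2) f * cnj (moment (\<lambda>x. (norm x)\<^sup>2) g))"
  proof -
    have ll: "moment (?l (Inl b, Inl b')) f = 4 * second_moment b b' f" for b b'
      using moment_scale_weight[of 4 "\<lambda>x. (x \<bullet> b) * (x \<bullet> b')" f] by (simp add: mult_ac)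
    have rr: "moment (?r (Inl b, Inl b')) g = second_moment b b' g" for b b' by simp
    have l1: "moment (\<lambda>x. - 2 * (x \<bullet> b)) f = 0" if "b \<in> Basis" for b
      unfolding moment_scale_weight first[OF that] by simp
    show ?thesis
      unfolding sum_Basis_plus_bool ll rr
      using first moment_one[OF S1(1)] moment_one[OF S1(2)] l1
      by (simp add: mult.assoc)
  qed
  finally show ?thesis by (simp add: sum_distrib_left)
qed

lemma zero_moments_subspace:
  assumes M: "l2_subspace M" "M \<subseteq> S1_space" and P: "\<And>p. p \<in> P \<Longrightarrow> polynomial_growth 4 p"
  shows "l2_subspace {f \<in> M. \<forall>p\<in>P. moment p f = 0}"
proof -
  note S = l2_subspaceD[OF M(1)]
  show ?thesis
    unfolding l2_subspace_def
  proof (intro conjI ballI allI impI)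
    show "{f \<in> M. \<forall>p\<in>P. moment p f = 0} \<subseteq> L2" using S(1) by auto
    show "(\<lambda>x. 0) \<in> {f \<in> M. \<forall>p\<in>P. moment p f = 0}" using S(2) by (simp add: moment_zero)
  next
    fix f g assume "f \<in> {f \<in> M. \<forall>p\<in>P. moment p f = 0}" "g \<in> {f \<in> M. \<forall>p\<in>P. moment p f = 0}"
    then show "(\<lambda>x. f x + g x) \<in> {f \<in> M. \<forall>p\<in>P. moment p f = 0}"
      using S(3)[of f g] moment_add[OF P, of _ f g] M(2) by (auto simp: subset_iff)
  next
    fix f a assume "f \<in> {f \<in> M. \<forall>p\<in>P. moment p f = 0}"
    then show "(\<lambda>x. a * f x) \<in> {f \<in> M. \<forall>p\<in>P. moment p f = 0}"
      using S(4)[of f a] by (simp add: moment_scale)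
  next
    fix f g assume f: "f \<in> {f \<in> M. \<forall>p\<in>P. moment p f = 0}" and g: "g \<in> L2"
      and fg: "AE x in lebesgue. f x = g x"
    have gM: "g \<in> M" using S(5)[OF _ g fg] f by simp
    have "moment p g = 0" if "p \<in> P" for p
      using moment_cong[OF P[OF that] _ _ fg] f gM M(2) that by auto
    then show "g \<in> {f \<in> M. \<forall>p\<in>P. moment p f = 0}" using gM by simp
  qed
qed

lemma S3_space_subset: "S3_space \<subseteq> S1_space"
  using S2_space_subset by (auto simp: S3_space_def)

lemma S3_space_subspace: "l2_subspace S3_space"
proof -
  have "S3_space = {f \<in> S2_space. \<forall>p\<in>(\<lambda>b x. x \<bullet> b) ` Basis. moment p f = 0}"
    by (auto simp: S3_space_def)
  then show ?thesis
    by (rule ssubst) (rule zero_moments_subspace[OF S2_space_subspace S2_space_subset],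
      auto intro: first_weight_growth)
qed

lemma S4_space_subset: "S4_space \<subseteq> S1_space"
  using S3_space_subset by (auto simp: S4_space_def)

lemma S4_space_subspace: "l2_subspace S4_space"
proof -
  have "S4_space = {f \<in> S3_space. \<forall>p\<in>(\<lambda>s x. (x \<bullet> fst s) * (x \<bullet> snd s)) ` (Basis \<times> Basis). moment p f = 0}"
    by (auto simp: S4_space_def)
  then show ?thesis
    by (rule ssubst) (rule zero_moments_subspace[OF S3_space_subspace S3_space_subset],
      auto intro: second_weight_growth)
qed

text \<open>
  At \<open>g = f\<close> the form is \<open>-2 c\<close> times the sum of the squared absolute values of the first moments.
\<close>

lemma kernel_second_form:
  assumes c: "c \<noteq> 0"
  shows "kernel_on (form_operator S2_space (vGv_form V c 2)) S2_space = S3_space"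
proof -
  have S1: "f \<in> S1_space" if "f \<in> S2_space" for f using that S2_space_subset by auto
  note form = vGv_form_two[OF S1 S1]
  have "kernel_on (form_operator S2_space (vGv_form V c 2)) S2_space
      = {f \<in> S2_space. \<forall>g\<in>S2_space. vGv_form V c 2 f g = 0}"
    by (rule kernel_vGv_form[OF S2_space_subspace S2_space_subset
        finite_dist_sq_terms(1) dist_sq_factor_growth dist_sq_separated])
  also have "\<dots> = S3_space"
  proof -
    have "(\<forall>g\<in>S2_space. vGv_form V c 2 f g = 0) \<longleftrightarrow> (\<forall>b\<in>Basis. first_moment b f = 0)"
      if f: "f \<in> S2_space" for f
    proof
      assume "\<forall>g\<in>S2_space. vGv_form V c 2 f g = 0"
      then have "(\<Sum>b\<in>Basis. first_moment b f * cnj (first_moment b f)) = 0"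
        using form[OF f f, of c] f c by simp
      then have "complex_of_real (\<Sum>b\<in>Basis. (cmod (first_moment b f))\<^sup>2) = 0"
        by (simp add: complex_norm_square del: of_real_power)
      then have "(\<Sum>b\<in>Basis. (cmod (first_moment b f))\<^sup>2) = 0" by (simp only: of_real_eq_0_iff)
      then show "\<forall>b\<in>Basis. first_moment b f = 0"
        by (subst (asm) sum_nonneg_eq_0_iff) auto
    next
      assume "\<forall>b\<in>Basis. first_moment b f = 0"
      then show "\<forall>g\<in>S2_space. vGv_form V c 2 f g = 0" using form[OF f] by simp
    qed
    then show ?thesis unfolding S3_space_def by (intro Collect_cong conj_cong refl)
  qed
  finally show ?thesis .
qed

text \<open>
  At \<open>g = f\<close> the form is \<open>c\<close> times a sum of squares in which every second moment occurs.
\<close>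

lemma kernel_fourth_form:
  assumes c: "c \<noteq> 0"
  shows "kernel_on (form_operator S3_space (vGv_form V c 4)) S3_space = S4_space"
proof -
  have S1: "f \<in> S1_space" if "f \<in> S3_space" for f using that S3_space_subset by auto
  note form = vGv_form_four
  have "kernel_on (form_operator S3_space (vGv_form V c 4)) S3_space
      = {f \<in> S3_space. \<forall>g\<in>S3_space. vGv_form V c 4 f g = 0}"
    by (rule kernel_vGv_form[OF S3_space_subspace S3_space_subset
        finite_dist_sq_terms(2) dist_fourth_factor_growth dist_fourth_separated])
  also have "\<dots> = S4_space"
  proof -
    have "(\<forall>g\<in>S3_space. vGv_form V c 4 f g = 0) \<longleftrightarrow> (\<forall>b\<in>Basis. \<forall>b'\<in>Basis. second_moment b b' f = 0)"
      if f: "f \<in> S3_space" for f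
    proof
      let ?m = "\<lambda>b b'. (cmod (second_moment b b' f))\<^sup>2" and ?r = "moment (\<lambda>x. (norm x)\<^sup>2) f"
      assume "\<forall>g\<in>S3_space. vGv_form V c 4 f g = 0"
      then have "4 * (\<Sum>b\<in>Basis. \<Sum>b'\<in>Basis. second_moment b b' f * cnj (second_moment b b' f))
          + 2 * (?r * cnj ?r) = 0"
        using form[OF f f, of c] f c by simp
      then have "complex_of_real (4 * (\<Sum>b\<in>Basis. \<Sum>b'\<in>Basis. ?m b b') + 2 * (cmod ?r)\<^sup>2) = 0"
        by (simp add: complex_norm_square del: of_real_power)
      then have "4 * (\<Sum>b\<in>Basis. \<Sum>b'\<in>Basis. ?m b b') + 2 * (cmod ?r)\<^sup>2 = 0"
        by (simp only: of_real_eq_0_iff)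
      moreover have "0 \<le> (\<Sum>b\<in>Basis. \<Sum>b'\<in>Basis. ?m b b')" by (intro sum_nonneg) auto
      ultimately have "(\<Sum>b\<in>Basis. \<Sum>b'\<in>Basis. ?m b b') = 0"
        using zero_le_power2[of "cmod ?r"] by linarith
      then show "\<forall>b\<in>Basis. \<forall>b'\<in>Basis. second_moment b b' f = 0"
        by (simp add: sum_nonneg_eq_0_iff sum_nonneg)
    next
      assume "\<forall>b\<in>Basis. \<forall>b'\<in>Basis. second_moment b b' f = 0"
      then show "\<forall>g\<in>S3_space. vGv_form V c 4 f g = 0"
        using form[OF f] norm_sq_moment[OF S1[OF f]] by simp
    qed
    then show ?thesis unfolding S4_space_def by (intro Collect_cong conj_cong refl)
  qed
  finally show ?thesis .
qed

lemma range_S3: "c2 \<noteq> 0 \<Longrightarrow> range_L2 (S3_op V c2) = S3_space"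
  unfolding S3_op_def range_S2 kernel_second_form
  by (rule subspace_of_S1_complemented(3)[OF S3_space_subspace S3_space_subset])

lemma range_S4: "c2 \<noteq> 0 \<Longrightarrow> c4 \<noteq> 0 \<Longrightarrow> range_L2 (S4_op V c2 c4) = S4_space"
  unfolding S4_op_def range_S3 kernel_fourth_form
  by (rule subspace_of_S1_complemented(3)[OF S4_space_subspace S4_space_subset])

section \<open>Asymptotics of the resonance function\<close>

text \<open>
  The function \<open>\<psi>\<close> of the theorem.
\<close>

definition resonance :: "(R4 \<Rightarrow> complex) \<Rightarrow> R4 \<Rightarrow> complex" where
  "resonance f x = T_coeff f - G1 (mult_op v f) x"

text \<open>
  The integral of the bound in the remainder of the expansion of the logarithm, uniformly in \<open>x\<close>.
\<close>

lemma weighted_moment_bound: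
  assumes f: "f \<in> S1_space"
  shows "\<exists>D. \<forall>x. integrable lebesgue (\<lambda>y. japanese_bracket y ^ 3 * (japanese_bracket y + 1 / norm (x - y)) * (v y * cmod (f y)))
    \<and> (LINT y|lebesgue. japanese_bracket y ^ 3 * (japanese_bracket y + 1 / norm (x - y)) * (v y * cmod (f y))) \<le> D"
proof -
  obtain B where B: "0 \<le> B" "AE x in lebesgue. cmod (f x) \<le> B * v x"
    using S1_space_decay[OF f] by auto
  obtain C where C: "0 < C" "AE x in lebesgue. v x \<le> C \<and> japanese_bracket x ^ 4 * v x \<le> C"
    using v_bounded by auto
  let ?w = "\<lambda>y. japanese_bracket y ^ 3 * (v y)\<^sup>2"
  have jb: "0 \<le> japanese_bracket y" for y using japanese_bracket_bounds(1)[of y] by linarith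
  have "\<exists>D. \<forall>x. integrable lebesgue (\<lambda>y. ?w y / (norm (x - y))\<^sup>2)
    \<and> (LINT y|lebesgue. ?w y / (norm (x - y))\<^sup>2) \<le> D"
  proof (rule inverse_square_potential_bounded)
    show "integrable lebesgue ?w" by (rule weight_v_sq_integrable) simp
    show "0 \<le> ?w y" for y using jb by simp
    show "AE y in lebesgue. ?w y \<le> C * C"
      using C(2)
    proof eventually_elim
      case (elim y)
      have "japanese_bracket y ^ 3 * v y \<le> japanese_bracket y ^ 4 * v y"
        by (intro mult_right_mono power_increasing japanese_bracket_bounds pot_root_nonneg) simp
      then have "(japanese_bracket y ^ 3 * v y) * v y \<le> C * C"
        using elim C(1) pot_root_nonneg[of V y] by (intro mult_mono) auto
      then show ?case by (simp add: power2_eq_square mult.assoc)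
    qed
  qed
  then obtain D where Di: "\<And>x. integrable lebesgue (\<lambda>y. ?w y / (norm (x - y))\<^sup>2)"
    and Db: "\<And>x. (LINT y|lebesgue. ?w y / (norm (x - y))\<^sup>2) \<le> D" by auto
  let ?I = "LINT y|lebesgue. japanese_bracket y ^ 4 * (v y)\<^sup>2"
  let ?F = "\<lambda>x y. japanese_bracket y ^ 3 * (japanese_bracket y + 1 / norm (x - y)) * (v y * cmod (f y))"
  let ?g = "\<lambda>x y. B * (2 * (japanese_bracket y ^ 4 * (v y)\<^sup>2) + ?w y / (norm (x - y))\<^sup>2)"
  have gi: "integrable lebesgue (?g x)" for x
    by (intro integrable_mult_right Bochner_Integration.integrable_add weighted_v_sq_integrable Di)
  have F0: "0 \<le> ?F x y" for x y
    using jb[of y] by (intro mult_nonneg_nonneg add_nonneg_nonneg) (auto simp: pot_root_nonneg)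
  have le: "AE y in lebesgue. ?F x y \<le> ?g x y" for x
    using B(2)
  proof eventually_elim
    case (elim y)
    let ?q = "1 / norm (x - y)" and ?b = "japanese_bracket y"
    have b: "1 \<le> ?b" by (rule japanese_bracket_bounds)
    \<comment> \<open>the singularity \<open>1/\<bar>x - y\<bar>\<close> is absorbed into the inverse square, for which a uniform bound is known\<close>
    have q: "?q \<le> 1 + ?q\<^sup>2"
      using zero_le_power2[of "?q - 1 / 2"] unfolding power2_eq_square by argo
    then have "?b ^ 3 * (?b + ?q) \<le> ?b ^ 3 * (2 * ?b + ?q\<^sup>2)"
      using b jb[of y] by (intro mult_left_mono) auto
    also have "\<dots> = 2 * ?b ^ 4 + ?b ^ 3 * ?q\<^sup>2"
      by (simp add: distrib_left power3_eq_cube power4_eq_xxxx)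
    finally have "?F x y \<le> (2 * ?b ^ 4 + ?b ^ 3 * ?q\<^sup>2) * (v y * (B * v y))"
      using elim jb[of y] B(1) pot_root_nonneg[of V y]
      by (intro mult_mono) (auto intro!: mult_left_mono add_nonneg_nonneg mult_nonneg_nonneg)
    also have "\<dots> = ?g x y"
      by (simp add: power_divide power2_eq_square algebra_simps)
    finally show ?case .
  qed
  have meas: "?F x \<in> borel_measurable lebesgue" for x
  proof (intro borel_measurable_times)
    show "(\<lambda>y. japanese_bracket y ^ 3) \<in> borel_measurable lebesgue"
      by (intro borel_imp_lebesgue_measurable borel_measurable_power japanese_bracket_measurable)
    show "(\<lambda>y. japanese_bracket y + 1 / norm (x - y)) \<in> borel_measurable lebesgue"
      by (intro borel_imp_lebesgue_measurable borel_measurable_add japanese_bracket_measurable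
        borel_measurable_divide borel_measurable_const)
        (intro borel_measurable_continuous_onI continuous_intros)
    show "v \<in> borel_measurable lebesgue" by (rule v_measurable)
    show "(\<lambda>y. cmod (f y)) \<in> borel_measurable lebesgue"
      by (rule measurable_compose[OF L2_measurable[OF S1_spaceD(1)[OF f]] borel_measurable_norm])
  qed
  have int: "integrable lebesgue (?F x)" for x
  proof (rule Bochner_Integration.integrable_bound[OF gi[of x] meas])
    show "AE y in lebesgue. norm (?F x y) \<le> norm (?g x y)"
      using le[of x]
    proof eventually_elim
      case (elim y)
      then show ?case
        unfolding real_norm_def abs_of_nonneg[OF F0] by (rule order_trans[OF _ abs_ge_self])
    qed
  qed
  have "(LINT y|lebesgue. ?F x y) \<le> B * (2 * ?I + D)" for x
  proof -
    have "(LINT y|lebesgue. ?F x y) \<le> (LINT y|lebesgue. ?g x y)"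
      by (rule integral_mono_AE[OF int gi le])
    also have "\<dots> = B * (2 * ?I + (LINT y|lebesgue. ?w y / (norm (x - y))\<^sup>2))"
      unfolding integral_mult_right_zero
      by (subst Bochner_Integration.integral_add[OF integrable_mult_right[OF weighted_v_sq_integrable] Di])
         (simp only: integral_mult_right_zero)
    also have "\<dots> \<le> B * (2 * ?I + D)" using Db[of x] B(1) by (intro mult_left_mono) auto
    finally show ?thesis .
  qed
  then show ?thesis using int by blast
qed

text \<open>
  Integrated against \<open>v f\<close>, the term \<open>log \<bar>x\<bar>\<close> disappears because \<open>v f\<close> has integral zero.
\<close>

lemma log_expansion_moments:
  assumes f: "f \<in> S1_space"
  shows "integrable lebesgue (\<lambda>y. of_real (log_expansion x y * v y) * f y)"
    and "(LINT y|lebesgue. of_real (log_expansion x y * v y) * f y)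
      = - dipole (\<lambda>b. first_moment b f) x + quadrupole (\<lambda>b b'. second_moment b b' f) x"
proof -
  have g0: "polynomial_growth 4 (\<lambda>y::R4. 1)" by (rule polynomial_growth_mono[OF polynomial_growth_basic(1)]) simp
  have g2: "polynomial_growth 4 (\<lambda>y. (norm y)\<^sup>2)"
    by (rule polynomial_growth_mono[OF polynomial_growth_basic(3)]) simp
  let ?m = "\<lambda>p y. of_real (p y * v y) * f y"
  let ?lin = "\<lambda>y. \<Sum>b\<in>Basis. complex_of_real ((x \<bullet> b) / (norm x)\<^sup>2) * ?m (\<lambda>y. y \<bullet> b) y"
  let ?quad = "\<lambda>y. \<Sum>b\<in>Basis. \<Sum>b'\<in>Basis. complex_of_real ((x \<bullet> b) * (x \<bullet> b') / norm x ^ 4) * ?m (\<lambda>y. (y \<bullet> b) * (y \<bullet> b')) y"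
  have eq: "of_real (log_expansion x y * v y) * f y
    = of_real (ln (norm x)) * ?m (\<lambda>y. 1) y - ?lin y + of_real (1 / (2 * (norm x)\<^sup>2)) * ?m (\<lambda>y. (norm y)\<^sup>2) y - ?quad y" for y
  proof -
    have xy: "x \<bullet> y = (\<Sum>b\<in>Basis. (x \<bullet> b) * (y \<bullet> b))" by (rule euclidean_inner)
    have lin: "of_real ((x \<bullet> y) / (norm x)\<^sup>2 * v y) * f y = ?lin y"
      unfolding xy sum_divide_distrib sum_distrib_right of_real_sum
      by (intro sum.cong refl) (simp add: mult_ac)
    have quad: "of_real ((x \<bullet> y)\<^sup>2 / norm x ^ 4 * v y) * f y = ?quad y"
    proof -
      have sq: "(x \<bullet> y)\<^sup>2 = (\<Sum>b\<in>Basis. \<Sum>b'\<in>Basis. ((x \<bullet> b) * (y \<bullet> b)) * ((x \<bullet> b') * (y \<bullet> b')))"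
        unfolding xy power2_eq_square by (rule sum_product)
      show ?thesis
        unfolding sq sum_divide_distrib sum_distrib_right of_real_sum
        by (intro sum.cong refl) (simp add: mult_ac)
    qed
    show ?thesis unfolding lin[symmetric] quad[symmetric] log_expansion_def
      by (simp add: algebra_simps)
  qed
  have i0: "integrable lebesgue (\<lambda>y. of_real (ln (norm x)) * ?m (\<lambda>y. 1) y)"
    by (intro integrable_mult_right moment_integrable g0 f)
  have i1: "integrable lebesgue ?lin"
    by (intro Bochner_Integration.integrable_sum integrable_mult_right moment_integrable first_weight_growth f)
  have i2: "integrable lebesgue (\<lambda>y. of_real (1 / (2 * (norm x)\<^sup>2)) * ?m (\<lambda>y. (norm y)\<^sup>2) y)"
    by (intro integrable_mult_right moment_integrable g2 f)
  have i3: "integrable lebesgue ?quad"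
    by (intro Bochner_Integration.integrable_sum integrable_mult_right moment_integrable second_weight_growth f)
  note i01 = Bochner_Integration.integrable_diff[OF i0 i1]
  note i012 = Bochner_Integration.integrable_add[OF i01 i2]
  show "integrable lebesgue (\<lambda>y. of_real (log_expansion x y * v y) * f y)"
    unfolding eq by (rule Bochner_Integration.integrable_diff[OF i012 i3])
  have e1: "(LINT y|lebesgue. ?lin y) = dipole (\<lambda>b. first_moment b f) x"
    unfolding dipole_def
    by (subst Bochner_Integration.integral_sum)
       (auto simp only: integral_mult_right_zero moment_def intro!: integrable_mult_right moment_integrable first_weight_growth f)
  have e3: "(LINT y|lebesgue. ?quad y)
      = (\<Sum>b\<in>Basis. \<Sum>b'\<in>Basis. of_real ((x \<bullet> b) * (x \<bullet> b') / norm x ^ 4) * second_moment b b' f)"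
  proof -
    have "(LINT y|lebesgue. ?quad y) = (\<Sum>b\<in>Basis. (LINT y|lebesgue. (\<Sum>b'\<in>Basis. complex_of_real ((x \<bullet> b) * (x \<bullet> b') / norm x ^ 4) * ?m (\<lambda>y. (y \<bullet> b) * (y \<bullet> b')) y)))"
      by (intro Bochner_Integration.integral_sum Bochner_Integration.integrable_sum integrable_mult_right moment_integrable second_weight_growth f)
    also have "\<dots> = (\<Sum>b\<in>Basis. \<Sum>b'\<in>Basis. (LINT y|lebesgue. complex_of_real ((x \<bullet> b) * (x \<bullet> b') / norm x ^ 4) * ?m (\<lambda>y. (y \<bullet> b) * (y \<bullet> b')) y))"
      by (intro sum.cong refl Bochner_Integration.integral_sum integrable_mult_right moment_integrable second_weight_growth f)
    finally show ?thesis by (simp only: integral_mult_right_zero moment_def)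
  qed
  show "(LINT y|lebesgue. of_real (log_expansion x y * v y) * f y)
      = - dipole (\<lambda>b. first_moment b f) x + quadrupole (\<lambda>b b'. second_moment b b' f) x"
    unfolding eq Bochner_Integration.integral_diff[OF i012 i3] Bochner_Integration.integral_add[OF i01 i2]
      Bochner_Integration.integral_diff[OF i0 i1] e1 e3 integral_mult_right_zero moment_def[symmetric]
      moment_one[OF f] norm_sq_moment[OF f] quadrupole_def
    by simp
qed

lemma resonance_expansion:
  assumes f: "f \<in> S1_space"
  defines "\<kappa> \<equiv> complex_of_real (1 / (8 * pi\<^sup>2))"
  shows "\<exists>C\<ge>0. \<forall>x. 1 \<le> norm x \<longrightarrow> cmod (resonance f x - (T_coeff f
      + \<kappa> * (- dipole (\<lambda>b. first_moment b f) x + quadrupole (\<lambda>b b'. second_moment b b' f) x))) \<le> C / norm x ^ 3"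
proof -
  let ?E = "\<lambda>x. resonance f x - (T_coeff f
      + \<kappa> * (- dipole (\<lambda>b. first_moment b f) x + quadrupole (\<lambda>b b'. second_moment b b' f) x))"
  obtain D where Di: "\<And>x. integrable lebesgue (\<lambda>y. japanese_bracket y ^ 3 * (japanese_bracket y + 1 / norm (x - y)) * (v y * cmod (f y)))"
    and Db: "\<And>x. (LINT y|lebesgue. japanese_bracket y ^ 3 * (japanese_bracket y + 1 / norm (x - y)) * (v y * cmod (f y))) \<le> D"
    using weighted_moment_bound[OF f] by auto
  have jb: "0 \<le> japanese_bracket y" for y using japanese_bracket_bounds(1)[of y] by linarith
  have "cmod (?E x)
      \<le> (1 / (8 * pi\<^sup>2) * (300 * max D 0)) / norm x ^ 3" if x: "1 \<le> norm x" for x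
  proof -
    let ?F = "\<lambda>y. japanese_bracket y ^ 3 * (japanese_bracket y + 1 / norm (x - y)) * (v y * cmod (f y))"
    note i1 = log_potential_integrable(1)[OF S1_spaceD(1)[OF f], of x]
    note i2 = log_expansion_moments(1)[OF f, of x]
    let ?d = "\<lambda>y. ln (norm (x - y)) *\<^sub>R mult_op v f y - of_real (log_expansion x y * v y) * f y"
    have "?E x
      = \<kappa> * (LINT y|lebesgue. ?d y)"
      unfolding resonance_def G1_def log_expansion_moments(2)[OF f, symmetric] Bochner_Integration.integral_diff[OF i1 i2] \<kappa>_def
      by (simp add: scaleR_conv_of_real algebra_simps)
    then have "cmod (?E x)
      = 1 / (8 * pi\<^sup>2) * cmod (LINT y|lebesgue. ?d y)"
      by (simp only: norm_mult \<kappa>_def norm_of_real) simp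
    also have "\<dots> \<le> 1 / (8 * pi\<^sup>2) * ((300 * max D 0) / norm x ^ 3)"
    proof (rule mult_left_mono)
      have "cmod (LINT y|lebesgue. ?d y) \<le> (LINT y|lebesgue. cmod (?d y))" by (rule integral_norm_bound)
      also have "\<dots> \<le> (LINT y|lebesgue. 300 / norm x ^ 3 * ?F y)"
      proof (rule integral_mono[OF integrable_norm[OF Bochner_Integration.integrable_diff[OF i1 i2]] integrable_mult_right[OF Di]])
        fix y
        have "?d y = of_real (ln (norm (x - y)) - log_expansion x y) * (of_real (v y) * f y)"
          by (simp add: mult_op_def scaleR_conv_of_real algebra_simps)
        then have "cmod (?d y) = \<bar>ln (norm (x - y)) - log_expansion x y\<bar> * (v y * cmod (f y))"
          by (simp only: norm_mult norm_of_real abs_of_nonneg[OF pot_root_nonneg])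
        also have "\<dots> \<le> (300 / norm x ^ 3 * (japanese_bracket y ^ 3 * (japanese_bracket y + 1 / norm (x - y)))) * (v y * cmod (f y))"
          by (intro mult_right_mono log_expansion_error x mult_nonneg_nonneg pot_root_nonneg norm_ge_zero)
        finally show "cmod (?d y) \<le> 300 / norm x ^ 3 * ?F y" by (simp only: mult.assoc)
      qed
      also have "\<dots> = 300 / norm x ^ 3 * (LINT y|lebesgue. ?F y)" by (simp only: integral_mult_right_zero)
      also have "\<dots> \<le> 300 / norm x ^ 3 * max D 0"
        using Db[of x] by (intro mult_left_mono) auto
      finally show "cmod (LINT y|lebesgue. ?d y) \<le> (300 * max D 0) / norm x ^ 3" by simp
    qed simp
    finally show ?thesis by simp
  qed
  then show ?thesis by (intro exI[of _ "1 / (8 * pi\<^sup>2) * (300 * max D 0)"]) auto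
qed

lemma resonance_measurable: "f \<in> S1_space \<Longrightarrow> resonance f \<in> borel_measurable lebesgue"
  unfolding resonance_def[abs_def]
  by (intro borel_measurable_diff borel_measurable_const G1_measurable mult_op_measurable L2_measurable S1_spaceD(1))

text \<open>
  Only the remainder \<open>O(\<bar>x\<bar>\<^sup>-\<^sup>3)\<close> is left of the expansion at infinity, and \<open>\<psi>\<close> is bounded.
\<close>

lemma S4_space_resonance_L2:
  assumes f: "f \<in> S4_space"
  shows "resonance f \<in> L2"
proof -
  have fS: "f \<in> S1_space" using f S4_space_subset by auto
  have c: "T_coeff f = 0" and m: "\<And>b. b \<in> Basis \<Longrightarrow> first_moment b f = 0"
    and M: "\<And>b b'. b \<in> Basis \<Longrightarrow> b' \<in> Basis \<Longrightarrow> second_moment b b' f = 0"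
    using f by (auto simp: S4_space_def S3_space_def S2_space_def)
  have dz: "dipole (\<lambda>b. first_moment b f) x = 0" for x unfolding dipole_def by (simp add: m)
  have qz: "quadrupole (\<lambda>b b'. second_moment b b' f) x = 0" for x unfolding quadrupole_def by (simp add: M)
  obtain C where C: "0 \<le> C" "\<And>x. 1 \<le> norm x \<Longrightarrow> cmod (resonance f x) \<le> C / norm x ^ 3"
    using resonance_expansion[OF fS] unfolding c dz qz by auto
  obtain B where B: "0 \<le> B" "\<And>x. cmod (resonance f x) \<le> B"
    using S1_space_bounded[OF fS] unfolding resonance_def by auto
  \<comment> \<open>the bracket is at most \<open>2 \<bar>x\<bar>\<close> outside the unit ball and at most \<open>2\<close> inside, and \<open>8 = 2\<^sup>3\<close>\<close>
  define K where "K = 8 * (B + C)"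
  have K0: "0 \<le> K" using B C by (simp add: K_def)
  have bound: "cmod (resonance f x) \<le> K / japanese_bracket x ^ 3" for x
  proof -
    have jb: "1 \<le> japanese_bracket x" "japanese_bracket x \<le> 1 + norm x" by (rule japanese_bracket_bounds)+
    show ?thesis
    proof (cases "1 \<le> norm x")
      case True
      have "japanese_bracket x ^ 3 \<le> (2 * norm x) ^ 3" using jb True by (intro power_mono) auto
      then have le: "japanese_bracket x ^ 3 \<le> 8 * norm x ^ 3" by (simp add: power_mult_distrib)
      have "C / norm x ^ 3 = (8 * C) / (8 * norm x ^ 3)" by simp
      also have "\<dots> \<le> (8 * C) / japanese_bracket x ^ 3"
        using le jb C(1) True by (intro divide_left_mono mult_pos_pos zero_less_power) auto
      also have "\<dots> \<le> K / japanese_bracket x ^ 3"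
        using jb B(1) unfolding K_def by (intro divide_right_mono) auto
      finally show ?thesis using C(2)[OF True] by linarith
    next
      case False
      have "japanese_bracket x ^ 3 \<le> 2 ^ 3" using jb False by (intro power_mono) auto
      then have "B * japanese_bracket x ^ 3 \<le> B * 8" using B(1) by (intro mult_left_mono) auto
      also have "\<dots> \<le> K" using C(1) by (simp add: K_def)
      finally have "B \<le> K / japanese_bracket x ^ 3" using jb by (simp add: field_simps)
      then show ?thesis using B(2)[of x] by linarith
    qed
  qed
  show ?thesis
  proof (rule L2_dominated[OF resonance_measurable[OF fS]])
    show "integrable lebesgue (\<lambda>x. K\<^sup>2 * japanese_bracket x powr (- 4 - 2))"
      by (intro integrable_mult_right japanese_bracket_integrable) simp
    have "(cmod (resonance f x))\<^sup>2 \<le> K\<^sup>2 * japanese_bracket x powr (- 4 - 2)" for x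
    proof -
      have jb: "0 < japanese_bracket x" using japanese_bracket_bounds(1)[of x] by linarith
      have "(cmod (resonance f x))\<^sup>2 \<le> (K / japanese_bracket x ^ 3)\<^sup>2"
        using bound[of x] by (intro power_mono) auto
      also have "\<dots> = K\<^sup>2 * (1 / japanese_bracket x ^ 6)" by (simp add: power_divide flip: power_mult)
      also have "1 / japanese_bracket x ^ 6 = japanese_bracket x powr (- 4 - 2)"
        using jb powr_realpow[OF jb, of 6] by (simp add: powr_minus inverse_eq_divide)
      finally show ?thesis .
    qed
    then show "AE x in lebesgue. (cmod (resonance f x))\<^sup>2 \<le> K\<^sup>2 * japanese_bracket x powr (- 4 - 2)" by simp
  qed
qed

text \<open>
  The terms of the expansion are removed one after the other, in the order of decreasing homogeneity.
\<close>

lemma resonance_L2_imp_S4_space: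
  assumes f: "f \<in> S1_space" and L2: "resonance f \<in> L2"
  shows "f \<in> S4_space"
proof -
  define \<kappa> where "\<kappa> = complex_of_real (1 / (8 * pi\<^sup>2))"
  have \<kappa>: "\<kappa> \<noteq> 0" by (simp add: \<kappa>_def)
  let ?d = "dipole (\<lambda>b. first_moment b f)" and ?q = "quadrupole (\<lambda>b b'. second_moment b b' f)"
  obtain C where C: "0 \<le> C"
    "\<And>x. 1 \<le> norm x \<Longrightarrow> cmod (resonance f x - (T_coeff f + \<kappa> * (- ?d x + ?q x))) \<le> C / norm x ^ 3"
    using resonance_expansion[OF f] unfolding \<kappa>_def by auto
  define A where "A = (\<Sum>b\<in>Basis. cmod (first_moment b f))"
  have A: "0 \<le> A" "\<And>x. cmod (?d x) \<le> A / norm x"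
    unfolding A_def by (auto intro: sum_nonneg dipole_bound)
  obtain B where B: "0 \<le> B" "\<And>x. cmod (?q x) \<le> B / (norm x)\<^sup>2"
    using quadrupole_bound by blast
  have pw: "t / norm x ^ j \<le> t / norm x ^ i" if "0 \<le> t" "i \<le> j" "1 \<le> norm x" for t x i j
    using that by (intro divide_left_mono power_increasing mult_pos_pos zero_less_power) auto
  have c0: "T_coeff f = 0"
  proof (rule homogeneous_leading_term_vanishes[OF L2, of 0 "axis 1 1" "\<lambda>x. T_coeff f" "cmod \<kappa> * (A + B) + C"])
    show "(axis 1 1 :: R4) \<noteq> 0" by (simp add: axis_eq_0_iff)
    fix x :: R4 assume x: "1 \<le> norm x"
    have "resonance f x - T_coeff f = (resonance f x - (T_coeff f + \<kappa> * (- ?d x + ?q x))) + \<kappa> * (- ?d x + ?q x)" by simp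
    then have "cmod (resonance f x - T_coeff f) \<le> C / norm x ^ 3 + cmod \<kappa> * cmod (- ?d x + ?q x)"
      using C(2)[OF x] norm_triangle_ineq[of "resonance f x - (T_coeff f + \<kappa> * (- ?d x + ?q x))" "\<kappa> * (- ?d x + ?q x)"]
      by (simp add: norm_mult)
    also have "cmod (- ?d x + ?q x) \<le> A / norm x + B / (norm x)\<^sup>2"
      using norm_triangle_ineq[of "- ?d x" "?q x"] A(2)[of x] B(2)[of x] by simp
    also have "B / (norm x)\<^sup>2 \<le> B / norm x" using pw[OF B(1) _ x, of 1 2] by simp
    also have "C / norm x ^ 3 \<le> C / norm x" using pw[OF C(1) _ x, of 1 3] by simp
    finally show "cmod (resonance f x - T_coeff f) \<le> (cmod \<kappa> * (A + B) + C) / norm x ^ Suc 0"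
      by (simp add: mult_left_mono add_divide_distrib distrib_left)
  qed auto
  have d0: "?d z = 0" if z: "z \<noteq> 0" for z
  proof -
    have "- \<kappa> * ?d z = 0"
    proof (rule homogeneous_leading_term_vanishes[OF L2, of 1 z "\<lambda>x. - \<kappa> * ?d x" "cmod \<kappa> * B + C"])
      show "isCont (\<lambda>x. - \<kappa> * ?d x) z" by (intro continuous_intros dipole_isCont z)
      show "- \<kappa> * ?d (R *\<^sub>R x) = - \<kappa> * ?d x / of_real (R ^ 1)" if "0 < R" for R x
        unfolding dipole_homogeneous[OF that] by simp
      fix x :: R4 assume x: "1 \<le> norm x"
      have "resonance f x - - \<kappa> * ?d x = (resonance f x - (T_coeff f + \<kappa> * (- ?d x + ?q x))) + \<kappa> * ?q x"
        unfolding c0 by (simp add: algebra_simps)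
      then have "cmod (resonance f x - - \<kappa> * ?d x)
          \<le> cmod (resonance f x - (T_coeff f + \<kappa> * (- ?d x + ?q x))) + cmod (\<kappa> * ?q x)"
        by (simp only: norm_triangle_ineq)
      also have "\<dots> \<le> C / norm x ^ 3 + cmod \<kappa> * cmod (?q x)"
        unfolding norm_mult by (rule add_right_mono[OF C(2)[OF x]])
      finally have "cmod (resonance f x - - \<kappa> * ?d x) \<le> C / norm x ^ 3 + cmod \<kappa> * cmod (?q x)" .
      also have "cmod (?q x) \<le> B / (norm x)\<^sup>2" by (rule B(2))
      also have "C / norm x ^ 3 \<le> C / (norm x)\<^sup>2" using pw[OF C(1) _ x, of 2 3] by simp
      finally show "cmod (resonance f x - - \<kappa> * ?d x) \<le> (cmod \<kappa> * B + C) / norm x ^ Suc 1"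
        by (simp add: mult_left_mono add_divide_distrib power2_eq_square)
    qed (use z in auto)
    then show ?thesis using \<kappa> by simp
  qed
  have q0: "?q z = 0" if z: "z \<noteq> 0" for z
  proof -
    have "\<kappa> * ?q z = 0"
    proof (rule homogeneous_leading_term_vanishes[OF L2, of 2 z "\<lambda>x. \<kappa> * ?q x" C])
      show "isCont (\<lambda>x. \<kappa> * ?q x) z" by (intro continuous_intros quadrupole_isCont z)
      show "\<kappa> * ?q (R *\<^sub>R x) = \<kappa> * ?q x / of_real (R ^ 2)" if "0 < R" for R x
        unfolding quadrupole_homogeneous[OF that] by simp
      fix x :: R4 assume x: "1 \<le> norm x"
      then have "x \<noteq> 0" by auto
      then have eq: "resonance f x - \<kappa> * ?q x = resonance f x - (T_coeff f + \<kappa> * (- ?d x + ?q x))"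
        unfolding c0 by (simp add: d0)
      show "cmod (resonance f x - \<kappa> * ?q x) \<le> C / norm x ^ Suc 2"
        unfolding eq using C(2)[OF x] by (simp only: numeral_3_eq_3 numeral_2_eq_2)
    qed (use z in auto)
    then show ?thesis using \<kappa> by simp
  qed
  have "first_moment b f = 0" if "b \<in> Basis" for b
    using dipole_injective[OF d0 that] .
  moreover have "second_moment b b' f = 0" if "b \<in> Basis" "b' \<in> Basis" for b b'
    using quadrupole_injective[of "\<lambda>b b'. second_moment b b' f", OF q0 _ that] by (simp add: mult.commute)
  ultimately show ?thesis using f c0 by (simp add: S4_space_def S3_space_def S2_space_def)
qed

end

theorem lemma7p8:
  fixes V :: "real^4 \<Rightarrow> real" and c2 c4 :: real
    and \<phi> \<psi> :: "real^4 \<Rightarrow> complex" and c0 :: complex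
  assumes V_meas: "V \<in> borel_measurable lebesgue"
    and V_nonzero: "\<not> (AE x in lebesgue. V x = 0)"
    and v_decay: "decays_faster (pot_root V) 4"
    and c2_nonzero: "c2 \<noteq> 0"
    and c4_nonzero: "c4 \<noteq> 0"
    and phi_S1: "\<phi> \<in> range_L2 (S1_op V)"
    and c0_eq: "c0 = (1 / (LINT x|lebesgue. \<bar>V x\<bar>)) *\<^sub>R
                  (LINT x|lebesgue. pot_root V x *\<^sub>R T_op V \<phi> x)"
    and psi_eq: "\<psi> = (\<lambda>x. c0 - G1 (mult_op (pot_root V) \<phi>) x)"
  shows "(AE x in lebesgue. \<phi> x = mult_op (pot_sign V) (mult_op (pot_root V) \<psi>) x)
    \<and> (\<phi> \<in> range_L2 (S4_op V c2 c4) \<longleftrightarrow> \<psi> \<in> L2)"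
proof -
  interpret decaying_potential V by unfold_locales (fact V_meas V_nonzero v_decay)+
  have \<phi>: "\<phi> \<in> S1_space" using phi_S1 by (simp add: range_S1)
  have "(LINT x|lebesgue. pot_root V x *\<^sub>R T_op V \<phi> x) = l2_inner (T_op V \<phi>) vc"
    unfolding l2_inner_def vc_def by (simp add: scaleR_conv_of_real mult.commute)
  then have "c0 = T_coeff \<phi>"
    unfolding c0_eq T_coeff_def inner_vc by (simp add: scaleR_conv_of_real)
  then have \<psi>: "\<psi> = resonance \<phi>" unfolding psi_eq resonance_def[abs_def] by simp
  have "AE x in lebesgue. \<phi> x = mult_op (pot_sign V) (mult_op (pot_root V) \<psi>) x"
    using S1_space_representation[OF \<phi>]
    by eventually_elim (simp add: \<psi> resonance_def mult_op_def[of "pot_sign V"] mult_op_def[of v "resonance \<phi>"] scaleR_conv_of_real)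
  moreover have "\<phi> \<in> range_L2 (S4_op V c2 c4) \<longleftrightarrow> \<psi> \<in> L2"
    unfolding range_S4[OF c2_nonzero c4_nonzero] \<psi>
    using S4_space_resonance_L2 resonance_L2_imp_S4_space[OF \<phi>] by auto
  ultimately show ?thesis by blast
qed

end
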